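(* Let $\mathcal{A},\mathcal{A}'$ be two regular categories and let $\delta,\delta'$ be degree functions on $\mathcal{A},\mathcal{A}'$ respectively. Let $F:\mathcal{A}\rightleftarrows\mathcal{A}':G$ be a pair of adjoint functors, with $G$ left adjoint to $F$, both preserving the degree functions, and such that $G$ preserves pullbacks ($F$ automatically preserves pullbacks). Let $\varepsilon:GF\Rightarrow\mathrm{Id}_{\mathcal{A}}$ and $\eta:\mathrm{Id}_{\mathcal{A}'}\Rightarrow FG$ be the corresponding counit and unit of the adjunction. Assume that for any two arrows $f:x\to y$ in $\mathcal{A}$ and $f':x'\to y'$ in $\mathcal{A}'$ the following two commutative squares are Cartesian: the square with top arrow $\eta_{x'}:x'\to FG(x')$, bottom arrow $\eta_{y'}:y'\to FG(y')$, left vertical arrow $f'$ and right vertical arrow $FG(f')$; and the square with top arrow $\varepsilon_x:GF(x)\to x$, bottom arrow $\varepsilon_y:GF(y)\to y$, left vertical arrow $GF(f)$ and right vertical arrow $f$. Then the functor $\overline{G}$ is left adjoint to the functor $\overline{F}$.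
   Context: $\mathbb{K}$ is a fixed field; all categories considered are well-powered. Following Knop, a category $\mathcal{A}$ is called regular if: it has a terminal object $\mathbf{1}_{\mathcal{A}}$; all morphisms have images (epi-mono factorizations, unique up to isomorphism); the pullback $x\times_z y$ exists whenever $x\to z\leftarrow y$ can be completed to a commutative square by some $w\to x$, $w\to y$; for any epimorphism $x\twoheadrightarrow z$ and any $y\to z$ the pullback $x\times_z y$ exists; epimorphisms are preserved under pullbacks. A degree function on $\mathcal{A}$ is a map $\delta:Epi(\mathcal{A})\to\mathbb{K}$ on the epimorphisms of $\mathcal{A}$ with $\delta(\mathrm{Id}_x)=1$, $\delta(e'e)=\delta(e')\delta(e)$ for composable epimorphisms, and $\delta(e')=\delta(e)$ whenever $e'$ is a pullback of $e$. A relation between $x$ and $y$ is a subobject $r\subset x\times y$. For relations $r\subset x\times y$, $s\subset y\times z$, their product is $r\star s:=\mathrm{im}(r\times_y s\to x\times z)$. The $\mathbb{K}$-linear category $\mathcal{T}^0(\mathcal{A},\delta)$ has objects $[x]$ for $x\in\mathcal{A}$; morphisms $[x]\to[y]$ are formal $\mathbb{K}$-linear combinations of symbols $\langle r\rangle$, $r\subset x\times y$ a relation; composition is $\langle s\rangle\circ\langle r\rangle:=\delta(e)\langle r\star s\rangle$ if $r\times_y s$ exists, where $e:r\times_y s\twoheadrightarrow r\star s$, and $0$ otherwise. $\mathcal{T}(\mathcal{A},\delta)$ is the additive Karoubi completion of $\mathcal{T}^0(\mathcal{A},\delta)$, with symmetric monoidal structure $[x]\otimes[y]:=[x\times y]$.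 A functor $F:\mathcal{A}\to\mathcal{A}'$ preserves the degree functions $\delta,\delta'$ if $F$ preserves epimorphisms and $\delta'(F(e))=\delta(e)$ for every epimorphism $e$ in $\mathcal{A}$ (and similarly for $G:\mathcal{A}'\to\mathcal{A}$, with $\delta(G(e'))=\delta'(e')$). For a functor $F:\mathcal{A}\to\mathcal{A}'$ preserving degree functions and pullbacks, $\overline{F}:\mathcal{T}^0(\mathcal{A},\delta)\to\mathcal{T}^0(\mathcal{A}',\delta')$ is the induced $\mathbb{K}$-linear functor $[x]\mapsto[F(x)]$, $\langle r\rangle\mapsto\langle F(r)\rangle$, where for $r\subset x\times y$ one views $F(r)\subset F(x\times y)$ as a subobject of $F(x)\times F(y)$ via the natural monomorphism $F(x\times y)\to F(x)\times F(y)$; the same symbol denotes its extension $\mathcal{T}(\mathcal{A},\delta)\to\mathcal{T}(\mathcal{A}',\delta')$. The functor $\overline{G}$ in the other direction is defined in the same way.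
   Formalization: "G preserves pullbacks" is taken to include: if a pullback does not exist in A', the pullback of the images under G does not exist in A. Without this the induced functor of G need not respect zero compositions (e.g. disjoint union on pairs of nonempty finite sets). *)

theory Defs
  imports Main "HOL-Library.Poly_Mapping"
begin

section \<open>Categories, functors, adjunctions\<close>

text \<open>Objects and arrows live in HOL types, so hom-sets and collections of subobjects are
  automatically small; in particular every category here is well-powered.\<close>

record ('o, 'm) cat =
  Obj :: "'o set"
  Arr :: "'m set"
  Dom :: "'m \<Rightarrow> 'o"
  Cod :: "'m \<Rightarrow> 'o"
  Ide :: "'o \<Rightarrow> 'm"
  Comp :: "'m \<Rightarrow> 'm \<Rightarrow> 'm"  (infixr \<open>\<cdot>\<index>\<close> 70)

definition hom :: "('o, 'm, 'z) cat_scheme \<Rightarrow> 'o \<Rightarrow> 'o \<Rightarrow> 'm set" where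
  "hom C x y = {f \<in> Arr C. Dom C f = x \<and> Cod C f = y}"

locale category =
  fixes C :: "('o, 'm, 'z) cat_scheme"  (structure)
  assumes Dom_in_Obj: "f \<in> Arr C \<Longrightarrow> Dom C f \<in> Obj C"
    and Cod_in_Obj: "f \<in> Arr C \<Longrightarrow> Cod C f \<in> Obj C"
    and Ide_in_hom: "x \<in> Obj C \<Longrightarrow> Ide C x \<in> hom C x x"
    and Comp_in_hom: "f \<in> hom C x y \<Longrightarrow> g \<in> hom C y z \<Longrightarrow> g \<cdot> f \<in> hom C x z"
    and Comp_Ide: "f \<in> hom C x y \<Longrightarrow> f \<cdot> Ide C x = f"
    and Ide_Comp: "f \<in> hom C x y \<Longrightarrow> Ide C y \<cdot> f = f"
    and Comp_assoc: "f \<in> hom C w x \<Longrightarrow> g \<in> hom C x y \<Longrightarrow> h \<in> hom C y z \<Longrightarrow>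
                       (h \<cdot> g) \<cdot> f = h \<cdot> (g \<cdot> f)"

record ('o, 'm, 'p, 'n) ftor =
  On_obj :: "'o \<Rightarrow> 'p"
  On_arr :: "'m \<Rightarrow> 'n"

definition id_ftor :: "('o, 'm, 'o, 'm) ftor" where
  "id_ftor = \<lparr> On_obj = (\<lambda>x. x), On_arr = (\<lambda>f. f) \<rparr>"

definition comp_ftor ::
    "('p, 'n, 'q, 'l) ftor \<Rightarrow> ('o, 'm, 'p, 'n) ftor \<Rightarrow> ('o, 'm, 'q, 'l) ftor" where
  "comp_ftor G F = \<lparr> On_obj = (\<lambda>x. On_obj G (On_obj F x)), On_arr = (\<lambda>f. On_arr G (On_arr F f)) \<rparr>"

locale cat_functor = dom_cat: category C + cod_cat: category D
  for C :: "('o, 'm, 'z) cat_scheme" and D :: "('p, 'n, 'w) cat_scheme" +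
  fixes F :: "('o, 'm, 'p, 'n) ftor"
  assumes On_obj: "x \<in> Obj C \<Longrightarrow> On_obj F x \<in> Obj D"
    and On_arr: "f \<in> hom C x y \<Longrightarrow> On_arr F f \<in> hom D (On_obj F x) (On_obj F y)"
    and On_Ide: "x \<in> Obj C \<Longrightarrow> On_arr F (Ide C x) = Ide D (On_obj F x)"
    and On_Comp: "f \<in> hom C x y \<Longrightarrow> g \<in> hom C y z \<Longrightarrow>
                    On_arr F (g \<cdot>\<^bsub>C\<^esub> f) = On_arr F g \<cdot>\<^bsub>D\<^esub> On_arr F f"

locale nat_transf = source: cat_functor C D F + target: cat_functor C D G
  for C :: "('o, 'm, 'z) cat_scheme" and D :: "('p, 'n, 'w) cat_scheme"
    and F G :: "('o, 'm, 'p, 'n) ftor" +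
  fixes \<tau> :: "'o \<Rightarrow> 'n"
  assumes component: "x \<in> Obj C \<Longrightarrow> \<tau> x \<in> hom D (On_obj F x) (On_obj G x)"
    and natural: "f \<in> hom C x y \<Longrightarrow> \<tau> y \<cdot>\<^bsub>D\<^esub> On_arr F f = On_arr G f \<cdot>\<^bsub>D\<^esub> \<tau> x"

text \<open>\<open>L : C \<rightarrow> D\<close> is left adjoint to \<open>R : D \<rightarrow> C\<close>, with unit \<open>\<eta>\<close> and counit \<open>\<epsilon>\<close>.\<close>

locale adjunction =
  left: cat_functor C D L + right: cat_functor D C R +
  unit: nat_transf C C id_ftor "comp_ftor R L" \<eta> +
  counit: nat_transf D D "comp_ftor L R" id_ftor \<epsilon>
  for C :: "('o, 'm, 'z) cat_scheme" and D :: "('p, 'n, 'w) cat_scheme"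
    and L :: "('o, 'm, 'p, 'n) ftor" and R :: "('p, 'n, 'o, 'm) ftor"
    and \<eta> :: "'o \<Rightarrow> 'm" and \<epsilon> :: "'p \<Rightarrow> 'n" +
  assumes triangle_left: "x \<in> Obj C \<Longrightarrow>
      \<epsilon> (On_obj L x) \<cdot>\<^bsub>D\<^esub> On_arr L (\<eta> x) = Ide D (On_obj L x)"
    and triangle_right: "y \<in> Obj D \<Longrightarrow>
      On_arr R (\<epsilon> y) \<cdot>\<^bsub>C\<^esub> \<eta> (On_obj R y) = Ide C (On_obj R y)"

definition left_adjoint ::
    "('o, 'm, 'z) cat_scheme \<Rightarrow> ('p, 'n, 'w) cat_scheme \<Rightarrow>
     ('o, 'm, 'p, 'n) ftor \<Rightarrow> ('p, 'n, 'o, 'm) ftor \<Rightarrow> bool" where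
  "left_adjoint C D L R \<longleftrightarrow> (\<exists>\<eta> \<epsilon>. adjunction C D L R \<eta> \<epsilon>)"

section \<open>Regular categories and degree functions\<close>

context
  fixes C :: "('o, 'm, 'z) cat_scheme"  (structure)
begin

definition mono_arr :: "'m \<Rightarrow> bool" where
  "mono_arr m \<longleftrightarrow> m \<in> Arr C \<and>
     (\<forall>f \<in> Arr C. \<forall>g \<in> Arr C. Dom C f = Dom C g \<longrightarrow> Cod C f = Dom C m \<longrightarrow> Cod C g = Dom C m \<longrightarrow>
        m \<cdot> f = m \<cdot> g \<longrightarrow> f = g)"

definition epi_arr :: "'m \<Rightarrow> bool" where
  "epi_arr e \<longleftrightarrow> e \<in> Arr C \<and>
     (\<forall>f \<in> Arr C. \<forall>g \<in> Arr C. Cod C f = Cod C g \<longrightarrow> Dom C f = Cod C e \<longrightarrow> Dom C g = Cod C e \<longrightarrow>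
        f \<cdot> e = g \<cdot> e \<longrightarrow> f = g)"

definition iso_arr :: "'m \<Rightarrow> bool" where
  "iso_arr i \<longleftrightarrow> i \<in> Arr C \<and>
     (\<exists>j \<in> hom C (Cod C i) (Dom C i). j \<cdot> i = Ide C (Dom C i) \<and> i \<cdot> j = Ide C (Cod C i))"

definition terminal_obj :: "'o \<Rightarrow> bool" where
  "terminal_obj t \<longleftrightarrow> t \<in> Obj C \<and> (\<forall>x \<in> Obj C. \<exists>!f. f \<in> hom C x t)"

text \<open>\<open>image_fact f e m\<close>: \<open>f = m \<circ> e\<close> is an epi-mono factorization.\<close>

definition image_fact :: "'m \<Rightarrow> 'm \<Rightarrow> 'm \<Rightarrow> bool" where
  "image_fact f e m \<longleftrightarrow> epi_arr e \<and> mono_arr m \<and> Cod C e = Dom C m \<and> f = m \<cdot> e"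

text \<open>\<open>comm_square f g p q\<close>: \<open>f \<circ> p = g \<circ> q\<close> for \<open>p : w \<rightarrow> x\<close>, \<open>q : w \<rightarrow> y\<close>,
  \<open>f : x \<rightarrow> z\<close>, \<open>g : y \<rightarrow> z\<close>.\<close>

definition comm_square :: "'m \<Rightarrow> 'm \<Rightarrow> 'm \<Rightarrow> 'm \<Rightarrow> bool" where
  "comm_square f g p q \<longleftrightarrow>
     f \<in> Arr C \<and> g \<in> Arr C \<and> p \<in> Arr C \<and> q \<in> Arr C \<and>
     Cod C f = Cod C g \<and> Dom C p = Dom C q \<and> Cod C p = Dom C f \<and> Cod C q = Dom C g \<and>
     f \<cdot> p = g \<cdot> q"

definition is_pullback :: "'m \<Rightarrow> 'm \<Rightarrow> 'm \<Rightarrow> 'm \<Rightarrow> bool" where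
  "is_pullback f g p q \<longleftrightarrow> comm_square f g p q \<and>
     (\<forall>p' q'. comm_square f g p' q' \<longrightarrow>
        (\<exists>!u. u \<in> hom C (Dom C p') (Dom C p) \<and> p \<cdot> u = p' \<and> q \<cdot> u = q'))"

definition has_pullback :: "'m \<Rightarrow> 'm \<Rightarrow> bool" where
  "has_pullback f g \<longleftrightarrow> (\<exists>p q. is_pullback f g p q)"

definition is_product :: "'o \<Rightarrow> 'o \<Rightarrow> 'm \<Rightarrow> 'm \<Rightarrow> bool" where
  "is_product x y p q \<longleftrightarrow>
     p \<in> Arr C \<and> q \<in> Arr C \<and> Dom C p = Dom C q \<and> Cod C p = x \<and> Cod C q = y \<and>
     (\<forall>w \<in> Obj C. \<forall>p' \<in> hom C w x. \<forall>q' \<in> hom C w y.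
        \<exists>!u. u \<in> hom C w (Dom C p) \<and> p \<cdot> u = p' \<and> q \<cdot> u = q')"

end

locale regular_category = category C
  for C :: "('o, 'm, 'z) cat_scheme"  (structure) +
  assumes has_terminal: "\<exists>t. terminal_obj C t"
    and has_image: "f \<in> Arr C \<Longrightarrow> \<exists>e m. image_fact C f e m"
    and image_unique: "image_fact C f e m \<Longrightarrow> image_fact C f e' m' \<Longrightarrow>
          \<exists>i. iso_arr C i \<and> i \<in> hom C (Cod C e) (Cod C e') \<and> i \<cdot> e = e' \<and> m' \<cdot> i = m"
    and has_pullback_of_square: "comm_square C f g p q \<Longrightarrow> has_pullback C f g"
    and has_pullback_of_epi: "epi_arr C f \<Longrightarrow> g \<in> Arr C \<Longrightarrow> Cod C g = Cod C f \<Longrightarrow> has_pullback C f g"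
    and epi_pullback: "is_pullback C f g p q \<Longrightarrow> epi_arr C f \<Longrightarrow> epi_arr C q"

text \<open>Only the values of \<open>\<delta>\<close> on epimorphisms are meaningful.\<close>

definition degree_function :: "('o, 'm, 'z) cat_scheme \<Rightarrow> ('m \<Rightarrow> 'k::field) \<Rightarrow> bool" where
  "degree_function C \<delta> \<longleftrightarrow>
     (\<forall>x \<in> Obj C. \<delta> (Ide C x) = 1) \<and>
     (\<forall>e e'. epi_arr C e \<longrightarrow> epi_arr C e' \<longrightarrow> Cod C e = Dom C e' \<longrightarrow>
        \<delta> (e' \<cdot>\<^bsub>C\<^esub> e) = \<delta> e' * \<delta> e) \<and>
     (\<forall>e g p e'. epi_arr C e \<longrightarrow> is_pullback C e g p e' \<longrightarrow> \<delta> e' = \<delta> e)"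

definition preserves_degree ::
    "('o, 'm, 'z) cat_scheme \<Rightarrow> ('m \<Rightarrow> 'k::field) \<Rightarrow>
     ('p, 'n, 'w) cat_scheme \<Rightarrow> ('n \<Rightarrow> 'k) \<Rightarrow> ('o, 'm, 'p, 'n) ftor \<Rightarrow> bool" where
  "preserves_degree C \<delta> D \<delta>' F \<longleftrightarrow>
     (\<forall>e. epi_arr C e \<longrightarrow> epi_arr D (On_arr F e) \<and> \<delta>' (On_arr F e) = \<delta> e)"

text \<open>Pullbacks are a partial operation in a regular category, and preserving them is understood
  in the sense of partial operations: pullback squares go to pullback squares, and
  \<open>F(x) \<times>\<^bsub>F(z)\<^esub> F(y)\<close> is undefined whenever \<open>x \<times>\<^bsub>z\<^esub> y\<close> is. The second clause holds
  trivially if all pullbacks exist in \<open>C\<close>, and always if \<open>F\<close> is a right adjoint. Without it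
  \<open>\<langle>r\<rangle> \<mapsto> \<langle>F(r)\<rangle>\<close> need not respect the case in which a product of relations is \<open>0\<close>:
  the disjoint union functor \<open>(x\<^sub>1, x\<^sub>2) \<mapsto> x\<^sub>1 + x\<^sub>2\<close> from pairs of nonempty finite
  sets to nonempty finite sets satisfies the first clause but does not induce a functor between the categories \<open>T\<^sup>0\<close> defined below.\<close>

definition preserves_pullbacks ::
    "('o, 'm, 'z) cat_scheme \<Rightarrow> ('p, 'n, 'w) cat_scheme \<Rightarrow> ('o, 'm, 'p, 'n) ftor \<Rightarrow> bool" where
  "preserves_pullbacks C D F \<longleftrightarrow>
     (\<forall>f g p q. is_pullback C f g p q \<longrightarrow>
        is_pullback D (On_arr F f) (On_arr F g) (On_arr F p) (On_arr F q)) \<and>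
     (\<forall>f \<in> Arr C. \<forall>g \<in> Arr C. Cod C f = Cod C g \<longrightarrow> \<not> has_pullback C f g \<longrightarrow>
        \<not> has_pullback D (On_arr F f) (On_arr F g))"

section \<open>Relations\<close>

context
  fixes C :: "('o, 'm, 'z) cat_scheme"  (structure)
begin

definition prod_cone :: "'o \<Rightarrow> 'o \<Rightarrow> 'm \<times> 'm" where
  "prod_cone x y = (SOME (p, q). is_product C x y p q)"

definition pr1 :: "'o \<Rightarrow> 'o \<Rightarrow> 'm" where
  "pr1 x y = fst (prod_cone x y)"

definition pr2 :: "'o \<Rightarrow> 'o \<Rightarrow> 'm" where
  "pr2 x y = snd (prod_cone x y)"

definition has_product :: "'o \<Rightarrow> 'o \<Rightarrow> bool" where
  "has_product x y \<longleftrightarrow> (\<exists>p q. is_product C x y p q)"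

definition prod_obj :: "'o \<Rightarrow> 'o \<Rightarrow> 'o" where
  "prod_obj x y = Dom C (pr1 x y)"

definition tuple :: "'m \<Rightarrow> 'm \<Rightarrow> 'm" where
  "tuple f g = (THE u. u \<in> hom C (Dom C f) (prod_obj (Cod C f) (Cod C g)) \<and>
     pr1 (Cod C f) (Cod C g) \<cdot> u = f \<and> pr2 (Cod C f) (Cod C g) \<cdot> u = g)"

text \<open>A subobject is a class of monomorphisms with a common codomain, modulo isomorphism
  of their domains.\<close>

definition subobj :: "'m \<Rightarrow> 'm set" where
  "subobj m = {n. mono_arr C n \<and> (\<exists>i. iso_arr C i \<and> i \<in> hom C (Dom C n) (Dom C m) \<and> n = m \<cdot> i)}"

definition subobjects :: "'o \<Rightarrow> 'm set set" where
  "subobjects x = subobj ` {m. mono_arr C m \<and> Cod C m = x}"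

text \<open>If \<open>x \<times> y\<close> does not exist, there are no relations between \<open>x\<close> and \<open>y\<close>.\<close>

definition relations :: "'o \<Rightarrow> 'o \<Rightarrow> 'm set set" where
  "relations x y = (if has_product x y then subobjects (prod_obj x y) else {})"

text \<open>The two legs of a relation \<open>r \<subseteq> x \<times> y\<close>, for a chosen representing monomorphism.\<close>

definition rep :: "'m set \<Rightarrow> 'm" where
  "rep r = (SOME m. m \<in> r)"

definition leg1 :: "'o \<Rightarrow> 'o \<Rightarrow> 'm set \<Rightarrow> 'm" where
  "leg1 x y r = pr1 x y \<cdot> rep r"

definition leg2 :: "'o \<Rightarrow> 'o \<Rightarrow> 'm set \<Rightarrow> 'm" where
  "leg2 x y r = pr2 x y \<cdot> rep r"

text \<open>\<open>rel_fact x y z r s (e, m)\<close>: the map \<open>r \<times>\<^bsub>y\<^esub> s \<rightarrow> x \<times> z\<close> has the epi-mono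
  factorization \<open>m \<circ> e\<close>, so that \<open>e : r \<times>\<^bsub>y\<^esub> s \<rightarrow> r \<star> s\<close> and \<open>m\<close> represents \<open>r \<star> s\<close>.
  Existence of \<open>r \<times>\<^bsub>y\<^esub> s\<close> entails that of \<open>x \<times> z\<close> in a regular category.\<close>

definition rel_fact :: "'o \<Rightarrow> 'o \<Rightarrow> 'o \<Rightarrow> 'm set \<Rightarrow> 'm set \<Rightarrow> 'm \<times> 'm \<Rightarrow> bool" where
  "rel_fact x y z r s = (\<lambda>(e, m). \<exists>p q.
     is_pullback C (leg2 x y r) (leg1 y z s) p q \<and>
     image_fact C (tuple (leg1 x y r \<cdot> p) (leg2 y z s \<cdot> q)) e m)"

definition rel_comp ::
    "('m \<Rightarrow> 'k::field) \<Rightarrow> 'o \<Rightarrow> 'o \<Rightarrow> 'o \<Rightarrow> 'm set \<Rightarrow> 'm set \<Rightarrow> ('m set \<Rightarrow>\<^sub>0 'k)" where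
  "rel_comp \<delta> x y z r s =
     (if has_pullback C (leg2 x y r) (leg1 y z s)
      then case SOME em. rel_fact x y z r s em of (e, m) \<Rightarrow> Poly_Mapping.single (subobj m) (\<delta> e)
      else 0)"

end

section \<open>The category \<open>T\<^sup>0(C, \<delta>)\<close>\<close>

text \<open>Categories with an addition on hom-sets; the scalar multiplication plays no role in the
  additive completion.\<close>

record ('o, 'm) preadd_cat = "('o, 'm) cat" +
  Hzero :: "'o \<Rightarrow> 'o \<Rightarrow> 'm"
  Hadd :: "'m \<Rightarrow> 'm \<Rightarrow> 'm"

type_synonym ('o, 'm, 'k) rel_arr = "'o \<times> 'o \<times> ('m set \<Rightarrow>\<^sub>0 'k)"

text \<open>An arrow \<open>(x, y, a) : [x] \<rightarrow> [y]\<close> is the formal linear combination of the \<open>\<langle>r\<rangle>\<close>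
  with coefficients \<open>a\<close>. The identity of \<open>[x]\<close> is the class of the diagonal.\<close>

definition T0 :: "('o, 'm, 'z) cat_scheme \<Rightarrow> ('m \<Rightarrow> 'k::field) \<Rightarrow> ('o, ('o, 'm, 'k) rel_arr) preadd_cat"
  where
  "T0 C \<delta> = \<lparr>
     Obj = Obj C,
     Arr = {(x, y, a). x \<in> Obj C \<and> y \<in> Obj C \<and> Poly_Mapping.keys a \<subseteq> relations C x y},
     Dom = (\<lambda>(x, y, a). x),
     Cod = (\<lambda>(x, y, a). y),
     Ide = (\<lambda>x. (x, x, Poly_Mapping.single (subobj C (tuple C (Ide C x) (Ide C x))) 1)),
     Comp = (\<lambda>(y', z, b) (x, y, a). (x, z,
        \<Sum>r \<in> Poly_Mapping.keys a. \<Sum>s \<in> Poly_Mapping.keys b.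
          Poly_Mapping.map ((*) (Poly_Mapping.lookup b s * Poly_Mapping.lookup a r))
            (rel_comp C \<delta> x y z r s))),
     Hzero = (\<lambda>x y. (x, y, 0)),
     Hadd = (\<lambda>(x, y, a) (x', y', b). (x, y, a + b)) \<rparr>"

text \<open>For \<open>r \<subseteq> x \<times> y\<close>, the subobject \<open>F(r)\<close> of \<open>F(x) \<times> F(y)\<close>, via
  \<open>F(x \<times> y) \<rightarrow> F(x) \<times> F(y)\<close>.\<close>

definition rel_image ::
    "('o, 'm, 'z) cat_scheme \<Rightarrow> ('p, 'n, 'w) cat_scheme \<Rightarrow> ('o, 'm, 'p, 'n) ftor \<Rightarrow>
     'o \<Rightarrow> 'o \<Rightarrow> 'm set \<Rightarrow> 'n set" where
  "rel_image C D F x y r =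
     subobj D (tuple D (On_arr F (pr1 C x y)) (On_arr F (pr2 C x y)) \<cdot>\<^bsub>D\<^esub> On_arr F (rep r))"

definition T0_ftor ::
    "('o, 'm, 'z) cat_scheme \<Rightarrow> ('p, 'n, 'w) cat_scheme \<Rightarrow> ('o, 'm, 'p, 'n) ftor \<Rightarrow>
     ('o, ('o, 'm, 'k::field) rel_arr, 'p, ('p, 'n, 'k) rel_arr) ftor" where
  "T0_ftor C D F = \<lparr>
     On_obj = On_obj F,
     On_arr = (\<lambda>(x, y, a). (On_obj F x, On_obj F y,
        \<Sum>r \<in> Poly_Mapping.keys a.
          Poly_Mapping.single (rel_image C D F x y r) (Poly_Mapping.lookup a r))) \<rparr>"

section \<open>Additive Karoubi completion\<close>

text \<open>Objects of the additive completion are finite lists of objects (formal direct sums). An arrow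
  \<open>(X, Y, M)\<close> is a matrix with entries \<open>M i j : X\<^sub>j \<rightarrow> Y\<^sub>i\<close>, extended by
  \<open>undefined\<close> outside of the index range so that equal matrices are equal arrows.\<close>

type_synonym ('o, 'm) mat_arr = "'o list \<times> 'o list \<times> (nat \<Rightarrow> nat \<Rightarrow> 'm)"

definition mk_mat :: "'o list \<Rightarrow> 'o list \<Rightarrow> (nat \<Rightarrow> nat \<Rightarrow> 'm) \<Rightarrow> ('o, 'm) mat_arr" where
  "mk_mat X Y M = (X, Y, \<lambda>i j. if i < length Y \<and> j < length X then M i j else undefined)"

definition Hsum :: "('o, 'm, 'z) preadd_cat_scheme \<Rightarrow> 'o \<Rightarrow> 'o \<Rightarrow> 'm list \<Rightarrow> 'm" where
  "Hsum C x y fs = foldr (Hadd C) fs (Hzero C x y)"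

definition additive_completion ::
    "('o, 'm, 'z) preadd_cat_scheme \<Rightarrow> ('o list, ('o, 'm) mat_arr) cat" where
  "additive_completion C = \<lparr>
     Obj = lists (Obj C),
     Arr = {(X, Y, M). X \<in> lists (Obj C) \<and> Y \<in> lists (Obj C) \<and> (X, Y, M) = mk_mat X Y M \<and>
              (\<forall>i < length Y. \<forall>j < length X. M i j \<in> hom C (X ! j) (Y ! i))},
     Dom = (\<lambda>(X, Y, M). X),
     Cod = (\<lambda>(X, Y, M). Y),
     Ide = (\<lambda>X. mk_mat X X (\<lambda>i j. if i = j then Ide C (X ! i) else Hzero C (X ! j) (X ! i))),
     Comp = (\<lambda>(Y', Z, N) (X, Y, M). mk_mat X Z (\<lambda>i j.
        Hsum C (X ! j) (Z ! i) (map (\<lambda>k. N i k \<cdot>\<^bsub>C\<^esub> M k j) [0..<length Y]))) \<rparr>"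

definition additive_ftor ::
    "('o, 'm, 'p, 'n) ftor \<Rightarrow> ('o list, ('o, 'm) mat_arr, 'p list, ('p, 'n) mat_arr) ftor" where
  "additive_ftor F = \<lparr>
     On_obj = map (On_obj F),
     On_arr = (\<lambda>(X, Y, M). mk_mat (map (On_obj F) X) (map (On_obj F) Y) (\<lambda>i j. On_arr F (M i j))) \<rparr>"

text \<open>Objects of the Karoubi completion are idempotents \<open>e\<close>, and arrows \<open>e \<rightarrow> e'\<close> are triples
  \<open>(e, f, e')\<close> with \<open>e' \<circ> f = f = f \<circ> e\<close>.\<close>

type_synonym 'm kar_arr = "'m \<times> 'm \<times> 'm"

definition karoubi :: "('o, 'm, 'z) cat_scheme \<Rightarrow> ('m, 'm kar_arr) cat" where
  "karoubi C =
     (let idem = {e \<in> Arr C. Dom C e = Cod C e \<and> e \<cdot>\<^bsub>C\<^esub> e = e} in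
      \<lparr> Obj = idem,
        Arr = {(e, f, e'). e \<in> idem \<and> e' \<in> idem \<and> f \<in> hom C (Dom C e) (Dom C e') \<and>
                 f \<cdot>\<^bsub>C\<^esub> e = f \<and> e' \<cdot>\<^bsub>C\<^esub> f = f},
        Dom = (\<lambda>(e, f, e'). e),
        Cod = (\<lambda>(e, f, e'). e'),
        Ide = (\<lambda>e. (e, e, e)),
        Comp = (\<lambda>(d', g, d) (e, f, e'). (e, g \<cdot>\<^bsub>C\<^esub> f, d)) \<rparr>)"

definition karoubi_ftor :: "('o, 'm, 'p, 'n) ftor \<Rightarrow> ('m, 'm kar_arr, 'n, 'n kar_arr) ftor" where
  "karoubi_ftor F = \<lparr>
     On_obj = On_arr F,
     On_arr = (\<lambda>(e, f, e'). (On_arr F e, On_arr F f, On_arr F e')) \<rparr>"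

type_synonym ('o, 'm, 'k) T_obj = "('o, ('o, 'm, 'k) rel_arr) mat_arr"

definition T :: "('o, 'm, 'z) cat_scheme \<Rightarrow> ('m \<Rightarrow> 'k::field) \<Rightarrow>
    (('o, 'm, 'k) T_obj, ('o, 'm, 'k) T_obj kar_arr) cat" where
  "T C \<delta> = karoubi (additive_completion (T0 C \<delta>))"

definition T_ftor ::
    "('o, 'm, 'z) cat_scheme \<Rightarrow> ('p, 'n, 'w) cat_scheme \<Rightarrow> ('o, 'm, 'p, 'n) ftor \<Rightarrow>
     (('o, 'm, 'k::field) T_obj, ('o, 'm, 'k) T_obj kar_arr,
      ('p, 'n, 'k) T_obj, ('p, 'n, 'k) T_obj kar_arr) ftor" where
  "T_ftor C D F = karoubi_ftor (additive_ftor (T0_ftor C D F))"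

end

theory Submission
  imports Defs
begin

text \<open>A span \<open>x \<leftarrow> w \<rightarrow> y\<close> defines the multiple \<open>\<delta>(e) \<langle>im\<rangle>\<close> of its image, where \<open>e\<close> is the
  epimorphism onto the image. Since \<open>\<delta>\<close> is multiplicative and stable under pullback, such classes
  compose by pulling back spans, and \<open>F\<close> and \<open>G\<close> act on them leg by leg. The unit and counit of the
  induced adjunction are the classes of the graphs of \<open>\<eta>\<close> and \<open>\<epsilon>\<close>: the Cartesian squares say precisely
  that these are natural with respect to relations, and the triangle identities are inherited, because
  forming graphs is functorial. The adjunction then passes to matrices, and to idempotents by replacing
  \<open>\<eta>\<^sub>x\<close> by \<open>\<eta>\<^sub>x \<circ> e\<close> and \<open>\<epsilon>\<^sub>y\<close> by \<open>e \<circ> \<epsilon>\<^sub>y\<close>.\<close>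

section \<open>Linear extension\<close>

text \<open>Working with arbitrary spans avoids images of images: a product of relations is the
  image of a pullback, whereas spans compose by pullback alone, and the image is taken only once, in
  \<open>span_class\<close>. Each basis element is the class of its own pair of legs, so identities
  that are linear in each argument can be tested on spans. The obstacle is that pullbacks are
  partial and an undefined product counts as 0, so every law needs matching zero cases. In a regular
  category a pullback exists as soon as the two arrows can be completed to some commutative square.
  Definedness is therefore a condition on squares: it does not distinguish the two bracketings of a
  triple product, it depends on a span only through its image relation, and for the right adjoint it
  can be transposed along the adjunction. Products may be missing as well; it is a span between two
  objects that provides their product.\<close>

definition scale :: "'k::field \<Rightarrow> ('a \<Rightarrow>\<^sub>0 'k) \<Rightarrow> ('a \<Rightarrow>\<^sub>0 'k)" where
  "scale c = Poly_Mapping.map ((*) c)"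

text \<open>\<open>Poly_Mapping.map\<close> acts on nonzero coefficients only; since
  \<open>c * 0 = 0\<close> the formula holds at every index.\<close>

lemma lookup_scale [simp]: "Poly_Mapping.lookup (scale c a) r = c * Poly_Mapping.lookup a r"
  by (simp add: scale_def map.rep_eq when_def)

lemma scale_simps [simp]:
  "scale c 0 = 0" "scale 0 a = 0" "scale 1 a = a" "scale c (scale d a) = scale (c * d) a"
  "scale c (Poly_Mapping.single r d) = Poly_Mapping.single r (c * d)"
  by (rule poly_mapping_eqI; simp add: lookup_single when_def)+

lemma scale_add_right: "scale c (a + b) = scale c a + scale c b"
  by (rule poly_mapping_eqI) (simp add: lookup_add algebra_simps)

lemma scale_add_left: "scale (c + d) a = scale c a + scale d a"
  by (rule poly_mapping_eqI) (simp add: lookup_add algebra_simps)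

lemma scale_sum: "scale c (sum f I) = (\<Sum>i\<in>I. scale c (f i))"
  by (induction I rule: infinite_finite_induct) (simp_all add: scale_add_right)

lemma keys_scale: "Poly_Mapping.keys (scale c a) \<subseteq> Poly_Mapping.keys a"
  by (auto simp: in_keys_iff)

text \<open>Composition in \<open>T0\<close> and the action of \<open>T0_ftor\<close> on
  coefficients are linear extensions of this kind, so identities between them reduce to basis
  relations.\<close>

definition lin :: "('a \<Rightarrow> 'b \<Rightarrow>\<^sub>0 'k) \<Rightarrow> ('a \<Rightarrow>\<^sub>0 'k) \<Rightarrow> 'b \<Rightarrow>\<^sub>0 'k::field" where
  "lin \<phi> a = (\<Sum>r\<in>Poly_Mapping.keys a. scale (Poly_Mapping.lookup a r) (\<phi> r))"

text \<open>Cancellation can make the keys of \<open>a + b\<close> smaller than the union of the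
  keys of \<open>a\<close> and \<open>b\<close>. Vanishing coefficients contribute 0, so any finite
  superset serves as a common index set.\<close>

lemma lin_superset:
  assumes "finite K" and "Poly_Mapping.keys a \<subseteq> K"
  shows "lin \<phi> a = (\<Sum>r\<in>K. scale (Poly_Mapping.lookup a r) (\<phi> r))"
  unfolding lin_def by (rule sum.mono_neutral_left) (use assms in \<open>auto simp: in_keys_iff\<close>)

lemma lin_zero [simp]: "lin \<phi> 0 = 0"
  by (simp add: lin_def)

lemma lin_add: "lin \<phi> (a + b) = lin \<phi> a + lin \<phi> b"
proof -
  let ?K = "Poly_Mapping.keys a \<union> Poly_Mapping.keys b"
  have "lin \<phi> c = (\<Sum>r\<in>?K. scale (Poly_Mapping.lookup c r) (\<phi> r))"
    if "c \<in> {a, b, a + b}" for c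
    using that keys_add[of a b] by (intro lin_superset) auto
  then show ?thesis
    by (simp add: lookup_add scale_add_left sum.distrib)
qed

lemma lin_scale: "lin \<phi> (scale c a) = scale c (lin \<phi> a)"
  by (subst lin_superset[OF finite_keys keys_scale]) (simp add: lin_def scale_sum)

lemma lin_single [simp]: "lin \<phi> (Poly_Mapping.single r c) = scale c (\<phi> r)"
  by (subst lin_superset[of "{r}"]) auto

lemma lin_sum: "lin \<phi> (sum f I) = (\<Sum>i\<in>I. lin \<phi> (f i))"
  by (induction I rule: infinite_finite_induct) (simp_all add: lin_add)

lemma lin_lin: "lin \<phi> (lin \<psi> a) = lin (\<lambda>r. lin \<phi> (\<psi> r)) a"
  by (simp add: lin_def[of \<psi>] lin_def[of "\<lambda>r. lin \<phi> (\<psi> r)"] lin_sum lin_scale)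

lemma lin_fun_add: "lin (\<lambda>r. \<phi> r + \<psi> r) a = lin \<phi> a + lin \<psi> a"
  by (simp add: lin_def scale_add_right sum.distrib)

lemma lin_fun_zero [simp]: "lin (\<lambda>r. 0) a = 0"
  by (simp add: lin_def)

text \<open>Interchange of two finite sums; the scalars may be reordered because multiplication in a
  field is commutative.\<close>

lemma lin_commute: "lin (\<lambda>r. lin (\<lambda>s. \<phi> r s) b) a = lin (\<lambda>s. lin (\<lambda>r. \<phi> r s) a) b"
  unfolding lin_def by (simp add: scale_sum mult.commute) (rule sum.swap)

lemma lin_cong:
  assumes "\<And>r. r \<in> Poly_Mapping.keys a \<Longrightarrow> \<phi> r = \<psi> r"
  shows "lin \<phi> a = lin \<psi> a"
  using assms by (simp add: lin_def)

text \<open>Every element is the sum of its monomials. This is the form in which identities are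
  shown to act trivially.\<close>

lemma lin_eqI:
  assumes "\<And>r. r \<in> Poly_Mapping.keys a \<Longrightarrow> \<phi> r = Poly_Mapping.single r 1"
  shows "lin \<phi> a = a"
proof -
  have "lin \<phi> a = (\<Sum>r\<in>Poly_Mapping.keys a. Poly_Mapping.single r (Poly_Mapping.lookup a r))"
    using assms by (simp add: lin_def)
  also have "\<dots> = a"
    by (rule poly_mapping_eqI) (auto simp: lookup_sum lookup_single when_def in_keys_iff)
  finally show ?thesis .
qed

lemma keys_lin:
  assumes "\<And>r. r \<in> Poly_Mapping.keys a \<Longrightarrow> Poly_Mapping.keys (\<phi> r) \<subseteq> K"
  shows "Poly_Mapping.keys (lin \<phi> a) \<subseteq> K"
  unfolding lin_def using keys_sum keys_scale assms by fast

section \<open>Categories and pullbacks\<close>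

context category
begin

text \<open>The axioms of \<open>category\<close> speak of \<open>hom\<close>, with objects that
  have to be guessed when they are applied. Phrased with equations between \<open>Dom\<close> and
  \<open>Cod\<close> they become conditional rewrite rules.\<close>

lemma comp_arr [simp]:
  assumes "f \<in> Arr C" and "g \<in> Arr C" and "Dom C g = Cod C f"
  shows "g \<cdot> f \<in> Arr C" and "Dom C (g \<cdot> f) = Dom C f" and "Cod C (g \<cdot> f) = Cod C g"
  using Comp_in_hom[of f "Dom C f" "Cod C f" g "Cod C g"] assms by (auto simp: hom_def)

lemma comp_assoc:
  assumes "f \<in> Arr C" and "g \<in> Arr C" and "h \<in> Arr C" and "Dom C g = Cod C f" and "Dom C h = Cod C g"
  shows "(h \<cdot> g) \<cdot> f = h \<cdot> (g \<cdot> f)"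
  using Comp_assoc[of f "Dom C f" "Cod C f" g "Cod C g" h "Cod C h"] assms by (auto simp: hom_def)

lemma ide_arr [simp]:
  assumes "x \<in> Obj C"
  shows "Ide C x \<in> Arr C" and "Dom C (Ide C x) = x" and "Cod C (Ide C x) = x"
  using Ide_in_hom[OF assms] by (auto simp: hom_def)

lemma comp_ide [simp]: "f \<in> Arr C \<Longrightarrow> Dom C f = x \<Longrightarrow> f \<cdot> Ide C x = f"
  using Comp_Ide[of f x "Cod C f"] by (auto simp: hom_def)

lemma ide_comp [simp]: "f \<in> Arr C \<Longrightarrow> Cod C f = x \<Longrightarrow> Ide C x \<cdot> f = f"
  using Ide_Comp[of f "Dom C f" x] by (auto simp: hom_def)

lemma dom_cod_obj [simp]: "f \<in> Arr C \<Longrightarrow> Dom C f \<in> Obj C" "f \<in> Arr C \<Longrightarrow> Cod C f \<in> Obj C"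
  using Dom_in_Obj Cod_in_Obj by auto

text \<open>Composites are normalised to the right, and a known composite of \<open>f\<close> and
  \<open>p\<close> is no longer a subterm of \<open>f \<cdot> (p \<cdot> u)\<close>; this makes the
  equation applicable again.\<close>

lemma comp_cong:
  assumes "f \<cdot> p = g" and "p \<in> Arr C" "f \<in> Arr C" "u \<in> Arr C" "Dom C f = Cod C p" "Dom C p = Cod C u"
  shows "f \<cdot> (p \<cdot> u) = g \<cdot> u"
  using assms comp_assoc[of u p f] by auto

lemma comp_square:
  assumes "f \<cdot> p = g \<cdot> q" and "f \<in> Arr C" "g \<in> Arr C" "p \<in> Arr C" "q \<in> Arr C" "u \<in> Arr C"
    "Dom C f = Cod C p" "Dom C p = Cod C u" "Dom C g = Cod C q" "Dom C q = Cod C u"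
  shows "f \<cdot> (p \<cdot> u) = g \<cdot> (q \<cdot> u)"
proof -
  have "f \<cdot> (p \<cdot> u) = (f \<cdot> p) \<cdot> u" "g \<cdot> (q \<cdot> u) = (g \<cdot> q) \<cdot> u"
    using assms(2-) by (simp_all add: comp_assoc)
  then show ?thesis
    using assms(1) by simp
qed

lemma mono_cancel:
  assumes "mono_arr C m" and "m \<cdot> f = m \<cdot> g" and "f \<in> Arr C" "g \<in> Arr C"
    and "Dom C f = Dom C g" and "Cod C f = Dom C m" "Cod C g = Dom C m"
  shows "f = g"
  using assms unfolding mono_arr_def by blast

lemma epi_cancel:
  assumes "epi_arr C e" and "f \<cdot> e = g \<cdot> e" and "f \<in> Arr C" "g \<in> Arr C"
    and "Cod C f = Cod C g" and "Dom C f = Cod C e" "Dom C g = Cod C e"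
  shows "f = g"
  using assms unfolding epi_arr_def by blast

lemma epi_arr_arr: "epi_arr C e \<Longrightarrow> e \<in> Arr C" and mono_arr_arr: "mono_arr C m \<Longrightarrow> m \<in> Arr C"
  by (auto simp: epi_arr_def mono_arr_def)

lemma epi_comp:
  assumes "epi_arr C e" and "epi_arr C e'" and "Cod C e = Dom C e'"
  shows "epi_arr C (e' \<cdot> e)"
proof -
  have a: "e \<in> Arr C" "e' \<in> Arr C"
    using assms by (auto simp: epi_arr_arr)
  show ?thesis
    unfolding epi_arr_def
  proof (intro conjI ballI impI)
    fix f g
    assume fg: "f \<in> Arr C" "g \<in> Arr C" "Cod C f = Cod C g" "Dom C f = Cod C (e' \<cdot> e)"
      "Dom C g = Cod C (e' \<cdot> e)" "f \<cdot> e' \<cdot> e = g \<cdot> e' \<cdot> e"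
    have "(f \<cdot> e') \<cdot> e = f \<cdot> e' \<cdot> e" "(g \<cdot> e') \<cdot> e = g \<cdot> e' \<cdot> e"
      using fg(1-5) a assms by (simp_all add: comp_assoc)
    then have "(f \<cdot> e') \<cdot> e = (g \<cdot> e') \<cdot> e"
      using fg(6) by simp
    then have "f \<cdot> e' = g \<cdot> e'"
      using fg a assms by - (rule epi_cancel[OF assms(1)], auto)
    then show "f = g"
      using fg a assms by - (rule epi_cancel[OF assms(2)], auto)
  qed (use a assms in auto)
qed

lemma mono_comp:
  assumes "mono_arr C m" and "mono_arr C m'" and "Cod C m = Dom C m'"
  shows "mono_arr C (m' \<cdot> m)"
proof -
  have a: "m \<in> Arr C" "m' \<in> Arr C"
    using assms by (auto simp: mono_arr_arr)
  show ?thesis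
    unfolding mono_arr_def
  proof (intro conjI ballI impI)
    fix f g
    assume fg: "f \<in> Arr C" "g \<in> Arr C" "Dom C f = Dom C g" "Cod C f = Dom C (m' \<cdot> m)"
      "Cod C g = Dom C (m' \<cdot> m)" "(m' \<cdot> m) \<cdot> f = (m' \<cdot> m) \<cdot> g"
    have "(m' \<cdot> m) \<cdot> f = m' \<cdot> (m \<cdot> f)" "(m' \<cdot> m) \<cdot> g = m' \<cdot> (m \<cdot> g)"
      using fg(1-5) a assms by (simp_all add: comp_assoc)
    then have "m' \<cdot> (m \<cdot> f) = m' \<cdot> (m \<cdot> g)"
      using fg(6) by simp
    then have "m \<cdot> f = m \<cdot> g"
      using fg a assms by - (rule mono_cancel[OF assms(2)], auto)
    then show "f = g"
      using fg a assms by - (rule mono_cancel[OF assms(1)], auto)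
  qed (use a assms in auto)
qed

lemma iso_arrE:
  assumes "iso_arr C i"
  obtains j where "i \<in> Arr C" "j \<in> Arr C" "Dom C j = Cod C i" "Cod C j = Dom C i"
    "j \<cdot> i = Ide C (Dom C i)" "i \<cdot> j = Ide C (Cod C i)" "iso_arr C j"
proof -
  from assms obtain j where j: "i \<in> Arr C" "j \<in> hom C (Cod C i) (Dom C i)"
    "j \<cdot> i = Ide C (Dom C i)" "i \<cdot> j = Ide C (Cod C i)"
    unfolding iso_arr_def by blast
  moreover from j have "iso_arr C j"
    unfolding iso_arr_def by (auto simp: hom_def)
  ultimately show thesis
    by (intro that[of j]) (auto simp: hom_def)
qed

lemma iso_imp_epi:
  assumes "iso_arr C i"
  shows "epi_arr C i"
proof -
  obtain j where j: "i \<in> Arr C" "j \<in> Arr C" "Dom C j = Cod C i" "Cod C j = Dom C i"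
    "i \<cdot> j = Ide C (Cod C i)"
    using iso_arrE[OF assms] by metis
  show ?thesis
    unfolding epi_arr_def
  proof (intro conjI ballI impI)
    fix f g
    assume fg: "f \<in> Arr C" "g \<in> Arr C" "Cod C f = Cod C g" "Dom C f = Cod C i" "Dom C g = Cod C i"
      "f \<cdot> i = g \<cdot> i"
    have "(f \<cdot> i) \<cdot> j = f" "(g \<cdot> i) \<cdot> j = g"
      using fg(1-5) j by (simp_all add: comp_assoc)
    with fg(6) show "f = g"
      by metis
  qed (fact j)
qed

lemma iso_imp_mono:
  assumes "iso_arr C i"
  shows "mono_arr C i"
proof -
  obtain j where j: "i \<in> Arr C" "j \<in> Arr C" "Dom C j = Cod C i" "Cod C j = Dom C i"
    "j \<cdot> i = Ide C (Dom C i)"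
    using iso_arrE[OF assms] by metis
  show ?thesis
    unfolding mono_arr_def
  proof (intro conjI ballI impI)
    fix f g
    assume fg: "f \<in> Arr C" "g \<in> Arr C" "Dom C f = Dom C g" "Cod C f = Dom C i" "Cod C g = Dom C i"
      "i \<cdot> f = i \<cdot> g"
    then have "j \<cdot> (i \<cdot> f) = j \<cdot> (i \<cdot> g)"
      by simp
    then show "f = g"
      using fg j comp_assoc[of f i j] comp_assoc[of g i j] by simp
  qed (fact j)
qed

lemma iso_comp:
  assumes "iso_arr C i" and "iso_arr C i'" and "Cod C i = Dom C i'"
  shows "iso_arr C (i' \<cdot> i)"
proof -
  obtain j where j: "i \<in> Arr C" "j \<in> Arr C" "Dom C j = Cod C i" "Cod C j = Dom C i"
    "j \<cdot> i = Ide C (Dom C i)" "i \<cdot> j = Ide C (Cod C i)"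
    using iso_arrE[OF assms(1)] by metis
  obtain j' where j': "i' \<in> Arr C" "j' \<in> Arr C" "Dom C j' = Cod C i'" "Cod C j' = Dom C i'"
    "j' \<cdot> i' = Ide C (Dom C i')" "i' \<cdot> j' = Ide C (Cod C i')"
    using iso_arrE[OF assms(2)] by metis
  have "(j \<cdot> j') \<cdot> (i' \<cdot> i) = j \<cdot> ((j' \<cdot> i') \<cdot> i)" "(i' \<cdot> i) \<cdot> (j \<cdot> j') = i' \<cdot> ((i \<cdot> j) \<cdot> j')"
    using j(1-4) j'(1-4) assms(3) by (simp_all add: comp_assoc)
  then show ?thesis
    unfolding iso_arr_def using j j' assms
    by (intro conjI bexI[of _ "j \<cdot> j'"]) (auto simp: hom_def)
qed

section \<open>Pullback squares and their pasting\<close>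

lemma comm_squareD:
  assumes "comm_square C f g p q"
  shows "f \<in> Arr C" "g \<in> Arr C" "p \<in> Arr C" "q \<in> Arr C" "Cod C f = Cod C g" "Dom C p = Dom C q"
    "Cod C p = Dom C f" "Cod C q = Dom C g" "f \<cdot> p = g \<cdot> q"
  using assms unfolding comm_square_def by auto

lemma comm_square_sym: "comm_square C f g p q \<Longrightarrow> comm_square C g f q p"
  unfolding comm_square_def by auto

lemma pullback_comm: "is_pullback C f g p q \<Longrightarrow> comm_square C f g p q"
  unfolding is_pullback_def by blast

lemma pullback_ex:
  assumes "is_pullback C f g p q" and "comm_square C f g p' q'"
  obtains u where "u \<in> Arr C" "Dom C u = Dom C p'" "Cod C u = Dom C p" "p \<cdot> u = p'" "q \<cdot> u = q'"
  using assms unfolding is_pullback_def hom_def by blast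

lemma pullback_jointly_mono:
  assumes "is_pullback C f g p q" and "u \<in> Arr C" "v \<in> Arr C" "Dom C u = Dom C v"
    "Cod C u = Dom C p" "Cod C v = Dom C p" and "p \<cdot> u = p \<cdot> v" "q \<cdot> u = q \<cdot> v"
  shows "u = v"
proof -
  note s = comm_squareD[OF pullback_comm[OF assms(1)]]
  have "f \<cdot> (p \<cdot> u) = g \<cdot> (q \<cdot> u)"
    using s assms by (intro comp_square) auto
  then have "comm_square C f g (p \<cdot> u) (q \<cdot> u)"
    unfolding comm_square_def using s assms by simp
  then have "\<exists>!w. w \<in> hom C (Dom C (p \<cdot> u)) (Dom C p) \<and> p \<cdot> w = p \<cdot> u \<and> q \<cdot> w = q \<cdot> u"
    using assms(1) unfolding is_pullback_def by blast
  moreover have "Dom C (p \<cdot> u) = Dom C u"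
    using s assms by simp
  ultimately show ?thesis
    using assms unfolding hom_def by auto
qed

lemma is_pullbackI:
  assumes "comm_square C f g p q"
    and "\<And>p' q'. comm_square C f g p' q' \<Longrightarrow>
      \<exists>u. u \<in> Arr C \<and> Dom C u = Dom C p' \<and> Cod C u = Dom C p \<and> p \<cdot> u = p' \<and> q \<cdot> u = q'"
    and "\<And>u v. u \<in> Arr C \<Longrightarrow> v \<in> Arr C \<Longrightarrow> Dom C u = Dom C v \<Longrightarrow> Cod C u = Dom C p \<Longrightarrow>
      Cod C v = Dom C p \<Longrightarrow> p \<cdot> u = p \<cdot> v \<Longrightarrow> q \<cdot> u = q \<cdot> v \<Longrightarrow> u = v"
  shows "is_pullback C f g p q"
  unfolding is_pullback_def
proof (intro conjI allI impI)
  fix p' q'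
  assume "comm_square C f g p' q'"
  then obtain u where "u \<in> Arr C" "Dom C u = Dom C p'" "Cod C u = Dom C p" "p \<cdot> u = p'" "q \<cdot> u = q'"
    using assms(2) by blast
  then show "\<exists>!u. u \<in> hom C (Dom C p') (Dom C p) \<and> p \<cdot> u = p' \<and> q \<cdot> u = q'"
    using assms(3) unfolding hom_def by (intro ex1I[of _ u]) auto
qed (fact assms(1))

lemma pullback_sym:
  assumes "is_pullback C f g p q"
  shows "is_pullback C g f q p"
proof (rule is_pullbackI)
  show "comm_square C g f q p"
    by (rule comm_square_sym) (rule pullback_comm[OF assms])
  have d: "Dom C p = Dom C q"
    using pullback_comm[OF assms] by (auto simp: comm_square_def)
  fix p' q'
  assume *: "comm_square C g f p' q'"
  show "\<exists>u. u \<in> Arr C \<and> Dom C u = Dom C p' \<and> Cod C u = Dom C q \<and> q \<cdot> u = p' \<and> p \<cdot> u = q'"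
    using pullback_ex[OF assms comm_square_sym[OF *]] d comm_squareD(6)[OF *] by metis
next
  have d: "Dom C p = Dom C q"
    using pullback_comm[OF assms] by (auto simp: comm_square_def)
  fix u v
  assume "u \<in> Arr C" "v \<in> Arr C" "Dom C u = Dom C v" "Cod C u = Dom C q" "Cod C v = Dom C q"
    "q \<cdot> u = q \<cdot> v" "p \<cdot> u = p \<cdot> v"
  then show "u = v"
    using pullback_jointly_mono[OF assms] d by simp
qed

text \<open>A cone is factored through \<open>P\<close> and then through \<open>Q\<close>. The lemma
  serves to replace a leg \<open>f\<close> by \<open>f \<cdot> h\<close>, where \<open>h\<close> is
  an epimorphism onto an image or a projection of another pullback.\<close>

lemma pullback_paste:
  assumes P: "is_pullback C f g p q" and Q: "is_pullback C p h p' q'"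
  shows "is_pullback C (f \<cdot> h) g q' (q \<cdot> p')"
proof (rule is_pullbackI)
  note s = comm_squareD[OF pullback_comm[OF P]] and t = comm_squareD[OF pullback_comm[OF Q]]
  have "(f \<cdot> h) \<cdot> q' = f \<cdot> (p \<cdot> p')"
    unfolding t(9) using s(1-8) t(1-8) by (simp add: comp_assoc)
  also have "\<dots> = g \<cdot> (q \<cdot> p')"
    using s t by (intro comp_square) auto
  finally show "comm_square C (f \<cdot> h) g q' (q \<cdot> p')"
    unfolding comm_square_def using s(1-8) t(1-8) by simp
  fix a b
  assume "comm_square C (f \<cdot> h) g a b"
  note c = comm_squareD[OF this]
  have "comm_square C f g (h \<cdot> a) b"
    unfolding comm_square_def using s t c by (simp add: comp_assoc)
  then obtain u where u: "u \<in> Arr C" "Dom C u = Dom C (h \<cdot> a)" "Cod C u = Dom C p"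
    "p \<cdot> u = h \<cdot> a" "q \<cdot> u = b"
    by (rule pullback_ex[OF P])
  have "comm_square C p h u a"
    unfolding comm_square_def using s t c u by simp
  then obtain v where v: "v \<in> Arr C" "Dom C v = Dom C u" "Cod C v = Dom C p'" "p' \<cdot> v = u" "q' \<cdot> v = a"
    by (rule pullback_ex[OF Q])
  have "(q \<cdot> p') \<cdot> v = b"
    using s t u v by (simp add: comp_assoc)
  then show "\<exists>u. u \<in> Arr C \<and> Dom C u = Dom C a \<and> Cod C u = Dom C q' \<and> q' \<cdot> u = a \<and> (q \<cdot> p') \<cdot> u = b"
    using s t c u v by (intro exI[of _ v]) auto
next
  note s = comm_squareD[OF pullback_comm[OF P]] and t = comm_squareD[OF pullback_comm[OF Q]]
  fix u v
  assume uv: "u \<in> Arr C" "v \<in> Arr C" "Dom C u = Dom C v" "Cod C u = Dom C q'" "Cod C v = Dom C q'"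
    "q' \<cdot> u = q' \<cdot> v" "(q \<cdot> p') \<cdot> u = (q \<cdot> p') \<cdot> v"
  have "p \<cdot> (p' \<cdot> u) = p \<cdot> (p' \<cdot> v)"
    using comp_cong[OF t(9)] comp_assoc[of u q' h] comp_assoc[of v q' h] uv t by simp
  moreover have "q \<cdot> (p' \<cdot> u) = q \<cdot> (p' \<cdot> v)"
    using uv s t comp_assoc[of u p' q] comp_assoc[of v p' q] by simp
  ultimately have "p' \<cdot> u = p' \<cdot> v"
    using uv t by - (rule pullback_jointly_mono[OF P], auto)
  then show "u = v"
    using uv t by - (rule pullback_jointly_mono[OF Q], auto)
qed

lemma pullback_unique:
  assumes P: "is_pullback C f g p q" and Q: "is_pullback C f g p' q'"
  obtains i where "iso_arr C i" "Dom C i = Dom C p'" "Cod C i = Dom C p" "p \<cdot> i = p'" "q \<cdot> i = q'"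
proof -
  note s = comm_squareD[OF pullback_comm[OF P]] and t = comm_squareD[OF pullback_comm[OF Q]]
  obtain u where u: "u \<in> Arr C" "Dom C u = Dom C p'" "Cod C u = Dom C p" "p \<cdot> u = p'" "q \<cdot> u = q'"
    by (rule pullback_ex[OF P pullback_comm[OF Q]])
  obtain v where v: "v \<in> Arr C" "Dom C v = Dom C p" "Cod C v = Dom C p'" "p' \<cdot> v = p" "q' \<cdot> v = q"
    by (rule pullback_ex[OF Q pullback_comm[OF P]])
  have eqs: "p \<cdot> u \<cdot> v = p" "q \<cdot> u \<cdot> v = q" "p' \<cdot> v \<cdot> u = p'" "q' \<cdot> v \<cdot> u = q'"
    using u v s t comp_cong[OF u(4)] comp_cong[OF u(5)] comp_cong[OF v(4)] comp_cong[OF v(5)] by auto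
  have "u \<cdot> v = Ide C (Dom C p)"
    by (rule pullback_jointly_mono[OF P]) (use eqs u(1-3) v(1-3) s t in auto)
  moreover have "v \<cdot> u = Ide C (Dom C p')"
    by (rule pullback_jointly_mono[OF Q]) (use eqs u(1-3) v(1-3) s t in auto)
  ultimately have "iso_arr C u"
    unfolding iso_arr_def using u v by (auto simp: hom_def intro!: bexI[of _ v])
  then show thesis
    using u that by blast
qed

text \<open>Pulling back along an identity changes nothing, which makes composition with the graph
  of an arrow explicit.\<close>

lemma pullback_ide:
  assumes "g \<in> Arr C"
  shows "is_pullback C g (Ide C (Cod C g)) (Ide C (Dom C g)) g"
proof (rule is_pullbackI)
  show "comm_square C g (Ide C (Cod C g)) (Ide C (Dom C g)) g"
    using assms by (simp add: comm_square_def)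
  fix p' q'
  assume "comm_square C g (Ide C (Cod C g)) p' q'"
  note c = comm_squareD[OF this]
  then show "\<exists>u. u \<in> Arr C \<and> Dom C u = Dom C p' \<and> Cod C u = Dom C (Ide C (Dom C g)) \<and>
      Ide C (Dom C g) \<cdot> u = p' \<and> g \<cdot> u = q'"
    using assms by (intro exI[of _ p']) auto
qed (use assms in auto)

text \<open>Turns monicity into a pullback condition, so that functors preserving pullbacks preserve
  monomorphisms.\<close>

lemma mono_iff_pullback:
  assumes "m \<in> Arr C"
  shows "mono_arr C m \<longleftrightarrow> is_pullback C m m (Ide C (Dom C m)) (Ide C (Dom C m))"
proof
  assume m: "mono_arr C m"
  show "is_pullback C m m (Ide C (Dom C m)) (Ide C (Dom C m))"
  proof (rule is_pullbackI)
    show "comm_square C m m (Ide C (Dom C m)) (Ide C (Dom C m))"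
      using assms by (simp add: comm_square_def)
    fix p' q'
    assume "comm_square C m m p' q'"
    note c = comm_squareD[OF this]
    have "p' = q'"
      using c by - (rule mono_cancel[OF m], auto)
    then show "\<exists>u. u \<in> Arr C \<and> Dom C u = Dom C p' \<and> Cod C u = Dom C (Ide C (Dom C m)) \<and>
        Ide C (Dom C m) \<cdot> u = p' \<and> Ide C (Dom C m) \<cdot> u = q'"
      using c by (intro exI[of _ p']) auto
  qed (use assms in auto)
next
  assume P: "is_pullback C m m (Ide C (Dom C m)) (Ide C (Dom C m))"
  show "mono_arr C m"
    unfolding mono_arr_def
  proof (intro conjI ballI impI)
    fix f g
    assume "f \<in> Arr C" "g \<in> Arr C" "Dom C f = Dom C g" "Cod C f = Dom C m"
      "Cod C g = Dom C m" "m \<cdot> f = m \<cdot> g"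
    then have "comm_square C m m f g"
      using assms by (simp add: comm_square_def)
    then obtain u where "u \<in> Arr C" "Cod C u = Dom C (Ide C (Dom C m))"
      "Ide C (Dom C m) \<cdot> u = f" "Ide C (Dom C m) \<cdot> u = g"
      by (rule pullback_ex[OF P])
    then show "f = g"
      by simp
  qed (fact assms)
qed

section \<open>Subobjects and their chosen representatives\<close>

lemma subobj_self: "mono_arr C m \<Longrightarrow> m \<in> subobj C m"
  using mono_arr_arr[of m] unfolding subobj_def iso_arr_def
  by (auto simp: hom_def intro!: exI[of _ "Ide C (Dom C m)"] bexI[of _ "Ide C (Dom C m)"])

text \<open>One inclusion holds for every arrow and every isomorphism into its source; the other is
  the same inclusion applied to the inverse of \<open>i\<close>.\<close>

lemma subobj_comp_iso:
  assumes "mono_arr C m" and "iso_arr C i" and "Cod C i = Dom C m"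
  shows "subobj C (m \<cdot> i) = subobj C m"
proof -
  have *: "subobj C (n \<cdot> k) \<subseteq> subobj C n" if "n \<in> Arr C" "iso_arr C k" "Cod C k = Dom C n" for n k
  proof
    fix l assume "l \<in> subobj C (n \<cdot> k)"
    then obtain h where l: "mono_arr C l" "l = (n \<cdot> k) \<cdot> h"
      and h: "iso_arr C h" "h \<in> hom C (Dom C l) (Dom C (n \<cdot> k))"
      by (auto simp: subobj_def)
    have k: "k \<in> Arr C"
      using that(2) by (simp add: iso_arr_def)
    have h': "h \<in> Arr C" "Dom C h = Dom C l" "Cod C h = Dom C k"
      using h k that by (auto simp: hom_def)
    have "l = n \<cdot> (k \<cdot> h)"
      unfolding l(2) using h' k that by (simp add: comp_assoc)
    moreover have "iso_arr C (k \<cdot> h)"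
      using iso_comp[OF h(1) that(2)] h' by simp
    moreover have "k \<cdot> h \<in> hom C (Dom C l) (Dom C n)"
      using h' k that by (simp add: hom_def)
    ultimately show "l \<in> subobj C n"
      using l(1) unfolding subobj_def by blast
  qed
  obtain j where j: "i \<in> Arr C" "j \<in> Arr C" "Dom C j = Cod C i" "Cod C j = Dom C i"
    "i \<cdot> j = Ide C (Cod C i)" "iso_arr C j"
    using iso_arrE[OF assms(2)] by metis
  have m: "m \<in> Arr C"
    using assms(1) by (rule mono_arr_arr)
  have "(m \<cdot> i) \<cdot> j = m"
    using j m assms by (simp add: comp_assoc)
  then show ?thesis
    using *[of m i] *[of "m \<cdot> i" j] m j assms by auto
qed

text \<open>\<open>rep\<close> is a choice inside the class and agrees with \<open>m\<close> only up
  to an isomorphism, which is therefore handed on to the caller.\<close>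

lemma rep_subobj:
  assumes "mono_arr C m"
  obtains i where "iso_arr C i" "Cod C i = Dom C m" "Dom C (rep (subobj C m)) = Dom C i"
    "rep (subobj C m) = m \<cdot> i" "mono_arr C (rep (subobj C m))" "subobj C (rep (subobj C m)) = subobj C m"
proof -
  have "rep (subobj C m) \<in> subobj C m"
    unfolding rep_def using subobj_self[OF assms] by (rule someI)
  then obtain i where "iso_arr C i" "i \<in> hom C (Dom C (rep (subobj C m))) (Dom C m)"
    "rep (subobj C m) = m \<cdot> i" "mono_arr C (rep (subobj C m))"
    unfolding subobj_def by blast
  then show thesis
    using subobj_comp_iso[OF assms, of i] by (intro that[of i]) (auto simp: hom_def)
qed

end

section \<open>Regular categories\<close>

context regular_category
begin

text \<open>By the completion axiom, definedness of a pullback is a condition on squares alone. The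
  zero case of associativity is decided through it.\<close>

lemma has_pullback_iff: "has_pullback C f g \<longleftrightarrow> (\<exists>p q. comm_square C f g p q)"
  using has_pullback_of_square pullback_comm unfolding has_pullback_def by blast

lemma terminal_eq:
  assumes "terminal_obj C t" and "a \<in> Arr C" "b \<in> Arr C" "Dom C a = Dom C b" "Cod C a = t" "Cod C b = t"
  shows "a = b"
proof -
  have "\<exists>!f. f \<in> hom C (Dom C a) t"
    using assms unfolding terminal_obj_def by auto
  then show ?thesis
    using assms by (auto simp: hom_def)
qed

text \<open>Over a terminal object any two arrows with a common source close to a commutative
  square, so product cones and pullback cones coincide. Products thereby profit from existence and
  preservation of pullbacks.\<close>

lemma product_iff_pullback:
  assumes t: "terminal_obj C t" and "tx \<in> hom C x t" and "ty \<in> hom C y t"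
  shows "is_product C x y p q \<longleftrightarrow> is_pullback C tx ty p q"
proof -
  have cs: "comm_square C tx ty a b \<longleftrightarrow>
      a \<in> Arr C \<and> b \<in> Arr C \<and> Dom C a = Dom C b \<and> Cod C a = x \<and> Cod C b = y" for a b
    using assms terminal_eq[OF t, of "tx \<cdot> a" "ty \<cdot> b"] unfolding comm_square_def by (auto simp: hom_def)
  show ?thesis
  proof
    assume P: "is_product C x y p q"
    show "is_pullback C tx ty p q"
      unfolding is_pullback_def
    proof (intro conjI allI impI)
      show "comm_square C tx ty p q"
        using P unfolding cs is_product_def by auto
      fix p' q'
      assume "comm_square C tx ty p' q'"
      then have "Dom C p' \<in> Obj C" "p' \<in> hom C (Dom C p') x" "q' \<in> hom C (Dom C p') y"
        unfolding cs hom_def by auto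
      then show "\<exists>!u. u \<in> hom C (Dom C p') (Dom C p) \<and> p \<cdot> u = p' \<and> q \<cdot> u = q'"
        using P unfolding is_product_def by blast
    qed
  next
    assume P: "is_pullback C tx ty p q"
    show "is_product C x y p q"
      unfolding is_product_def
    proof (intro conjI ballI)
      fix w p' q'
      assume "p' \<in> hom C w x" "q' \<in> hom C w y"
      then have "comm_square C tx ty p' q'" "w = Dom C p'"
        unfolding cs hom_def by auto
      then show "\<exists>!u. u \<in> hom C w (Dom C p) \<and> p \<cdot> u = p' \<and> q \<cdot> u = q'"
        using P unfolding is_pullback_def by blast
    qed (use pullback_comm[OF P] cs in auto)
  qed
qed

text \<open>Binary products are not among the axioms of a regular category. A span closes to a
  square over the terminal object, and the completion axiom then yields the product of its feet;
  hence \<open>tuple\<close> is meaningful for every span.\<close>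

lemma has_product_of_span:
  assumes "f \<in> Arr C" "g \<in> Arr C" "Dom C f = Dom C g"
  shows "has_product C (Cod C f) (Cod C g)"
proof -
  obtain t where t: "terminal_obj C t"
    using has_terminal by blast
  obtain tx where tx: "tx \<in> hom C (Cod C f) t"
    using t assms unfolding terminal_obj_def by (metis Cod_in_Obj)
  obtain ty where ty: "ty \<in> hom C (Cod C g) t"
    using t assms unfolding terminal_obj_def by (metis Cod_in_Obj)
  have "tx \<cdot> f = ty \<cdot> g"
    using tx ty assms by (intro terminal_eq[OF t]) (auto simp: hom_def)
  then have "comm_square C tx ty f g"
    using tx ty assms by (auto simp: comm_square_def hom_def)
  then have "has_pullback C tx ty"
    by (rule has_pullback_of_square)
  then show ?thesis
    unfolding has_pullback_def has_product_def product_iff_pullback[OF t tx ty] .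
qed

lemma prod_cone:
  assumes "has_product C x y"
  shows "is_product C x y (pr1 C x y) (pr2 C x y)"
proof -
  have "case prod_cone C x y of (p, q) \<Rightarrow> is_product C x y p q"
    unfolding prod_cone_def by (rule someI_ex) (use assms in \<open>auto simp: has_product_def\<close>)
  then show ?thesis
    by (simp add: pr1_def pr2_def case_prod_beta)
qed

lemma pr_arr:
  assumes "has_product C x y"
  shows "pr1 C x y \<in> Arr C" "pr2 C x y \<in> Arr C" "Dom C (pr1 C x y) = prod_obj C x y"
    "Dom C (pr2 C x y) = prod_obj C x y" "Cod C (pr1 C x y) = x" "Cod C (pr2 C x y) = y"
  using prod_cone[OF assms] unfolding is_product_def prod_obj_def by auto

lemma product_jointly_mono:
  assumes "has_product C x y" and "u \<in> Arr C" "v \<in> Arr C" "Dom C u = Dom C v"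
    and "Cod C u = prod_obj C x y" "Cod C v = prod_obj C x y"
    and "pr1 C x y \<cdot> u = pr1 C x y \<cdot> v" "pr2 C x y \<cdot> u = pr2 C x y \<cdot> v"
  shows "u = v"
proof -
  have "\<exists>!w. w \<in> hom C (Dom C u) (Dom C (pr1 C x y)) \<and> pr1 C x y \<cdot> w = pr1 C x y \<cdot> u \<and>
      pr2 C x y \<cdot> w = pr2 C x y \<cdot> u"
    using prod_cone[OF assms(1)] assms pr_arr[OF assms(1)] unfolding is_product_def
    by (auto simp: hom_def)
  then show ?thesis
    using assms pr_arr[OF assms(1)] by (auto simp: hom_def)
qed

lemma tuple:
  assumes "f \<in> Arr C" "g \<in> Arr C" "Dom C f = Dom C g"
  shows "tuple C f g \<in> Arr C" "Dom C (tuple C f g) = Dom C f"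
    "Cod C (tuple C f g) = prod_obj C (Cod C f) (Cod C g)"
    "pr1 C (Cod C f) (Cod C g) \<cdot> tuple C f g = f" "pr2 C (Cod C f) (Cod C g) \<cdot> tuple C f g = g"
proof -
  have "\<exists>!u. u \<in> hom C (Dom C f) (prod_obj C (Cod C f) (Cod C g)) \<and>
      pr1 C (Cod C f) (Cod C g) \<cdot> u = f \<and> pr2 C (Cod C f) (Cod C g) \<cdot> u = g"
  proof -
    have "Dom C f \<in> Obj C" "f \<in> hom C (Dom C f) (Cod C f)" "g \<in> hom C (Dom C f) (Cod C g)"
      using assms by (auto simp: hom_def)
    then show ?thesis
      using prod_cone[OF has_product_of_span[OF assms]] unfolding is_product_def prod_obj_def by blast
  qed
  from theI'[OF this]
  show "tuple C f g \<in> Arr C" "Dom C (tuple C f g) = Dom C f"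
    "Cod C (tuple C f g) = prod_obj C (Cod C f) (Cod C g)"
    "pr1 C (Cod C f) (Cod C g) \<cdot> tuple C f g = f" "pr2 C (Cod C f) (Cod C g) \<cdot> tuple C f g = g"
    unfolding tuple_def hom_def by auto
qed

lemma tuple_eqI:
  assumes "has_product C x y" and "u \<in> Arr C" "Cod C u = prod_obj C x y"
  shows "tuple C (pr1 C x y \<cdot> u) (pr2 C x y \<cdot> u) = u"
proof -
  note p = pr_arr[OF assms(1)]
  show ?thesis
    using tuple[of "pr1 C x y \<cdot> u" "pr2 C x y \<cdot> u"] p assms
    by - (rule product_jointly_mono[OF assms(1)], auto)
qed

lemma tuple_comp:
  assumes "f \<in> Arr C" "g \<in> Arr C" "Dom C f = Dom C g" "u \<in> Arr C" "Cod C u = Dom C f"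
  shows "tuple C (f \<cdot> u) (g \<cdot> u) = tuple C f g \<cdot> u"
proof -
  note p = pr_arr[OF has_product_of_span[OF assms(1-3)]] and t = tuple[OF assms(1-3)]
  show ?thesis
    using tuple_eqI[OF has_product_of_span[OF assms(1-3)], of "tuple C f g \<cdot> u"] assms p t
      comp_cong[OF t(4)] comp_cong[OF t(5)] by simp
qed

end

section \<open>The category of relations\<close>

text \<open>The factorization is an arbitrary choice, made harmless by
  \<open>span_class_eq\<close>.\<close>

definition span_class :: "('o, 'm, 'z) cat_scheme \<Rightarrow> ('m \<Rightarrow> 'k::field) \<Rightarrow> 'm \<Rightarrow> 'm \<Rightarrow> 'm set \<Rightarrow>\<^sub>0 'k" where
  "span_class C \<delta> f g =
     (case SOME (e, m). image_fact C (tuple C f g) e m of (e, m) \<Rightarrow> Poly_Mapping.single (subobj C m) (\<delta> e))"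

text \<open>The arguments stand in diagrammatic order, the morphism from \<open>x\<close> to
  \<open>y\<close> first, as in \<open>rel_comp\<close>; composition in \<open>T0\<close> takes them
  the other way round.\<close>

definition lin_comp :: "('o, 'm, 'z) cat_scheme \<Rightarrow> ('m \<Rightarrow> 'k::field) \<Rightarrow> 'o \<Rightarrow> 'o \<Rightarrow> 'o \<Rightarrow>
    ('m set \<Rightarrow>\<^sub>0 'k) \<Rightarrow> ('m set \<Rightarrow>\<^sub>0 'k) \<Rightarrow> ('m set \<Rightarrow>\<^sub>0 'k)" where
  "lin_comp C \<delta> x y z a b = lin (\<lambda>r. lin (\<lambda>s. rel_comp C \<delta> x y z r s) b) a"

lemma T0_simps:
  "Obj (T0 C \<delta>) = Obj C"
  "Arr (T0 C \<delta>) = {(x, y, a). x \<in> Obj C \<and> y \<in> Obj C \<and> Poly_Mapping.keys a \<subseteq> relations C x y}"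
  "Dom (T0 C \<delta>) (x, y, a) = x" "Cod (T0 C \<delta>) (x, y, a) = y"
  "Hzero (T0 C \<delta>) x y = (x, y, 0)" "Hadd (T0 C \<delta>) (x, y, a) (x', y', b) = (x, y, a + b)"
  "Ide (T0 C \<delta>) x = (x, x, Poly_Mapping.single (subobj C (tuple C (Ide C x) (Ide C x))) 1)"
  "Comp (T0 C \<delta>) (y', z, b) (x, y, a) = (x, z, lin_comp C \<delta> x y z a b)"
  by (simp_all add: T0_def lin_comp_def lin_def scale_sum flip: scale_def)
    (simp add: scale_def[symmetric] mult.commute)

lemma hom_T0: "hom (T0 C \<delta>) x y =
    {(x, y, a) |a. x \<in> Obj C \<and> y \<in> Obj C \<and> Poly_Mapping.keys a \<subseteq> relations C x y}"
  by (auto simp: hom_def T0_simps)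

section \<open>Degrees and classes of spans\<close>

locale degree_category = regular_category C
  for C :: "('o, 'm, 'z) cat_scheme"  (structure) +
  fixes \<delta> :: "'m \<Rightarrow> 'k::field"
  assumes degree: "degree_function C \<delta>"
begin

lemma degree_ide: "x \<in> Obj C \<Longrightarrow> \<delta> (Ide C x) = 1"
  and degree_comp: "epi_arr C e \<Longrightarrow> epi_arr C e' \<Longrightarrow> Cod C e = Dom C e' \<Longrightarrow> \<delta> (e' \<cdot> e) = \<delta> e' * \<delta> e"
  and degree_pullback: "epi_arr C e \<Longrightarrow> is_pullback C e g p e' \<Longrightarrow> \<delta> e' = \<delta> e"
  using degree unfolding degree_function_def by blast+

text \<open>Multiplicativity only shows that the degrees of an isomorphism and its inverse are
  inverse to each other. But an isomorphism is also a pullback of an identity, and identities have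
  degree 1.\<close>

lemma degree_iso:
  assumes "iso_arr C i"
  shows "\<delta> i = 1"
proof -
  obtain j where j: "i \<in> Arr C" "j \<in> Arr C" "Dom C j = Cod C i" "Cod C j = Dom C i"
    "j \<cdot> i = Ide C (Dom C i)" "i \<cdot> j = Ide C (Cod C i)"
    using iso_arrE[OF assms] by metis
  have "is_pullback C (Ide C (Cod C i)) (Ide C (Cod C i)) i i"
  proof (rule is_pullbackI)
    show "comm_square C (Ide C (Cod C i)) (Ide C (Cod C i)) i i"
      using j by (simp add: comm_square_def)
    fix p q
    assume "comm_square C (Ide C (Cod C i)) (Ide C (Cod C i)) p q"
    note c = comm_squareD[OF this]
    have "i \<cdot> (j \<cdot> p) = p"
      using comp_cong[OF j(6), of p] j c by simp
    then show "\<exists>u. u \<in> Arr C \<and> Dom C u = Dom C p \<and> Cod C u = Dom C i \<and> i \<cdot> u = p \<and> i \<cdot> u = q"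
      using j c by (intro exI[of _ "j \<cdot> p"]) auto
  next
    fix u v
    assume "u \<in> Arr C" "v \<in> Arr C" "Dom C u = Dom C v" "Cod C u = Dom C i" "Cod C v = Dom C i"
      "i \<cdot> u = i \<cdot> v"
    then show "u = v"
      by - (rule mono_cancel[OF iso_imp_mono[OF assms]])
  qed
  moreover have "epi_arr C (Ide C (Cod C i))"
    using j by (intro iso_imp_epi) (auto simp: iso_arr_def hom_def intro!: bexI[of _ "Ide C (Cod C i)"])
  ultimately show ?thesis
    using degree_pullback degree_ide j(1) by (metis dom_cod_obj(2))
qed

text \<open>Two factorizations differ by an isomorphism, which has degree 1 and leaves the subobject
  unchanged.\<close>

lemma span_class_eq:
  assumes "image_fact C (tuple C f g) e m"
  shows "span_class C \<delta> f g = Poly_Mapping.single (subobj C m) (\<delta> e)"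
proof -
  have "case SOME (e, m). image_fact C (tuple C f g) e m of (e, m) \<Rightarrow> image_fact C (tuple C f g) e m"
    by (rule someI_ex) (use assms in auto)
  then obtain e' m' where s: "(SOME (e, m). image_fact C (tuple C f g) e m) = (e', m')"
    and im: "image_fact C (tuple C f g) e' m'"
    by (auto split: prod.splits)
  from image_unique[OF assms im]
  obtain i where i: "iso_arr C i" "i \<in> hom C (Cod C e) (Cod C e')" "i \<cdot> e = e'" "m' \<cdot> i = m"
    by blast
  have "\<delta> e' = \<delta> i * \<delta> e"
    using i assms degree_comp[of e i] iso_imp_epi[of i] by (auto simp: image_fact_def hom_def)
  moreover have "subobj C m = subobj C m'"
    using subobj_comp_iso[of m' i] i im by (auto simp: image_fact_def hom_def)
  ultimately show ?thesis
    using s i degree_iso by (simp add: span_class_def)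
qed

text \<open>Precomposition with \<open>e\<close> keeps the image and only enlarges the epimorphic
  part; by multiplicativity \<open>\<delta> e\<close> comes out as a scalar.\<close>

lemma span_class_epi:
  assumes "f \<in> Arr C" "g \<in> Arr C" "Dom C f = Dom C g" "epi_arr C e" "Cod C e = Dom C f"
  shows "span_class C \<delta> (f \<cdot> e) (g \<cdot> e) = scale (\<delta> e) (span_class C \<delta> f g)"
proof -
  note t = tuple[OF assms(1-3)]
  obtain e' m where im: "image_fact C (tuple C f g) e' m"
    using has_image[OF t(1)] by blast
  have e: "e \<in> Arr C" "e' \<in> Arr C" "m \<in> Arr C" "Dom C e' = Dom C f" "Cod C e' = Dom C m"
    using im assms t comp_arr[of e' m] by (auto simp: image_fact_def epi_arr_arr mono_arr_arr)
  have im': "image_fact C (tuple C (f \<cdot> e) (g \<cdot> e)) (e' \<cdot> e) m"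
    using im assms t e epi_comp[of e e'] by (simp add: image_fact_def tuple_comp comp_assoc)
  show ?thesis
    using span_class_eq[OF im] span_class_eq[OF im'] degree_comp[of e e'] im assms e
    by (simp add: image_fact_def mult.commute)
qed

lemma span_class_iso:
  assumes "f \<in> Arr C" "g \<in> Arr C" "Dom C f = Dom C g" "iso_arr C e" "Cod C e = Dom C f"
  shows "span_class C \<delta> (f \<cdot> e) (g \<cdot> e) = span_class C \<delta> f g"
  using span_class_epi[OF assms(1-3) iso_imp_epi[OF assms(4)] assms(5)] degree_iso[OF assms(4)] by simp

text \<open>Two pullbacks of the same arrows differ by an isomorphism of their apexes, which the
  class of a span does not see.\<close>

lemma span_class_unique_pullback:
  assumes "is_pullback C g h p q" "is_pullback C g h p' q'" "f \<in> Arr C" "k \<in> Arr C"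
    "Dom C f = Dom C g" "Dom C h = Dom C k"
  shows "span_class C \<delta> (f \<cdot> p) (k \<cdot> q) = span_class C \<delta> (f \<cdot> p') (k \<cdot> q')"
proof -
  note s = comm_squareD[OF pullback_comm[OF assms(1)]]
  obtain i where i: "iso_arr C i" "Dom C i = Dom C p'" "Cod C i = Dom C p" "p \<cdot> i = p'" "q \<cdot> i = q'"
    by (rule pullback_unique[OF assms(1,2)])
  have "i \<in> Arr C"
    using i by (simp add: iso_arr_def)
  then have "f \<cdot> p' = (f \<cdot> p) \<cdot> i" "k \<cdot> q' = (k \<cdot> q) \<cdot> i"
    using i s assms by (auto simp: comp_assoc)
  then show ?thesis
    using i s assms by (simp add: span_class_iso)
qed

text \<open>Gathers what is known about the chosen representative, so that a relation can be handled
  through its two legs; these determine it because their tuple is \<open>rep r\<close>.\<close>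

lemma relation:
  assumes "r \<in> relations C x y"
  shows "has_product C x y" "mono_arr C (rep r)" "subobj C (rep r) = r"
    "leg1 C x y r \<in> Arr C" "leg2 C x y r \<in> Arr C"
    "Dom C (leg1 C x y r) = Dom C (rep r)" "Dom C (leg2 C x y r) = Dom C (rep r)"
    "Cod C (leg1 C x y r) = x" "Cod C (leg2 C x y r) = y"
    "tuple C (leg1 C x y r) (leg2 C x y r) = rep r"
    "x \<in> Obj C" "y \<in> Obj C"
proof -
  from assms obtain m where h: "has_product C x y" and m: "mono_arr C m" "Cod C m = prod_obj C x y"
    "r = subobj C m"
    by (auto simp: relations_def subobjects_def split: if_splits)
  obtain i where i: "iso_arr C i" "Cod C i = Dom C m" "rep (subobj C m) = m \<cdot> i"
    and r: "mono_arr C (rep (subobj C m))" "subobj C (rep (subobj C m)) = subobj C m"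
    by (rule rep_subobj[OF m(1)])
  have c: "Cod C (rep r) = prod_obj C x y" "rep r \<in> Arr C"
    using m i r mono_arr_arr[OF m(1)] mono_arr_arr[OF r(1)] by (auto simp: iso_arr_def)
  show "has_product C x y" "mono_arr C (rep r)" "subobj C (rep r) = r"
    using h m r by auto
  note p = pr_arr[OF h]
  show "leg1 C x y r \<in> Arr C" "leg2 C x y r \<in> Arr C"
    "Dom C (leg1 C x y r) = Dom C (rep r)" "Dom C (leg2 C x y r) = Dom C (rep r)"
    "Cod C (leg1 C x y r) = x" "Cod C (leg2 C x y r) = y"
    "tuple C (leg1 C x y r) (leg2 C x y r) = rep r"
    using p c tuple_eqI[OF h, of "rep r"] by (auto simp: leg1_def leg2_def)
  show "x \<in> Obj C" "y \<in> Obj C"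
    using p by (metis dom_cod_obj(2))+
qed

text \<open>A monomorphism factors with an identity, of degree 1, as epimorphic part. The basis of
  each space of morphisms thus consists of classes of spans, and this is what reduces multilinear
  identities to spans.\<close>

lemma span_class_relation:
  assumes "r \<in> relations C x y"
  shows "span_class C \<delta> (leg1 C x y r) (leg2 C x y r) = Poly_Mapping.single r 1"
proof -
  note r = relation[OF assms]
  have a: "rep r \<in> Arr C"
    using r by (simp add: mono_arr_arr)
  have i: "iso_arr C (Ide C (Dom C (rep r)))"
    using a by (auto simp: iso_arr_def hom_def intro!: bexI[of _ "Ide C (Dom C (rep r))"])
  have "image_fact C (tuple C (leg1 C x y r) (leg2 C x y r)) (Ide C (Dom C (rep r))) (rep r)"
    using r a iso_imp_epi[OF i] by (simp add: image_fact_def)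
  then show ?thesis
    using r degree_iso[OF i] span_class_eq by simp
qed

text \<open>Image factorization exhibits a span as the legs of a relation precomposed with one
  epimorphism. Statements about spans are brought back to relations in this way.\<close>

lemma span_class_cases:
  assumes "f \<in> Arr C" "g \<in> Arr C" "Dom C f = Dom C g"
  obtains r e where "r \<in> relations C (Cod C f) (Cod C g)" "epi_arr C e" "Dom C e = Dom C f"
    "Cod C e = Dom C (rep r)" "f = leg1 C (Cod C f) (Cod C g) r \<cdot> e" "g = leg2 C (Cod C f) (Cod C g) r \<cdot> e"
    "span_class C \<delta> f g = Poly_Mapping.single r (\<delta> e)"
proof -
  note t = tuple[OF assms] and h = has_product_of_span[OF assms]
  obtain e m where im: "image_fact C (tuple C f g) e m"
    using has_image[OF t(1)] by blast
  let ?r = "subobj C m"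
  have e: "e \<in> Arr C" "m \<in> Arr C" "Dom C e = Dom C f" "Cod C e = Dom C m"
    "Cod C m = prod_obj C (Cod C f) (Cod C g)"
    using im assms t comp_arr[of e m] by (auto simp: image_fact_def epi_arr_arr mono_arr_arr)
  have m: "mono_arr C m" "epi_arr C e"
    using im by (auto simp: image_fact_def)
  have rel: "?r \<in> relations C (Cod C f) (Cod C g)"
    using h e m by (auto simp: relations_def subobjects_def)
  obtain i where i: "iso_arr C i" "Cod C i = Dom C m" "Dom C (rep ?r) = Dom C i" "rep ?r = m \<cdot> i"
    by (rule rep_subobj[OF m(1)])
  \<comment> \<open>The image \<open>m\<close> and the chosen \<open>rep ?r\<close> differ by
    \<open>i\<close>; the inverse \<open>j\<close> is absorbed into the epimorphism.\<close>
  obtain j where j: "i \<in> Arr C" "j \<in> Arr C" "Dom C j = Cod C i" "Cod C j = Dom C i"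
    "i \<cdot> j = Ide C (Cod C i)" "iso_arr C j"
    using iso_arrE[OF i(1)] by metis
  note r = relation[OF rel]
  have tu: "tuple C f g = rep ?r \<cdot> (j \<cdot> e)"
  proof -
    have "rep ?r \<cdot> (j \<cdot> e) = m \<cdot> ((i \<cdot> j) \<cdot> e)"
      unfolding i(4) using e i(2) j(1-4) by (simp add: comp_assoc)
    also have "\<dots> = m \<cdot> e"
      using e i j by simp
    finally show ?thesis
      using im by (simp add: image_fact_def)
  qed
  note p = pr_arr[OF h]
  have R: "rep ?r \<in> Arr C" "Cod C (rep ?r) = prod_obj C (Cod C f) (Cod C g)"
    using i j e by auto
  have f: "f = leg1 C (Cod C f) (Cod C g) ?r \<cdot> (j \<cdot> e)"
    unfolding leg1_def using p R i j e t(4) tu comp_assoc[of "j \<cdot> e" "rep ?r"] by simp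
  have g: "g = leg2 C (Cod C f) (Cod C g) ?r \<cdot> (j \<cdot> e)"
    unfolding leg2_def using p R i j e t(5) tu comp_assoc[of "j \<cdot> e" "rep ?r"] by simp
  have ep: "epi_arr C (j \<cdot> e)"
    using epi_comp iso_imp_epi i j e m by simp
  have "image_fact C (tuple C f g) (j \<cdot> e) (rep ?r)"
    using tu r i j e ep by (simp add: image_fact_def)
  then have "span_class C \<delta> f g = Poly_Mapping.single ?r (\<delta> (j \<cdot> e))"
    using r span_class_eq by simp
  then show thesis
    using rel ep f g i j e by (intro that[of ?r "j \<cdot> e"]) auto
qed

lemma keys_span_class:
  assumes "f \<in> Arr C" "g \<in> Arr C" "Dom C f = Dom C g" "Cod C f = x" "Cod C g = y"
  shows "Poly_Mapping.keys (span_class C \<delta> f g) \<subseteq> relations C x y"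
  by (rule span_class_cases[OF assms(1-3)]) (use assms in auto)

text \<open>\<open>rel_comp\<close> chooses a factorization and, hidden in \<open>rel_fact\<close>,
  a pullback that need not be the given one. The class of the resulting span is independent of both
  choices.\<close>

lemma rel_comp_pullback:
  assumes r: "r \<in> relations C x y" and s: "s \<in> relations C y z"
    and P: "is_pullback C (leg2 C x y r) (leg1 C y z s) p q"
  shows "rel_comp C \<delta> x y z r s = span_class C \<delta> (leg1 C x y r \<cdot> p) (leg2 C y z s \<cdot> q)"
proof -
  note R = relation[OF r] and S = relation[OF s] and c = comm_squareD[OF pullback_comm[OF P]]
  obtain e0 m0 where "image_fact C (tuple C (leg1 C x y r \<cdot> p) (leg2 C y z s \<cdot> q)) e0 m0"
    using has_image[OF tuple(1)[of "leg1 C x y r \<cdot> p" "leg2 C y z s \<cdot> q"]] R S c by auto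
  then have "\<exists>em. rel_fact C x y z r s em"
    using P by (auto simp: rel_fact_def)
  then have "rel_fact C x y z r s (SOME em. rel_fact C x y z r s em)"
    by (rule someI_ex)
  then obtain e m p' q' where em: "(SOME em. rel_fact C x y z r s em) = (e, m)"
    and P': "is_pullback C (leg2 C x y r) (leg1 C y z s) p' q'"
    and im: "image_fact C (tuple C (leg1 C x y r \<cdot> p') (leg2 C y z s \<cdot> q')) e m"
    by (auto simp: rel_fact_def split: prod.splits)
  have "rel_comp C \<delta> x y z r s = Poly_Mapping.single (subobj C m) (\<delta> e)"
    using P em by (auto simp: rel_comp_def has_pullback_def)
  also have "\<dots> = span_class C \<delta> (leg1 C x y r \<cdot> p') (leg2 C y z s \<cdot> q')"
    using span_class_eq[OF im] by simp
  also have "\<dots> = span_class C \<delta> (leg1 C x y r \<cdot> p) (leg2 C y z s \<cdot> q)"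
    using R S by (intro span_class_unique_pullback[OF P' P]) auto
  finally show ?thesis .
qed

section \<open>Composition of classes of spans\<close>

lemma lin_comp_single:
  "lin_comp C \<delta> x y z (Poly_Mapping.single r c) (Poly_Mapping.single s d) =
     scale (c * d) (rel_comp C \<delta> x y z r s)"
  by (simp add: lin_comp_def)

text \<open>The pullback of the spans arises from the pullback of their image relations by pulling
  back along the epimorphisms \<open>e\<close> and \<open>e'\<close>. By stability of degrees, the
  comparison map \<open>p2 \<cdot> p3\<close> is an epimorphism of degree
  \<open>\<delta> e * \<delta> e'\<close>, which is exactly the scalar by which the two classes
  differ from the basis relations.\<close>

lemma span_comp:
  assumes P: "is_pullback C g h p q" and f: "f \<in> Arr C" "Dom C f = Dom C g"
    and k: "k \<in> Arr C" "Dom C k = Dom C h" and xyz: "Cod C f = x" "Cod C g = y" "Cod C k = z"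
  shows "lin_comp C \<delta> x y z (span_class C \<delta> f g) (span_class C \<delta> h k) = span_class C \<delta> (f \<cdot> p) (k \<cdot> q)"
proof -
  note c = comm_squareD[OF pullback_comm[OF P]]
  obtain r e where r: "r \<in> relations C x y" and e: "epi_arr C e" "Dom C e = Dom C f"
    "Cod C e = Dom C (rep r)" "f = leg1 C x y r \<cdot> e" "g = leg2 C x y r \<cdot> e"
    and fg: "span_class C \<delta> f g = Poly_Mapping.single r (\<delta> e)"
    using span_class_cases[of f g] f c xyz by metis
  have Codh: "Cod C h = y"
    using c xyz by simp
  obtain s e' where s: "s \<in> relations C y z" and e': "epi_arr C e'" "Dom C e' = Dom C h"
    "Cod C e' = Dom C (rep s)" "h = leg1 C y z s \<cdot> e'" "k = leg2 C y z s \<cdot> e'"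
    and hk: "span_class C \<delta> h k = Poly_Mapping.single s (\<delta> e')"
    using span_class_cases[of h k] k c xyz unfolding Codh by metis
  let ?f = "leg1 C x y r" and ?g = "leg2 C x y r" and ?h = "leg1 C y z s" and ?k = "leg2 C y z s"
  note R = relation[OF r] and S = relation[OF s]
  have ea: "e \<in> Arr C" "e' \<in> Arr C"
    using e e' by (auto simp: epi_arr_arr)
  \<comment> \<open>Pushing the given square forward along the epimorphisms shows that the legs of
    the relations have a pullback, too.\<close>
  have "comm_square C ?g ?h (e \<cdot> p) (e' \<cdot> q)"
  proof -
    have "?g \<cdot> (e \<cdot> p) = g \<cdot> p" "?h \<cdot> (e' \<cdot> q) = h \<cdot> q"
      unfolding e(5) e'(4) using c(1-8) e(2,3) e'(2,3) ea R S f k by (simp_all add: comp_assoc)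
    then show ?thesis
      unfolding comm_square_def using c(1-8) c(9) e(2,3) e'(2,3) ea R S f k by auto
  qed
  then obtain p1 q1 where P1: "is_pullback C ?g ?h p1 q1"
    using has_pullback_of_square unfolding has_pullback_def by blast
  note c1 = comm_squareD[OF pullback_comm[OF P1]]
  \<comment> \<open>Pulling back along \<open>e\<close>, and afterwards along \<open>e'\<close>, is
    possible because both are epimorphisms; pasting then gives another pullback of \<open>g\<close>
    and \<open>h\<close>.\<close>
  obtain q2 p2 where P2: "is_pullback C e p1 q2 p2"
    using has_pullback_of_epi[OF e(1), of p1] c1 e R by (auto simp: has_pullback_def)
  note c2 = comm_squareD[OF pullback_comm[OF P2]]
  have P12: "is_pullback C g ?h q2 (q1 \<cdot> p2)"
    using pullback_paste[OF P1 pullback_sym[OF P2]] e by simp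
  obtain q3 p3 where P3: "is_pullback C e' (q1 \<cdot> p2) q3 p3"
    using has_pullback_of_epi[OF e'(1), of "q1 \<cdot> p2"] c1 c2 e' S by (auto simp: has_pullback_def)
  note c3 = comm_squareD[OF pullback_comm[OF P3]]
  have P123: "is_pullback C g h (q2 \<cdot> p3) q3"
    using pullback_sym[OF pullback_paste[OF pullback_sym[OF P12] pullback_sym[OF P3]]] e' by simp
  have E: "epi_arr C p2" "epi_arr C p3" "\<delta> p2 = \<delta> e" "\<delta> p3 = \<delta> e'"
    using epi_pullback[OF P2 e(1)] epi_pullback[OF P3 e'(1)]
      degree_pullback[OF e(1) P2] degree_pullback[OF e'(1) P3] by auto
  have d3: "Cod C p3 = Dom C p2" "Dom C q2 = Dom C p2"
    using c1 c2 c3 by auto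
  have E': "epi_arr C (p2 \<cdot> p3)" "\<delta> (p2 \<cdot> p3) = \<delta> e * \<delta> e'"
    using epi_comp[OF E(2,1)] degree_comp[OF E(2,1)] E d3 by auto
  have "f \<cdot> (q2 \<cdot> p3) = (?f \<cdot> p1) \<cdot> (p2 \<cdot> p3)"
  proof -
    have "f \<cdot> (q2 \<cdot> p3) = ?f \<cdot> ((e \<cdot> q2) \<cdot> p3)"
      unfolding e(4) using ea c1 c2(1-8) c3(1-8) d3 R e(3) by (simp add: comp_assoc)
    also have "\<dots> = (?f \<cdot> p1) \<cdot> (p2 \<cdot> p3)"
      unfolding c2(9) using ea c1(1-8) c2(1-8) c3(1-8) d3 R e(3) by (simp add: comp_assoc)
    finally show ?thesis .
  qed
  moreover have "k \<cdot> q3 = (?k \<cdot> q1) \<cdot> (p2 \<cdot> p3)"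
  proof -
    have "k \<cdot> q3 = ?k \<cdot> (e' \<cdot> q3)"
      unfolding e'(5) using ea c3(1-8) S e'(3) by (simp add: comp_assoc)
    also have "\<dots> = (?k \<cdot> q1) \<cdot> (p2 \<cdot> p3)"
      unfolding c3(9) using ea c1(1-8) c2(1-8) c3(1-8) d3 S e'(3) by (simp add: comp_assoc)
    finally show ?thesis .
  qed
  moreover have "span_class C \<delta> (f \<cdot> p) (k \<cdot> q) = span_class C \<delta> (f \<cdot> (q2 \<cdot> p3)) (k \<cdot> q3)"
    using f k by (intro span_class_unique_pullback[OF P P123]) auto
  ultimately have "span_class C \<delta> (f \<cdot> p) (k \<cdot> q) = span_class C \<delta> ((?f \<cdot> p1) \<cdot> (p2 \<cdot> p3)) ((?k \<cdot> q1) \<cdot> (p2 \<cdot> p3))"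
    by simp
  also have "\<dots> = scale (\<delta> e * \<delta> e') (span_class C \<delta> (?f \<cdot> p1) (?k \<cdot> q1))"
    using span_class_epi[of "?f \<cdot> p1" "?k \<cdot> q1" "p2 \<cdot> p3"] E' R S c1 c2 c3 d3 by simp
  also have "\<dots> = lin_comp C \<delta> x y z (span_class C \<delta> f g) (span_class C \<delta> h k)"
    unfolding fg hk lin_comp_single rel_comp_pullback[OF r s P1] ..
  finally show ?thesis ..
qed

text \<open>If the legs of the image relations had a pullback, pulling it back along the two
  epimorphisms would produce one of \<open>g\<close> and \<open>h\<close>. So the zero case can be
  read off from the spans as well.\<close>

lemma span_comp_zero:
  assumes "\<not> has_pullback C g h" and f: "f \<in> Arr C" "g \<in> Arr C" "Dom C f = Dom C g"
    and k: "h \<in> Arr C" "k \<in> Arr C" "Dom C k = Dom C h"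
    and xyz: "Cod C f = x" "Cod C g = y" "Cod C h = y" "Cod C k = z"
  shows "lin_comp C \<delta> x y z (span_class C \<delta> f g) (span_class C \<delta> h k) = 0"
proof -
  obtain r e where r: "r \<in> relations C x y" and e: "epi_arr C e" "Dom C e = Dom C f"
    "Cod C e = Dom C (rep r)" "f = leg1 C x y r \<cdot> e" "g = leg2 C x y r \<cdot> e"
    and fg: "span_class C \<delta> f g = Poly_Mapping.single r (\<delta> e)"
    using span_class_cases[of f g] f xyz by metis
  obtain s e' where s: "s \<in> relations C y z" and e': "epi_arr C e'" "Dom C e' = Dom C h"
    "Cod C e' = Dom C (rep s)" "h = leg1 C y z s \<cdot> e'" "k = leg2 C y z s \<cdot> e'"
    and hk: "span_class C \<delta> h k = Poly_Mapping.single s (\<delta> e')"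
    using span_class_cases[of h k] k xyz by metis
  let ?f = "leg1 C x y r" and ?g = "leg2 C x y r" and ?h = "leg1 C y z s" and ?k = "leg2 C y z s"
  note R = relation[OF r] and S = relation[OF s]
  have ea: "e \<in> Arr C" "e' \<in> Arr C"
    using e e' by (auto simp: epi_arr_arr)
  have "\<not> has_pullback C ?g ?h"
  proof
    assume "has_pullback C ?g ?h"
    then obtain p1 q1 where P1: "is_pullback C ?g ?h p1 q1"
      by (auto simp: has_pullback_def)
    note c1 = comm_squareD[OF pullback_comm[OF P1]]
    obtain q2 p2 where P2: "is_pullback C e p1 q2 p2"
      using has_pullback_of_epi[OF e(1), of p1] c1 e R by (auto simp: has_pullback_def)
    note c2 = comm_squareD[OF pullback_comm[OF P2]]
    have P12: "is_pullback C g ?h q2 (q1 \<cdot> p2)"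
      using pullback_paste[OF P1 pullback_sym[OF P2]] e by simp
    obtain q3 p3 where P3: "is_pullback C e' (q1 \<cdot> p2) q3 p3"
      using has_pullback_of_epi[OF e'(1), of "q1 \<cdot> p2"] c1 c2 e' S by (auto simp: has_pullback_def)
    have "is_pullback C g h (q2 \<cdot> p3) q3"
      using pullback_sym[OF pullback_paste[OF pullback_sym[OF P12] pullback_sym[OF P3]]] e' by simp
    then show False
      using assms(1) by (auto simp: has_pullback_def)
  qed
  then have "rel_comp C \<delta> x y z r s = 0"
    by (simp add: rel_comp_def)
  then show ?thesis
    by (simp add: fg hk lin_comp_single)
qed

end

section \<open>Bilinearity of composition\<close>

lemma lin_comp_left: "lin_comp C \<delta> x y z a b = lin (\<lambda>r. lin_comp C \<delta> x y z (Poly_Mapping.single r 1) b) a"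
  by (simp add: lin_comp_def)

lemma lin_comp_right: "lin_comp C \<delta> x y z a b = lin (\<lambda>s. lin_comp C \<delta> x y z a (Poly_Mapping.single s 1)) b"
  by (simp add: lin_comp_def) (rule lin_commute)

lemma lin_comp_lin_left: "lin_comp C \<delta> x y z (lin \<phi> a) b = lin (\<lambda>r. lin_comp C \<delta> x y z (\<phi> r) b) a"
  by (simp add: lin_comp_def lin_lin)

lemma lin_comp_lin_right: "lin_comp C \<delta> x y z a (lin \<phi> b) = lin (\<lambda>s. lin_comp C \<delta> x y z a (\<phi> s)) b"
  by (simp add: lin_comp_def lin_lin) (rule lin_commute)

lemma lin_comp_add_left: "lin_comp C \<delta> x y z (a + a') b = lin_comp C \<delta> x y z a b + lin_comp C \<delta> x y z a' b"
  by (simp add: lin_comp_def lin_add)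

lemma lin_comp_add_right: "lin_comp C \<delta> x y z a (b + b') = lin_comp C \<delta> x y z a b + lin_comp C \<delta> x y z a b'"
  by (simp add: lin_comp_def lin_add lin_fun_add)

lemma lin_comp_zero [simp]: "lin_comp C \<delta> x y z 0 b = 0" "lin_comp C \<delta> x y z a 0 = 0"
  by (simp_all add: lin_comp_def)

section \<open>Identities, graphs and associativity\<close>

context degree_category
begin

lemma span_class_mono:
  assumes "f \<in> Arr C" "g \<in> Arr C" "Dom C f = Dom C g" and "mono_arr C (tuple C f g)"
  shows "span_class C \<delta> f g = Poly_Mapping.single (subobj C (tuple C f g)) 1"
proof -
  note t = tuple[OF assms(1-3)]
  have i: "iso_arr C (Ide C (Dom C f))"
    using assms by (auto simp: iso_arr_def hom_def intro!: bexI[of _ "Ide C (Dom C f)"])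
  have "image_fact C (tuple C f g) (Ide C (Dom C f)) (tuple C f g)"
    using assms t iso_imp_epi[OF i] by (simp add: image_fact_def)
  then show ?thesis
    using degree_iso[OF i] span_class_eq by simp
qed

text \<open>The first projection retracts the tuple, which is therefore a split monomorphism. For an
  identity arrow it is the diagonal.\<close>

lemma mono_tuple_ide:
  assumes "f \<in> Arr C"
  shows "mono_arr C (tuple C (Ide C (Dom C f)) f)"
proof -
  let ?x = "Dom C f"
  have a: "Ide C ?x \<in> Arr C" "Dom C (Ide C ?x) = Dom C f" "Cod C (Ide C ?x) = ?x"
    using assms by auto
  note t = tuple[OF a(1) assms a(2), unfolded a] and p = pr_arr[OF has_product_of_span[OF a(1) assms a(2)], unfolded a]
  show ?thesis
    unfolding mono_arr_def
  proof (intro conjI ballI impI)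
    fix u v
    assume uv: "u \<in> Arr C" "v \<in> Arr C" "Dom C u = Dom C v" "Cod C u = Dom C (tuple C (Ide C ?x) f)"
      "Cod C v = Dom C (tuple C (Ide C ?x) f)" "tuple C (Ide C ?x) f \<cdot> u = tuple C (Ide C ?x) f \<cdot> v"
    have "pr1 C ?x (Cod C f) \<cdot> (tuple C (Ide C ?x) f \<cdot> u) = u"
      "pr1 C ?x (Cod C f) \<cdot> (tuple C (Ide C ?x) f \<cdot> v) = v"
      using uv(1-5) p t(1-3) a comp_cong[OF t(4), of u] comp_cong[OF t(4), of v] by auto
    then show "u = v"
      using uv(6) by metis
  qed (fact t)
qed

lemma span_class_ide:
  "x \<in> Obj C \<Longrightarrow>
    span_class C \<delta> (Ide C x) (Ide C x) = Poly_Mapping.single (subobj C (tuple C (Ide C x) (Ide C x))) 1"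
  using span_class_mono mono_tuple_ide[of "Ide C x"] by simp

text \<open>The graph of \<open>h\<close> has an identity as its left leg, and pulling back along it
  is trivial, so only the right leg changes. With \<open>f\<close> an identity this is functoriality
  of graphs.\<close>

lemma comp_graph:
  assumes "f \<in> Arr C" "g \<in> Arr C" "Dom C f = Dom C g" "h \<in> Arr C" "Dom C h = Cod C g"
    and "Cod C f = x" "Cod C g = y" "Cod C h = z"
  shows "lin_comp C \<delta> x y z (span_class C \<delta> f g) (span_class C \<delta> (Ide C y) h) = span_class C \<delta> f (h \<cdot> g)"
  using span_comp[OF pullback_ide[of g], of f h x y z] dom_cod_obj(2)[OF assms(2)] assms by simp

lemma relation_ide_comp:
  assumes "Poly_Mapping.keys a \<subseteq> relations C x y" "x \<in> Obj C"
  shows "lin_comp C \<delta> x x y (span_class C \<delta> (Ide C x) (Ide C x)) a = a"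
proof -
  have "lin_comp C \<delta> x x y (span_class C \<delta> (Ide C x) (Ide C x)) (Poly_Mapping.single r 1) =
      Poly_Mapping.single r 1" if "r \<in> relations C x y" for r
  proof -
    note R = relation[OF that]
    show ?thesis
      using R assms span_comp[OF pullback_sym[OF pullback_ide[of "leg1 C x y r"]], of "Ide C x" "leg2 C x y r" x x y]
      by (simp flip: span_class_relation[OF that])
  qed
  then show ?thesis
    by (subst lin_comp_right) (use assms in \<open>auto intro!: lin_eqI\<close>)
qed

lemma relation_comp_ide:
  assumes "Poly_Mapping.keys a \<subseteq> relations C x y" "y \<in> Obj C"
  shows "lin_comp C \<delta> x y y a (span_class C \<delta> (Ide C y) (Ide C y)) = a"
proof -
  have "lin_comp C \<delta> x y y (Poly_Mapping.single r 1) (span_class C \<delta> (Ide C y) (Ide C y)) =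
      Poly_Mapping.single r 1" if "r \<in> relations C x y" for r
  proof -
    note R = relation[OF that]
    show ?thesis
      using R assms comp_graph[of "leg1 C x y r" "leg2 C x y r" "Ide C y" x y y]
      by (simp flip: span_class_relation[OF that])
  qed
  then show ?thesis
    by (subst lin_comp_left) (use assms in \<open>auto intro!: lin_eqI\<close>)
qed

text \<open>The right-hand side asks for one object with compatible maps to the source of
  \<open>f\<close>, to the common source of \<open>g\<close> and \<open>h\<close>, and to the source
  of \<open>k\<close>. It favours neither bracketing, so both iterated products of three spans are
  defined under the same condition.\<close>

lemma has_pullback_comp_iff:
  assumes P: "is_pullback C f g p q" and h: "h \<in> Arr C" "Dom C h = Dom C g" and k: "k \<in> Arr C" "Cod C k = Cod C h"
  shows "has_pullback C (h \<cdot> q) k \<longleftrightarrow> (\<exists>u a b. comm_square C f g u a \<and> comm_square C h k a b)"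
proof
  note c = comm_squareD[OF pullback_comm[OF P]]
  assume "has_pullback C (h \<cdot> q) k"
  then obtain a b where ab: "comm_square C (h \<cdot> q) k a b"
    unfolding has_pullback_iff by blast
  note d = comm_squareD[OF ab]
  have "comm_square C f g (p \<cdot> a) (q \<cdot> a)"
    using c d h comp_square[OF c(9)] by (auto simp: comm_square_def)
  moreover have "comm_square C h k (q \<cdot> a) b"
    using c d h comp_assoc[of a q h] by (simp add: comm_square_def)
  ultimately show "\<exists>u a b. comm_square C f g u a \<and> comm_square C h k a b"
    by blast
next
  note c = comm_squareD[OF pullback_comm[OF P]]
  assume "\<exists>u a b. comm_square C f g u a \<and> comm_square C h k a b"
  then obtain u a b where s: "comm_square C f g u a" and t: "comm_square C h k a b"
    by blast
  obtain v where v: "v \<in> Arr C" "Dom C v = Dom C u" "Cod C v = Dom C p" "p \<cdot> v = u" "q \<cdot> v = a"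
    by (rule pullback_ex[OF P s])
  have "comm_square C (h \<cdot> q) k v b"
    using c comm_squareD[OF s] comm_squareD[OF t] h v comp_assoc[of v q h] by (simp add: comm_square_def)
  then show "has_pullback C (h \<cdot> q) k"
    by (rule has_pullback_of_square)
qed

text \<open>When three compatible maps exist, both bracketings are the class of the outer legs on
  the iterated pullback with projections \<open>k\<close> and \<open>l\<close>; otherwise both
  vanish.\<close>

lemma span_comp_assoc:
  assumes f: "f1 \<in> Arr C" "g1 \<in> Arr C" "Dom C f1 = Dom C g1" "Cod C f1 = x" "Cod C g1 = y"
    and g: "f2 \<in> Arr C" "g2 \<in> Arr C" "Dom C f2 = Dom C g2" "Cod C f2 = y" "Cod C g2 = z"
    and h: "f3 \<in> Arr C" "g3 \<in> Arr C" "Dom C f3 = Dom C g3" "Cod C f3 = z" "Cod C g3 = w"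
  shows "lin_comp C \<delta> x z w (lin_comp C \<delta> x y z (span_class C \<delta> f1 g1) (span_class C \<delta> f2 g2)) (span_class C \<delta> f3 g3)
    = lin_comp C \<delta> x y w (span_class C \<delta> f1 g1) (lin_comp C \<delta> y z w (span_class C \<delta> f2 g2) (span_class C \<delta> f3 g3))"
    (is "?L = ?R")
proof (cases "\<exists>u a b. comm_square C g1 f2 u a \<and> comm_square C g2 f3 a b")
  case True
  then have "has_pullback C g1 f2" "has_pullback C g2 f3"
    unfolding has_pullback_iff by blast+
  then obtain p q p' q' where P: "is_pullback C g1 f2 p q" and P': "is_pullback C g2 f3 p' q'"
    unfolding has_pullback_def by blast
  note c = comm_squareD[OF pullback_comm[OF P]] and c' = comm_squareD[OF pullback_comm[OF P']]
  from True obtain u a b where ua: "comm_square C g1 f2 u a" and ab: "comm_square C g2 f3 a b"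
    by blast
  obtain i where i: "i \<in> Arr C" "Dom C i = Dom C u" "Cod C i = Dom C p" "p \<cdot> i = u" "q \<cdot> i = a"
    by (rule pullback_ex[OF P ua])
  obtain j where j: "j \<in> Arr C" "Dom C j = Dom C a" "Cod C j = Dom C p'" "p' \<cdot> j = a" "q' \<cdot> j = b"
    by (rule pullback_ex[OF P' ab])
  \<comment> \<open>The compatible maps \<open>u\<close>, \<open>a\<close>, \<open>b\<close> factor
    through the two pullbacks and close to a square over the source of the middle span, so the
    iterated pullback exists.\<close>
  have "comm_square C q p' i j"
    using c c' comm_squareD[OF ua] i j g by (simp add: comm_square_def)
  then obtain k l where K: "is_pullback C q p' k l"
    using has_pullback_of_square unfolding has_pullback_def by blast
  note d = comm_squareD[OF pullback_comm[OF K]]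
  have 1: "is_pullback C (g2 \<cdot> q) f3 k (q' \<cdot> l)"
    using pullback_paste[OF P' pullback_sym[OF K]] .
  have 2: "is_pullback C g1 (f2 \<cdot> p') (p \<cdot> k) l"
    using pullback_sym[OF pullback_paste[OF pullback_sym[OF P] K]] .
  have "?L = lin_comp C \<delta> x z w (span_class C \<delta> (f1 \<cdot> p) (g2 \<cdot> q)) (span_class C \<delta> f3 g3)"
    using span_comp[OF P] f g by simp
  also have "\<dots> = span_class C \<delta> ((f1 \<cdot> p) \<cdot> k) (g3 \<cdot> (q' \<cdot> l))"
    using f g h c d by (intro span_comp[OF 1]) auto
  also have "\<dots> = span_class C \<delta> (f1 \<cdot> (p \<cdot> k)) ((g3 \<cdot> q') \<cdot> l)"
    using f g h c c' d by (simp add: comp_assoc)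
  also have "\<dots> = lin_comp C \<delta> x y w (span_class C \<delta> f1 g1) (span_class C \<delta> (f2 \<cdot> p') (g3 \<cdot> q'))"
    using f g h c' d by (intro span_comp[OF 2, symmetric]) auto
  also have "\<dots> = ?R"
    using span_comp[OF P'] g h by simp
  finally show ?thesis .
next
  case False
  \<comment> \<open>Either the inner product is undefined, or it is defined and the outer one is
    not; the composite is 0 in both cases.\<close>
  have "?L = 0"
  proof (cases "has_pullback C g1 f2")
    case True
    then obtain p q where P: "is_pullback C g1 f2 p q"
      unfolding has_pullback_def by blast
    note c = comm_squareD[OF pullback_comm[OF P]]
    have "\<not> has_pullback C (g2 \<cdot> q) f3"
      using has_pullback_comp_iff[OF P, of g2 f3] False f g h by simp
    then show ?thesis
      using span_comp[OF P, of f1 g2] f g h c by (simp add: span_comp_zero)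
  qed (use f g in \<open>simp add: span_comp_zero\<close>)
  moreover have "?R = 0"
  proof (cases "has_pullback C g2 f3")
    case True
    then obtain p q where P: "is_pullback C g2 f3 p q"
      unfolding has_pullback_def by blast
    note c = comm_squareD[OF pullback_comm[OF P]]
    \<comment> \<open>The condition is read backwards, because the inner product now consists of the
      second and third span.\<close>
    have "\<not> (\<exists>u a b. comm_square C f3 g2 u a \<and> comm_square C f2 g1 a b)"
      using False comm_square_sym by blast
    then have "\<not> has_pullback C (f2 \<cdot> p) g1"
      using has_pullback_comp_iff[OF pullback_sym[OF P], of f2 g1] f g h by simp
    then have "\<not> has_pullback C g1 (f2 \<cdot> p)"
      using pullback_sym unfolding has_pullback_def by blast
    then show ?thesis
      using span_comp[OF P, of f2 g3] f g h c by (simp add: span_comp_zero)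
  qed (use g h in \<open>simp add: span_comp_zero\<close>)
  ultimately show ?thesis
    by simp
qed

lemma keys_lin_comp:
  assumes "Poly_Mapping.keys a \<subseteq> relations C x y" "Poly_Mapping.keys b \<subseteq> relations C y z"
  shows "Poly_Mapping.keys (lin_comp C \<delta> x y z a b) \<subseteq> relations C x z"
  unfolding lin_comp_def
proof (intro keys_lin)
  fix r s
  assume "r \<in> Poly_Mapping.keys a" "s \<in> Poly_Mapping.keys b"
  then have r: "r \<in> relations C x y" and s: "s \<in> relations C y z"
    using assms by auto
  note R = relation[OF r] and S = relation[OF s]
  show "Poly_Mapping.keys (rel_comp C \<delta> x y z r s) \<subseteq> relations C x z"
  proof (cases "has_pullback C (leg2 C x y r) (leg1 C y z s)")
    case True
    then obtain p q where P: "is_pullback C (leg2 C x y r) (leg1 C y z s) p q"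
      unfolding has_pullback_def by blast
    show ?thesis
      unfolding rel_comp_pullback[OF r s P]
      using R S comm_squareD[OF pullback_comm[OF P]] by (intro keys_span_class) auto
  qed (simp add: rel_comp_def)
qed

text \<open>Both sides are trilinear, and basis relations are the classes of their legs.\<close>

lemma lin_comp_assoc:
  assumes "Poly_Mapping.keys a \<subseteq> relations C x y" "Poly_Mapping.keys b \<subseteq> relations C y z"
    "Poly_Mapping.keys c \<subseteq> relations C z w"
  shows "lin_comp C \<delta> x z w (lin_comp C \<delta> x y z a b) c = lin_comp C \<delta> x y w a (lin_comp C \<delta> y z w b c)"
proof -
  let ?s = "\<lambda>r. Poly_Mapping.single r (1::'k)"
  have "lin_comp C \<delta> x z w (lin_comp C \<delta> x y z a b) c =
      lin (\<lambda>r. lin (\<lambda>s. lin (\<lambda>t. lin_comp C \<delta> x z w (lin_comp C \<delta> x y z (?s r) (?s s)) (?s t)) c) b) a"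
    by (subst lin_comp_left, subst lin_comp_right, subst lin_comp_lin_left, subst lin_comp_lin_left,
        subst lin_comp_right) (rule refl)
  also have "\<dots> = lin (\<lambda>r. lin (\<lambda>s. lin (\<lambda>t. lin_comp C \<delta> x y w (?s r) (lin_comp C \<delta> y z w (?s s) (?s t))) c) b) a"
  proof (intro lin_cong)
    fix r s t
    assume "r \<in> Poly_Mapping.keys a" "s \<in> Poly_Mapping.keys b" "t \<in> Poly_Mapping.keys c"
    then have r: "r \<in> relations C x y" and s: "s \<in> relations C y z" and t: "t \<in> relations C z w"
      using assms by auto
    note R = relation[OF r] and S = relation[OF s] and T = relation[OF t]
    show "lin_comp C \<delta> x z w (lin_comp C \<delta> x y z (?s r) (?s s)) (?s t) =
        lin_comp C \<delta> x y w (?s r) (lin_comp C \<delta> y z w (?s s) (?s t))"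
      unfolding span_class_relation[OF r, symmetric] span_class_relation[OF s, symmetric]
        span_class_relation[OF t, symmetric]
      by (rule span_comp_assoc) (simp_all add: R S T)
  qed
  also have "\<dots> = lin_comp C \<delta> x y w a (lin_comp C \<delta> y z w b c)"
    unfolding lin_comp_left[of C \<delta> x y w a] lin_comp_left[of C \<delta> y z w b] lin_comp_lin_right
    by (subst lin_commute) (simp add: lin_comp_right[of C \<delta> y z w _ c] lin_comp_lin_right)
  finally show ?thesis .
qed

end

section \<open>Functors and adjunctions\<close>

lemma ftor_simps [simp]:
  "On_obj id_ftor x = x" "On_arr id_ftor f = f"
  "On_obj (comp_ftor G F) x = On_obj G (On_obj F x)" "On_arr (comp_ftor G F) f = On_arr G (On_arr F f)"
  by (simp_all add: id_ftor_def comp_ftor_def)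

lemma (in category) cat_functor_id: "cat_functor C C id_ftor"
  by unfold_locales auto

lemma cat_functor_comp:
  assumes "cat_functor C D F" and "cat_functor D E G"
  shows "cat_functor C E (comp_ftor G F)"
proof -
  interpret F: cat_functor C D F by fact
  interpret G: cat_functor D E G by fact
  show ?thesis
    by unfold_locales
      (auto intro: F.On_obj G.On_obj F.On_arr G.On_arr simp: F.On_Ide G.On_Ide[OF F.On_obj] F.On_Comp
        G.On_Comp[OF F.On_arr F.On_arr])
qed

text \<open>Settles functoriality of the identity and of the two composites once and for all,
  leaving components, naturality and triangle identities.\<close>

lemma adjunctionI:
  assumes "cat_functor C D L" and "cat_functor D C R"
    and "\<And>x. x \<in> Obj C \<Longrightarrow> \<eta> x \<in> hom C x (On_obj R (On_obj L x))"
    and "\<And>x y f. f \<in> hom C x y \<Longrightarrow> \<eta> y \<cdot>\<^bsub>C\<^esub> f = On_arr R (On_arr L f) \<cdot>\<^bsub>C\<^esub> \<eta> x"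
    and "\<And>y. y \<in> Obj D \<Longrightarrow> \<epsilon> y \<in> hom D (On_obj L (On_obj R y)) y"
    and "\<And>x y f. f \<in> hom D x y \<Longrightarrow> \<epsilon> y \<cdot>\<^bsub>D\<^esub> On_arr L (On_arr R f) = f \<cdot>\<^bsub>D\<^esub> \<epsilon> x"
    and "\<And>x. x \<in> Obj C \<Longrightarrow> \<epsilon> (On_obj L x) \<cdot>\<^bsub>D\<^esub> On_arr L (\<eta> x) = Ide D (On_obj L x)"
    and "\<And>y. y \<in> Obj D \<Longrightarrow> On_arr R (\<epsilon> y) \<cdot>\<^bsub>C\<^esub> \<eta> (On_obj R y) = Ide C (On_obj R y)"
  shows "adjunction C D L R \<eta> \<epsilon>"
proof -
  interpret L: cat_functor C D L by fact
  interpret R: cat_functor D C R by fact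
  show ?thesis
    by (intro adjunction.intro nat_transf.intro nat_transf_axioms.intro adjunction_axioms.intro
        L.dom_cat.cat_functor_id L.cod_cat.cat_functor_id cat_functor_comp[OF assms(1,2)]
        cat_functor_comp[OF assms(2,1)] assms(1,2))
      (simp_all add: assms)
qed

context cat_functor
begin

lemma on_arr [simp]:
  assumes "f \<in> Arr C"
  shows "On_arr F f \<in> Arr D" "Dom D (On_arr F f) = On_obj F (Dom C f)"
    "Cod D (On_arr F f) = On_obj F (Cod C f)"
  using On_arr[of f "Dom C f" "Cod C f"] assms by (auto simp: hom_def)

lemma on_comp:
  "f \<in> Arr C \<Longrightarrow> g \<in> Arr C \<Longrightarrow> Dom C g = Cod C f \<Longrightarrow>
    On_arr F (g \<cdot>\<^bsub>C\<^esub> f) = On_arr F g \<cdot>\<^bsub>D\<^esub> On_arr F f"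
  using On_Comp[of f "Dom C f" "Cod C f" g "Cod C g"] by (auto simp: hom_def)

lemma on_comm_square:
  "comm_square C f g p q \<Longrightarrow> comm_square D (On_arr F f) (On_arr F g) (On_arr F p) (On_arr F q)"
  unfolding comm_square_def by (simp flip: on_comp)

end

section \<open>Adjoint transposes and preservation of pullbacks\<close>

context adjunction
begin

lemma unit_arr:
  assumes "x \<in> Obj C"
  shows "\<eta> x \<in> Arr C" "Dom C (\<eta> x) = x" "Cod C (\<eta> x) = On_obj R (On_obj L x)"
  using unit.component[OF assms] by (auto simp: hom_def)

lemma counit_arr:
  assumes "y \<in> Obj D"
  shows "\<epsilon> y \<in> Arr D" "Dom D (\<epsilon> y) = On_obj L (On_obj R y)" "Cod D (\<epsilon> y) = y"
  using counit.component[OF assms] by (auto simp: hom_def)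

lemma unit_natural: "f \<in> Arr C \<Longrightarrow> \<eta> (Cod C f) \<cdot>\<^bsub>C\<^esub> f = On_arr R (On_arr L f) \<cdot>\<^bsub>C\<^esub> \<eta> (Dom C f)"
  using unit.natural[of f "Dom C f" "Cod C f"] by (simp add: hom_def)

lemma counit_natural: "f \<in> Arr D \<Longrightarrow> \<epsilon> (Cod D f) \<cdot>\<^bsub>D\<^esub> On_arr L (On_arr R f) = f \<cdot>\<^bsub>D\<^esub> \<epsilon> (Dom D f)"
  using counit.natural[of f "Dom D f" "Cod D f"] by (simp add: hom_def)

text \<open>The adjoint transpose of \<open>a\<close> is \<open>\<epsilon> x\<close> after
  \<open>L a\<close>. Transposing back gives \<open>a\<close> by naturality of the unit and a
  triangle identity.\<close>

lemma transpose:
  assumes "a \<in> Arr C" and x: "x \<in> Obj D" and "Cod C a = On_obj R x"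
  shows "On_arr R (\<epsilon> x \<cdot>\<^bsub>D\<^esub> On_arr L a) \<cdot>\<^bsub>C\<^esub> \<eta> (Dom C a) = a"
proof -
  note e = counit_arr[OF x] and u = unit_arr[of "Dom C a"] unit_arr[of "Cod C a"]
  have "On_arr R (\<epsilon> x \<cdot>\<^bsub>D\<^esub> On_arr L a) \<cdot>\<^bsub>C\<^esub> \<eta> (Dom C a) =
      On_arr R (\<epsilon> x) \<cdot>\<^bsub>C\<^esub> (On_arr R (On_arr L a) \<cdot>\<^bsub>C\<^esub> \<eta> (Dom C a))"
    using e u assms by (simp add: right.on_comp left.dom_cat.comp_assoc)
  also have "\<dots> = (On_arr R (\<epsilon> x) \<cdot>\<^bsub>C\<^esub> \<eta> (Cod C a)) \<cdot>\<^bsub>C\<^esub> a"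
    unfolding unit_natural[OF assms(1), symmetric]
    using e u assms right.On_obj[OF x] by (simp add: left.dom_cat.comp_assoc)
  also have "\<dots> = a"
    using triangle_right[OF x] assms right.On_obj[OF x] by simp
  finally show ?thesis .
qed

text \<open>Naturality of transposition in the target, coming from naturality of the counit.\<close>

lemma comp_transpose:
  assumes "a \<in> Arr C" and f: "f \<in> Arr D" and "Cod C a = On_obj R (Dom D f)"
  shows "f \<cdot>\<^bsub>D\<^esub> (\<epsilon> (Dom D f) \<cdot>\<^bsub>D\<^esub> On_arr L a) = \<epsilon> (Cod D f) \<cdot>\<^bsub>D\<^esub> On_arr L (On_arr R f \<cdot>\<^bsub>C\<^esub> a)"
proof -
  note e = counit_arr[of "Dom D f"] counit_arr[of "Cod D f"]
  have "f \<cdot>\<^bsub>D\<^esub> (\<epsilon> (Dom D f) \<cdot>\<^bsub>D\<^esub> On_arr L a) = (f \<cdot>\<^bsub>D\<^esub> \<epsilon> (Dom D f)) \<cdot>\<^bsub>D\<^esub> On_arr L a"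
    using e assms by (simp add: left.cod_cat.comp_assoc)
  also have "\<dots> = \<epsilon> (Cod D f) \<cdot>\<^bsub>D\<^esub> On_arr L (On_arr R f \<cdot>\<^bsub>C\<^esub> a)"
    unfolding counit_natural[OF f, symmetric]
    using e assms by (simp add: left.cod_cat.comp_assoc left.on_comp)
  finally show ?thesis .
qed

lemma comm_square_transpose:
  assumes s: "comm_square C (On_arr R f) (On_arr R g) a b" and f: "f \<in> Arr D" "g \<in> Arr D" "Cod D f = Cod D g"
  shows "comm_square D f g (\<epsilon> (Dom D f) \<cdot>\<^bsub>D\<^esub> On_arr L a) (\<epsilon> (Dom D g) \<cdot>\<^bsub>D\<^esub> On_arr L b)"
  using left.dom_cat.comm_squareD[OF s] f counit_arr[of "Dom D f"] counit_arr[of "Dom D g"]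
    comp_transpose[of a f] comp_transpose[of b g]
  by (simp add: comm_square_def)

text \<open>Besides the usual argument that right adjoints preserve limits, undefined pullbacks have
  to stay undefined. This is where regularity of \<open>D\<close> is used, through its completion
  axiom.\<close>

lemma right_adjoint_preserves_pullbacks:
  assumes "regular_category D"
  shows "preserves_pullbacks D C R"
  unfolding preserves_pullbacks_def
proof (intro conjI allI impI ballI)
  fix f g p q
  assume P: "is_pullback D f g p q"
  note c = left.cod_cat.comm_squareD[OF left.cod_cat.pullback_comm[OF P]]
  show "is_pullback C (On_arr R f) (On_arr R g) (On_arr R p) (On_arr R q)"
  proof (rule left.dom_cat.is_pullbackI)
    show "comm_square C (On_arr R f) (On_arr R g) (On_arr R p) (On_arr R q)"
      by (rule right.on_comm_square) (rule left.cod_cat.pullback_comm[OF P])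
    fix a b
    assume s: "comm_square C (On_arr R f) (On_arr R g) a b"
    note d = left.dom_cat.comm_squareD[OF s]
    note e = counit_arr[of "Dom D f"] counit_arr[of "Dom D g"] and h = unit_arr[of "Dom C a"]
    \<comment> \<open>The transposed cone factors through the pullback in \<open>D\<close>; the
      resulting arrow is carried back to \<open>C\<close> by the unit.\<close>
    obtain u where u: "u \<in> Arr D" "Dom D u = Dom D (\<epsilon> (Dom D f) \<cdot>\<^bsub>D\<^esub> On_arr L a)" "Cod D u = Dom D p"
      "p \<cdot>\<^bsub>D\<^esub> u = \<epsilon> (Dom D f) \<cdot>\<^bsub>D\<^esub> On_arr L a" "q \<cdot>\<^bsub>D\<^esub> u = \<epsilon> (Dom D g) \<cdot>\<^bsub>D\<^esub> On_arr L b"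
      by (rule left.cod_cat.pullback_ex[OF P comm_square_transpose[OF s c(1,2,5)]])
    have du: "Dom D u = On_obj L (Dom C a)"
      using u(2) c d e by simp
    have "On_arr R p \<cdot>\<^bsub>C\<^esub> (On_arr R u \<cdot>\<^bsub>C\<^esub> \<eta> (Dom C a)) = On_arr R (p \<cdot>\<^bsub>D\<^esub> u) \<cdot>\<^bsub>C\<^esub> \<eta> (Dom C a)"
      using c(1-8) d(1-8) u(1,3) du h by (simp add: right.on_comp left.dom_cat.comp_assoc)
    also have "\<dots> = a"
      unfolding u(4) using c d by (intro transpose) auto
    finally have 1: "On_arr R p \<cdot>\<^bsub>C\<^esub> (On_arr R u \<cdot>\<^bsub>C\<^esub> \<eta> (Dom C a)) = a" .
    have "On_arr R q \<cdot>\<^bsub>C\<^esub> (On_arr R u \<cdot>\<^bsub>C\<^esub> \<eta> (Dom C a)) = On_arr R (q \<cdot>\<^bsub>D\<^esub> u) \<cdot>\<^bsub>C\<^esub> \<eta> (Dom C b)"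
      using c(1-8) d(1-8) u(1,3) du h by (simp add: right.on_comp left.dom_cat.comp_assoc)
    also have "\<dots> = b"
      unfolding u(5) using c d by (intro transpose) auto
    finally have 2: "On_arr R q \<cdot>\<^bsub>C\<^esub> (On_arr R u \<cdot>\<^bsub>C\<^esub> \<eta> (Dom C a)) = b" .
    show "\<exists>v. v \<in> Arr C \<and> Dom C v = Dom C a \<and> Cod C v = Dom C (On_arr R p) \<and>
        On_arr R p \<cdot>\<^bsub>C\<^esub> v = a \<and> On_arr R q \<cdot>\<^bsub>C\<^esub> v = b"
      using 1 2 c(1-8) d(1-8) u(1,3) du h by (intro exI[of _ "On_arr R u \<cdot>\<^bsub>C\<^esub> \<eta> (Dom C a)"]) simp
  next
    fix u v
    assume uv: "u \<in> Arr C" "v \<in> Arr C" "Dom C u = Dom C v" "Cod C u = Dom C (On_arr R p)"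
      "Cod C v = Dom C (On_arr R p)" "On_arr R p \<cdot>\<^bsub>C\<^esub> u = On_arr R p \<cdot>\<^bsub>C\<^esub> v"
      "On_arr R q \<cdot>\<^bsub>C\<^esub> u = On_arr R q \<cdot>\<^bsub>C\<^esub> v"
    \<comment> \<open>The two candidates are compared after transposition, where \<open>p\<close>
      and \<open>q\<close> are jointly monic.\<close>
    let ?u = "\<epsilon> (Dom D p) \<cdot>\<^bsub>D\<^esub> On_arr L u" and ?v = "\<epsilon> (Dom D p) \<cdot>\<^bsub>D\<^esub> On_arr L v"
    note e = counit_arr[of "Dom D p"]
    have "p \<cdot>\<^bsub>D\<^esub> ?u = p \<cdot>\<^bsub>D\<^esub> ?v" "q \<cdot>\<^bsub>D\<^esub> ?u = q \<cdot>\<^bsub>D\<^esub> ?v"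
      using comp_transpose[of u p] comp_transpose[of v p] comp_transpose[of u q] comp_transpose[of v q]
        uv c by simp_all
    then have "?u = ?v"
      using uv(1-5) c e by - (rule left.cod_cat.pullback_jointly_mono[OF P], auto)
    then show "u = v"
      using transpose[of u "Dom D p"] transpose[of v "Dom D p"] uv(1-5) c by simp
  qed
next
  interpret D: regular_category D by fact
  fix f g
  assume f: "f \<in> Arr D" "g \<in> Arr D" "Cod D f = Cod D g" and n: "\<not> has_pullback D f g"
  show "\<not> has_pullback C (On_arr R f) (On_arr R g)"
  proof
    assume "has_pullback C (On_arr R f) (On_arr R g)"
    \<comment> \<open>A square over the images transposes to a square over \<open>f\<close> and
      \<open>g\<close>, which would provide the missing pullback.\<close>
    then obtain a b where "comm_square C (On_arr R f) (On_arr R g) a b"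
      using left.dom_cat.pullback_comm unfolding has_pullback_def by blast
    from D.has_pullback_of_square[OF comm_square_transpose[OF this f]] n show False
      by simp
  qed
qed

end

section \<open>Functors between categories of relations\<close>

text \<open>Enrichment in commutative monoids, as matrix multiplication requires. The laws are
  relative to hom-sets because \<open>Hadd\<close> is total on the type of arrows: in
  \<open>T0\<close> it copies the endpoints of its first argument, whatever those of the
  second.\<close>

locale preadditive = category C
  for C :: "('o, 'm, 'z) preadd_cat_scheme"  (structure) +
  assumes Hzero_hom: "x \<in> Obj C \<Longrightarrow> y \<in> Obj C \<Longrightarrow> Hzero C x y \<in> hom C x y"
    and Hadd_hom: "f \<in> hom C x y \<Longrightarrow> g \<in> hom C x y \<Longrightarrow> Hadd C f g \<in> hom C x y"
    and Hadd_assoc: "f \<in> hom C x y \<Longrightarrow> g \<in> hom C x y \<Longrightarrow> h \<in> hom C x y \<Longrightarrow>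
      Hadd C (Hadd C f g) h = Hadd C f (Hadd C g h)"
    and Hadd_commute: "f \<in> hom C x y \<Longrightarrow> g \<in> hom C x y \<Longrightarrow> Hadd C f g = Hadd C g f"
    and Hadd_zero: "f \<in> hom C x y \<Longrightarrow> Hadd C f (Hzero C x y) = f"
    and comp_Hadd: "f \<in> hom C x y \<Longrightarrow> g \<in> hom C x y \<Longrightarrow> h \<in> hom C y z \<Longrightarrow>
      h \<cdot> Hadd C f g = Hadd C (h \<cdot> f) (h \<cdot> g)"
    and Hadd_comp: "f \<in> hom C x y \<Longrightarrow> g \<in> hom C y z \<Longrightarrow> h \<in> hom C y z \<Longrightarrow>
      Hadd C g h \<cdot> f = Hadd C (g \<cdot> f) (h \<cdot> f)"
    and comp_Hzero: "x \<in> Obj C \<Longrightarrow> g \<in> hom C y z \<Longrightarrow> g \<cdot> Hzero C x y = Hzero C x z"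
    and Hzero_comp: "z \<in> Obj C \<Longrightarrow> f \<in> hom C x y \<Longrightarrow> Hzero C y z \<cdot> f = Hzero C x z"

locale additive_functor = cat_functor C D F + source: preadditive C + target: preadditive D
  for C :: "('o, 'm, 'z) preadd_cat_scheme" and D :: "('p, 'n, 'w) preadd_cat_scheme"
    and F :: "('o, 'm, 'p, 'n) ftor" +
  assumes On_Hzero: "x \<in> Obj C \<Longrightarrow> y \<in> Obj C \<Longrightarrow>
      On_arr F (Hzero C x y) = Hzero D (On_obj F x) (On_obj F y)"
    and On_Hadd: "f \<in> hom C x y \<Longrightarrow> g \<in> hom C x y \<Longrightarrow>
      On_arr F (Hadd C f g) = Hadd D (On_arr F f) (On_arr F g)"

section \<open>\<open>T0\<close> as a preadditive category\<close>

context degree_category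
begin

lemma T0_Ide:
  "x \<in> Obj C \<Longrightarrow> Ide (T0 C \<delta>) x = (x, x, span_class C \<delta> (Ide C x) (Ide C x))"
  by (simp add: T0_simps span_class_ide)

lemma T0_category: "category (T0 C \<delta>)"
proof
  fix x assume x: "x \<in> Obj (T0 C \<delta>)"
  then show "Ide (T0 C \<delta>) x \<in> hom (T0 C \<delta>) x x"
    using keys_span_class[of "Ide C x" "Ide C x" x x]
    unfolding T0_Ide[OF x[unfolded T0_simps]] by (simp add: hom_T0 T0_simps)
next
  fix f g x y z
  assume "f \<in> hom (T0 C \<delta>) x y" "g \<in> hom (T0 C \<delta>) y z"
  then show "g \<cdot>\<^bsub>T0 C \<delta>\<^esub> f \<in> hom (T0 C \<delta>) x z"
    by (auto simp: hom_T0 T0_simps dest: keys_lin_comp)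
next
  fix f x y
  assume "f \<in> hom (T0 C \<delta>) x y"
  then show "f \<cdot>\<^bsub>T0 C \<delta>\<^esub> Ide (T0 C \<delta>) x = f" "Ide (T0 C \<delta>) y \<cdot>\<^bsub>T0 C \<delta>\<^esub> f = f"
    by (auto simp: hom_T0 T0_Ide T0_simps(8) relation_ide_comp relation_comp_ide)
next
  fix f g h w x y z
  assume "f \<in> hom (T0 C \<delta>) w x" "g \<in> hom (T0 C \<delta>) x y" "h \<in> hom (T0 C \<delta>) y z"
  then show "(h \<cdot>\<^bsub>T0 C \<delta>\<^esub> g) \<cdot>\<^bsub>T0 C \<delta>\<^esub> f = h \<cdot>\<^bsub>T0 C \<delta>\<^esub> (g \<cdot>\<^bsub>T0 C \<delta>\<^esub> f)"
    by (auto simp: hom_T0 T0_simps lin_comp_assoc)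
qed (auto simp: T0_simps)

lemma T0_preadditive: "preadditive (T0 C \<delta>)"
proof -
  interpret T0: category "T0 C \<delta>"
    by (rule T0_category)
  show ?thesis
    by unfold_locales
      (auto simp: hom_T0 T0_simps add.assoc lin_comp_add_left lin_comp_add_right
        intro: add.commute dest!: keys_add[THEN subsetD])
qed

end

section \<open>The linear functor induced by a functor preserving degrees and pullbacks\<close>

definition rel_map :: "('o, 'm, 'z) cat_scheme \<Rightarrow> ('p, 'n, 'w) cat_scheme \<Rightarrow> ('o, 'm, 'p, 'n) ftor \<Rightarrow>
    'o \<Rightarrow> 'o \<Rightarrow> ('m set \<Rightarrow>\<^sub>0 'k::field) \<Rightarrow> ('n set \<Rightarrow>\<^sub>0 'k)" where
  "rel_map C D F x y = lin (\<lambda>r. Poly_Mapping.single (rel_image C D F x y r) 1)"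

lemma T0_ftor_simps:
  "On_obj (T0_ftor C D F) = On_obj F"
  "On_arr (T0_ftor C D F) (x, y, a) = (On_obj F x, On_obj F y, rel_map C D F x y a)"
  by (simp_all add: T0_ftor_def rel_map_def lin_def)

locale degree_functor = cat_functor C D F + source: degree_category C \<delta> + target: degree_category D \<delta>'
  for C :: "('o, 'm, 'z) cat_scheme" and D :: "('p, 'n, 'w) cat_scheme" and F :: "('o, 'm, 'p, 'n) ftor"
    and \<delta> :: "'m \<Rightarrow> 'k::field" and \<delta>' :: "'n \<Rightarrow> 'k" +
  assumes preserves_degree: "preserves_degree C \<delta> D \<delta>' F"
    and preserves_pullbacks: "preserves_pullbacks C D F"
begin

lemma on_epi: "epi_arr C e \<Longrightarrow> epi_arr D (On_arr F e)"
  and on_degree: "epi_arr C e \<Longrightarrow> \<delta>' (On_arr F e) = \<delta> e"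
  and on_pullback: "is_pullback C f g p q \<Longrightarrow>
    is_pullback D (On_arr F f) (On_arr F g) (On_arr F p) (On_arr F q)"
  and on_has_pullback: "f \<in> Arr C \<Longrightarrow> g \<in> Arr C \<Longrightarrow> Cod C f = Cod C g \<Longrightarrow>
    has_pullback D (On_arr F f) (On_arr F g) \<Longrightarrow> has_pullback C f g"
  using preserves_degree preserves_pullbacks unfolding preserves_degree_def preserves_pullbacks_def by blast+

lemma on_mono:
  assumes "mono_arr C m"
  shows "mono_arr D (On_arr F m)"
proof -
  have m: "m \<in> Arr C"
    using assms by (rule dom_cat.mono_arr_arr)
  then have "is_pullback C m m (Ide C (Dom C m)) (Ide C (Dom C m))"
    using assms dom_cat.mono_iff_pullback by blast
  from on_pullback[OF this] show ?thesis
    using m cod_cat.mono_iff_pullback[of "On_arr F m"] by (simp add: On_Ide)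
qed

text \<open>The product is the pullback over the terminal object, hence \<open>F\<close> takes its projections to a jointly monic pair.\<close>

lemma mono_tuple_pr:
  assumes "has_product C x y"
  shows "mono_arr D (tuple D (On_arr F (pr1 C x y)) (On_arr F (pr2 C x y)))"
proof -
  note p = source.pr_arr[OF assms]
  let ?p = "On_arr F (pr1 C x y)" and ?q = "On_arr F (pr2 C x y)"
  have pq: "?p \<in> Arr D" "?q \<in> Arr D" "Dom D ?p = Dom D ?q"
    using p by auto
  note t = target.tuple[OF pq] and h = target.pr_arr[OF target.has_product_of_span[OF pq]]
  obtain t0 where t0: "terminal_obj C t0"
    using source.has_terminal by blast
  have xy: "x \<in> Obj C" "y \<in> Obj C"
    using p dom_cat.dom_cod_obj(2) by metis+
  then obtain tx ty where tx: "tx \<in> hom C x t0" and ty: "ty \<in> hom C y t0"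
    using t0 unfolding terminal_obj_def by metis
  have "is_pullback C tx ty (pr1 C x y) (pr2 C x y)"
    using source.prod_cone[OF assms] source.product_iff_pullback[OF t0 tx ty] by blast
  note P = on_pullback[OF this]
  show ?thesis
    unfolding mono_arr_def
  proof (intro conjI ballI impI)
    fix u v
    assume uv: "u \<in> Arr D" "v \<in> Arr D" "Dom D u = Dom D v" "Cod D u = Dom D (tuple D ?p ?q)"
      "Cod D v = Dom D (tuple D ?p ?q)" "tuple D ?p ?q \<cdot>\<^bsub>D\<^esub> u = tuple D ?p ?q \<cdot>\<^bsub>D\<^esub> v"
    have "?p \<cdot>\<^bsub>D\<^esub> w = pr1 D (Cod D ?p) (Cod D ?q) \<cdot>\<^bsub>D\<^esub> (tuple D ?p ?q \<cdot>\<^bsub>D\<^esub> w)"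
      "?q \<cdot>\<^bsub>D\<^esub> w = pr2 D (Cod D ?p) (Cod D ?q) \<cdot>\<^bsub>D\<^esub> (tuple D ?p ?q \<cdot>\<^bsub>D\<^esub> w)"
      if "w \<in> Arr D" "Cod D w = Dom D (tuple D ?p ?q)" for w
      using cod_cat.comp_cong[OF t(4), of w] cod_cat.comp_cong[OF t(5), of w] that t(1-3) h by auto
    then have "?p \<cdot>\<^bsub>D\<^esub> u = ?p \<cdot>\<^bsub>D\<^esub> v" "?q \<cdot>\<^bsub>D\<^esub> u = ?q \<cdot>\<^bsub>D\<^esub> v"
      using uv by metis+
    then show "u = v"
      using uv(1-5) t(2) by - (rule cod_cat.pullback_jointly_mono[OF P], auto)
  qed (fact t)
qed

text \<open>The embedding of \<open>F(r)\<close> is a composite of two monomorphisms and equals the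
  tuple of the images of the legs. That span is thus its own image, with coefficient 1.\<close>

lemma single_rel_image:
  assumes "r \<in> relations C x y"
  shows "Poly_Mapping.single (rel_image C D F x y r) 1 =
    span_class D \<delta>' (On_arr F (leg1 C x y r)) (On_arr F (leg2 C x y r))"
proof -
  note R = source.relation[OF assms]
  note p = source.pr_arr[OF R(1)]
  have r: "rep r \<in> Arr C" "Cod C (rep r) = prod_obj C x y"
    using dom_cat.mono_arr_arr[OF R(2)] source.tuple(3)[OF R(4,5)] R by auto
  have "On_arr F (leg1 C x y r) = On_arr F (pr1 C x y) \<cdot>\<^bsub>D\<^esub> On_arr F (rep r)"
    "On_arr F (leg2 C x y r) = On_arr F (pr2 C x y) \<cdot>\<^bsub>D\<^esub> On_arr F (rep r)"
    using p r by (simp_all add: leg1_def leg2_def on_comp)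
  then have t: "tuple D (On_arr F (leg1 C x y r)) (On_arr F (leg2 C x y r)) =
      tuple D (On_arr F (pr1 C x y)) (On_arr F (pr2 C x y)) \<cdot>\<^bsub>D\<^esub> On_arr F (rep r)"
    using p r target.tuple_comp[of "On_arr F (pr1 C x y)" "On_arr F (pr2 C x y)" "On_arr F (rep r)"] by simp
  moreover have "mono_arr D (tuple D (On_arr F (pr1 C x y)) (On_arr F (pr2 C x y)) \<cdot>\<^bsub>D\<^esub> On_arr F (rep r))"
    using p r R target.tuple(2)[of "On_arr F (pr1 C x y)" "On_arr F (pr2 C x y)"]
    by (intro cod_cat.mono_comp on_mono mono_tuple_pr) auto
  ultimately show ?thesis
    using R target.span_class_mono[of "On_arr F (leg1 C x y r)" "On_arr F (leg2 C x y r)"]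
    by (simp add: rel_image_def)
qed

text \<open>The epimorphism from a span onto its image goes to an epimorphism of the same degree, so
  the scalar is the right one after applying \<open>F\<close>. Preservation of degrees enters
  here.\<close>

lemma rel_map_span_class:
  assumes "f \<in> Arr C" "g \<in> Arr C" "Dom C f = Dom C g" "Cod C f = x" "Cod C g = y"
  shows "rel_map C D F x y (span_class C \<delta> f g) = span_class D \<delta>' (On_arr F f) (On_arr F g)"
proof -
  obtain r e where r: "r \<in> relations C x y" and e: "epi_arr C e" "Dom C e = Dom C f"
    "Cod C e = Dom C (rep r)" "f = leg1 C x y r \<cdot>\<^bsub>C\<^esub> e" "g = leg2 C x y r \<cdot>\<^bsub>C\<^esub> e"
    and fg: "span_class C \<delta> f g = Poly_Mapping.single r (\<delta> e)"
    using source.span_class_cases[of f g] assms by metis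
  note R = source.relation[OF r]
  have ea: "e \<in> Arr C"
    using e(1) by (rule dom_cat.epi_arr_arr)
  have "rel_map C D F x y (span_class C \<delta> f g) =
      scale (\<delta> e) (span_class D \<delta>' (On_arr F (leg1 C x y r)) (On_arr F (leg2 C x y r)))"
    by (simp add: rel_map_def fg flip: single_rel_image[OF r])
  also have "\<dots> = span_class D \<delta>' (On_arr F (leg1 C x y r) \<cdot>\<^bsub>D\<^esub> On_arr F e) (On_arr F (leg2 C x y r) \<cdot>\<^bsub>D\<^esub> On_arr F e)"
    using R e ea by (subst target.span_class_epi) (auto simp: on_epi on_degree)
  also have "\<dots> = span_class D \<delta>' (On_arr F f) (On_arr F g)"
    using R e ea by (simp add: on_comp)
  finally show ?thesis .
qed

lemma keys_rel_map:
  fixes a :: "'m set \<Rightarrow>\<^sub>0 'k"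
  assumes "Poly_Mapping.keys a \<subseteq> relations C x y"
  shows "Poly_Mapping.keys (rel_map C D F x y a) \<subseteq> relations D (On_obj F x) (On_obj F y)"
  unfolding rel_map_def
proof (rule keys_lin)
  fix r assume "r \<in> Poly_Mapping.keys a"
  then have r: "r \<in> relations C x y"
    using assms by auto
  show "Poly_Mapping.keys (Poly_Mapping.single (rel_image C D F x y r) (1::'k)) \<subseteq> relations D (On_obj F x) (On_obj F y)"
    unfolding single_rel_image[OF r] using source.relation[OF r]
    by (intro target.keys_span_class) auto
qed

text \<open>If the pullback exists, its square is preserved. If it does not, the second clause of
  \<open>preserves_pullbacks\<close> excludes one after applying \<open>F\<close>, and both sides
  vanish.\<close>

lemma rel_map_lin_comp:
  assumes "Poly_Mapping.keys a \<subseteq> relations C x y" "Poly_Mapping.keys b \<subseteq> relations C y z"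
  shows "rel_map C D F x z (lin_comp C \<delta> x y z a b) =
    lin_comp D \<delta>' (On_obj F x) (On_obj F y) (On_obj F z) (rel_map C D F x y a) (rel_map C D F y z b)"
proof -
  have "rel_map C D F x z (rel_comp C \<delta> x y z r s) =
      lin_comp D \<delta>' (On_obj F x) (On_obj F y) (On_obj F z) (Poly_Mapping.single (rel_image C D F x y r) 1)
        (Poly_Mapping.single (rel_image C D F y z s) 1)"
    if r: "r \<in> relations C x y" and s: "s \<in> relations C y z" for r s
  proof -
    note R = source.relation[OF r] and S = source.relation[OF s]
    show ?thesis
    proof (cases "has_pullback C (leg2 C x y r) (leg1 C y z s)")
      case True
      then obtain p q where P: "is_pullback C (leg2 C x y r) (leg1 C y z s) p q"
        unfolding has_pullback_def by blast
      note c = dom_cat.comm_squareD[OF dom_cat.pullback_comm[OF P]]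
      have "rel_map C D F x z (rel_comp C \<delta> x y z r s) =
          span_class D \<delta>' (On_arr F (leg1 C x y r) \<cdot>\<^bsub>D\<^esub> On_arr F p) (On_arr F (leg2 C y z s) \<cdot>\<^bsub>D\<^esub> On_arr F q)"
        unfolding source.rel_comp_pullback[OF r s P] using R S c by (simp add: rel_map_span_class on_comp)
      also have "\<dots> = lin_comp D \<delta>' (On_obj F x) (On_obj F y) (On_obj F z)
          (span_class D \<delta>' (On_arr F (leg1 C x y r)) (On_arr F (leg2 C x y r)))
          (span_class D \<delta>' (On_arr F (leg1 C y z s)) (On_arr F (leg2 C y z s)))"
        using R S by (intro target.span_comp[OF on_pullback[OF P], symmetric]) auto
      finally show ?thesis
        by (simp add: single_rel_image r s)
    next
      case False
      then have "\<not> has_pullback D (On_arr F (leg2 C x y r)) (On_arr F (leg1 C y z s))"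
        using on_has_pullback R S by metis
      then show ?thesis
        using False R S by (simp add: rel_comp_def single_rel_image r s target.span_comp_zero rel_map_def)
    qed
  qed
  then show ?thesis
    unfolding lin_comp_def rel_map_def lin_lin using assms
    by (auto intro!: lin_cong simp: subset_iff)
qed

lemma T0_additive_functor: "additive_functor (T0 C \<delta>) (T0 D \<delta>') (T0_ftor C D F)"
proof -
  interpret S: preadditive "T0 C \<delta>"
    by (rule source.T0_preadditive)
  interpret T: preadditive "T0 D \<delta>'"
    by (rule target.T0_preadditive)
  show ?thesis
  proof unfold_locales
    fix x assume "x \<in> Obj (T0 C \<delta>)"
    then show "On_obj (T0_ftor C D F) x \<in> Obj (T0 D \<delta>')"
      by (simp add: T0_simps T0_ftor_simps On_obj)
  next
    fix f x y assume "f \<in> hom (T0 C \<delta>) x y"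
    then show "On_arr (T0_ftor C D F) f \<in> hom (T0 D \<delta>') (On_obj (T0_ftor C D F) x) (On_obj (T0_ftor C D F) y)"
      by (auto simp: hom_T0 T0_ftor_simps On_obj dest: keys_rel_map[THEN subsetD, rotated])
  next
    fix x assume "x \<in> Obj (T0 C \<delta>)"
    then show "On_arr (T0_ftor C D F) (Ide (T0 C \<delta>) x) = Ide (T0 D \<delta>') (On_obj (T0_ftor C D F) x)"
      by (simp add: T0_simps(1) source.T0_Ide target.T0_Ide T0_ftor_simps On_obj rel_map_span_class On_Ide)
  next
    fix f g x y z assume "f \<in> hom (T0 C \<delta>) x y" "g \<in> hom (T0 C \<delta>) y z"
    then show "On_arr (T0_ftor C D F) (g \<cdot>\<^bsub>T0 C \<delta>\<^esub> f) =
        On_arr (T0_ftor C D F) g \<cdot>\<^bsub>T0 D \<delta>'\<^esub> On_arr (T0_ftor C D F) f"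
      by (auto simp: hom_T0 T0_simps T0_ftor_simps rel_map_lin_comp)
  qed (auto simp: hom_T0 T0_simps T0_ftor_simps rel_map_def lin_add)
qed

end

section \<open>The adjunction between the categories \<open>T0\<close>\<close>

locale cartesian_adjunction = adjunction C D L R \<eta> \<epsilon> + left: degree_functor C D L \<delta> \<delta>' +
  right: degree_functor D C R \<delta>' \<delta>
  for C :: "('o, 'm, 'z) cat_scheme" and D :: "('p, 'n, 'w) cat_scheme"
    and L :: "('o, 'm, 'p, 'n) ftor" and R :: "('p, 'n, 'o, 'm) ftor"
    and \<eta> :: "'o \<Rightarrow> 'm" and \<epsilon> :: "'p \<Rightarrow> 'n"
    and \<delta> :: "'m \<Rightarrow> 'k::field" and \<delta>' :: "'n \<Rightarrow> 'k" +
  assumes unit_cartesian: "f \<in> hom C x y \<Longrightarrow> is_pullback C (\<eta> y) (On_arr R (On_arr L f)) f (\<eta> x)"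
    and counit_cartesian: "g \<in> hom D u v \<Longrightarrow> is_pullback D (\<epsilon> v) g (On_arr L (On_arr R g)) (\<epsilon> u)"
begin

definition T0_unit :: "'o \<Rightarrow> ('o, 'm, 'k) rel_arr" where
  "T0_unit x = (x, On_obj R (On_obj L x), span_class C \<delta> (Ide C x) (\<eta> x))"

definition T0_counit :: "'p \<Rightarrow> ('p, 'n, 'k) rel_arr" where
  "T0_counit y = (On_obj L (On_obj R y), y, span_class D \<delta>' (Ide D (On_obj L (On_obj R y))) (\<epsilon> y))"

text \<open>On a relation \<open>r\<close> with legs \<open>f\<close>, \<open>g\<close> both sides are the class of the span with legs \<open>f\<close> and
  \<open>\<eta> \<circ> g\<close>; for \<open>RL(r) \<circ> \<eta>\<close> this is the Cartesian naturality square of \<open>f\<close>.\<close>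

lemma T0_unit_natural:
  assumes "Poly_Mapping.keys a \<subseteq> relations C x y"
  shows "lin_comp C \<delta> x y (On_obj R (On_obj L y)) a (span_class C \<delta> (Ide C y) (\<eta> y)) =
    lin_comp C \<delta> x (On_obj R (On_obj L x)) (On_obj R (On_obj L y)) (span_class C \<delta> (Ide C x) (\<eta> x))
      (rel_map D C R (On_obj L x) (On_obj L y) (rel_map C D L x y a))"
proof -
  let ?H = "\<lambda>x. On_obj R (On_obj L x)" and ?h = "\<lambda>f. On_arr R (On_arr L f)"
  have "lin_comp C \<delta> x y (?H y) (Poly_Mapping.single r 1) (span_class C \<delta> (Ide C y) (\<eta> y)) =
      lin_comp C \<delta> x (?H x) (?H y) (span_class C \<delta> (Ide C x) (\<eta> x))
        (rel_map D C R (On_obj L x) (On_obj L y) (rel_map C D L x y (Poly_Mapping.single r 1)))"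
    if r: "r \<in> relations C x y" for r
  proof -
    note S = left.source.relation[OF r]
    let ?f = "leg1 C x y r" and ?g = "leg2 C x y r"
    let ?w = "Dom C ?g"
    note u = unit_arr[OF S(11)] unit_arr[OF S(12)] unit_arr[of ?w]
    have "lin_comp C \<delta> x y (?H y) (span_class C \<delta> ?f ?g) (span_class C \<delta> (Ide C y) (\<eta> y)) =
        span_class C \<delta> ?f (\<eta> y \<cdot>\<^bsub>C\<^esub> ?g)"
      using S u by (intro left.source.comp_graph) auto
    also have "\<dots> = span_class C \<delta> (Ide C x \<cdot>\<^bsub>C\<^esub> ?f) (?h ?g \<cdot>\<^bsub>C\<^esub> \<eta> ?w)"
      using S u unit_natural[of ?g] by simp
    also have "\<dots> = lin_comp C \<delta> x (?H x) (?H y) (span_class C \<delta> (Ide C x) (\<eta> x)) (span_class C \<delta> (?h ?f) (?h ?g))"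
      using S u unit_cartesian[of ?f ?w x]
      by (intro left.source.span_comp[symmetric]) (auto simp: hom_def)
    finally show ?thesis
      using S by (simp add: left.rel_map_span_class right.rel_map_span_class
          flip: left.source.span_class_relation[OF r])
  qed
  then show ?thesis
    using assms unfolding rel_map_def
    by (subst lin_comp_left) (auto intro!: lin_cong simp: lin_lin lin_comp_lin_right)
qed

text \<open>For a relation with legs \<open>f\<close> and \<open>g\<close>, both sides are the class
  of the span with legs \<open>LR(f)\<close> and \<open>g\<close> after \<open>\<epsilon>\<close>.
  On the left this is plain naturality at \<open>g\<close>; on the right the Cartesian square at
  \<open>f\<close> supplies the pullback.\<close>

lemma T0_counit_natural:
  assumes "Poly_Mapping.keys a \<subseteq> relations D x y"
  shows "lin_comp D \<delta>' (On_obj L (On_obj R x)) (On_obj L (On_obj R y)) y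
      (rel_map C D L (On_obj R x) (On_obj R y) (rel_map D C R x y a))
      (span_class D \<delta>' (Ide D (On_obj L (On_obj R y))) (\<epsilon> y)) =
    lin_comp D \<delta>' (On_obj L (On_obj R x)) x y (span_class D \<delta>' (Ide D (On_obj L (On_obj R x))) (\<epsilon> x)) a"
proof -
  let ?H = "\<lambda>x. On_obj L (On_obj R x)" and ?h = "\<lambda>f. On_arr L (On_arr R f)"
  have "lin_comp D \<delta>' (?H x) (?H y) y
        (rel_map C D L (On_obj R x) (On_obj R y) (rel_map D C R x y (Poly_Mapping.single r 1)))
        (span_class D \<delta>' (Ide D (?H y)) (\<epsilon> y)) =
      lin_comp D \<delta>' (?H x) x y (span_class D \<delta>' (Ide D (?H x)) (\<epsilon> x)) (Poly_Mapping.single r 1)"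
    if r: "r \<in> relations D x y" for r
  proof -
    note S = left.target.relation[OF r]
    let ?f = "leg1 D x y r" and ?g = "leg2 D x y r"
    let ?w = "Dom D ?g"
    note u = counit_arr[OF S(11)] counit_arr[OF S(12)] counit_arr[of ?w]
    have "lin_comp D \<delta>' (?H x) (?H y) y (span_class D \<delta>' (?h ?f) (?h ?g)) (span_class D \<delta>' (Ide D (?H y)) (\<epsilon> y)) =
        span_class D \<delta>' (?h ?f) (\<epsilon> y \<cdot>\<^bsub>D\<^esub> ?h ?g)"
      using S u by (intro left.target.comp_graph) auto
    also have "\<dots> = span_class D \<delta>' (Ide D (?H x) \<cdot>\<^bsub>D\<^esub> ?h ?f) (?g \<cdot>\<^bsub>D\<^esub> \<epsilon> ?w)"
      using S u counit_natural[of ?g] by simp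
    also have "\<dots> = lin_comp D \<delta>' (?H x) x y (span_class D \<delta>' (Ide D (?H x)) (\<epsilon> x)) (span_class D \<delta>' ?f ?g)"
      using S u counit_cartesian[of ?f ?w x] left.On_obj[OF right.On_obj[OF S(11)]]
      by (intro left.target.span_comp[symmetric]) (auto simp: hom_def)
    finally show ?thesis
      using S by (simp add: left.rel_map_span_class right.rel_map_span_class
          flip: left.target.span_class_relation[OF r])
  qed
  then show ?thesis
    using assms unfolding rel_map_def
    by (subst lin_comp_right[of D \<delta>' _ x y _ a]) (auto intro!: lin_cong simp: lin_lin lin_comp_lin_left)
qed

theorem T0_adjunction:
  "adjunction (T0 C \<delta>) (T0 D \<delta>') (T0_ftor C D L) (T0_ftor D C R) T0_unit T0_counit"
proof (rule adjunctionI)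
  show "cat_functor (T0 C \<delta>) (T0 D \<delta>') (T0_ftor C D L)" "cat_functor (T0 D \<delta>') (T0 C \<delta>) (T0_ftor D C R)"
    using left.T0_additive_functor right.T0_additive_functor additive_functor.axioms(1) by blast+
  note simps = T0_ftor_simps T0_simps(8) T0_unit_def T0_counit_def
  fix x assume "x \<in> Obj (T0 C \<delta>)"
  then have x: "x \<in> Obj C" "On_obj L x \<in> Obj D" "On_obj R (On_obj L x) \<in> Obj C"
    "On_obj L (On_obj R (On_obj L x)) \<in> Obj D"
    by (simp_all add: T0_simps left.On_obj right.On_obj)
  note u = unit_arr[OF x(1)] and v = counit_arr[OF x(2)]
  show "T0_unit x \<in> hom (T0 C \<delta>) x (On_obj (T0_ftor D C R) (On_obj (T0_ftor C D L) x))"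
    using x u left.source.keys_span_class[of "Ide C x" "\<eta> x" x "On_obj R (On_obj L x)"]
    by (auto simp: hom_T0 simps)
  have "rel_map C D L x (On_obj R (On_obj L x)) (span_class C \<delta> (Ide C x) (\<eta> x)) =
      span_class D \<delta>' (Ide D (On_obj L x)) (On_arr L (\<eta> x))"
    using x u by (simp add: left.rel_map_span_class left.On_Ide)
  moreover have "lin_comp D \<delta>' (On_obj L x) (On_obj L (On_obj R (On_obj L x))) (On_obj L x)
      (span_class D \<delta>' (Ide D (On_obj L x)) (On_arr L (\<eta> x)))
      (span_class D \<delta>' (Ide D (On_obj L (On_obj R (On_obj L x)))) (\<epsilon> (On_obj L x))) =
      span_class D \<delta>' (Ide D (On_obj L x)) (Ide D (On_obj L x))"
    using x u v triangle_left[OF x(1)] by (subst left.target.comp_graph) auto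
  ultimately show "T0_counit (On_obj (T0_ftor C D L) x) \<cdot>\<^bsub>T0 D \<delta>'\<^esub> On_arr (T0_ftor C D L) (T0_unit x) =
      Ide (T0 D \<delta>') (On_obj (T0_ftor C D L) x)"
    using x by (simp add: simps left.target.T0_Ide)
next
  note simps = T0_ftor_simps T0_simps(8) T0_unit_def T0_counit_def
  fix y assume "y \<in> Obj (T0 D \<delta>')"
  then have y: "y \<in> Obj D" "On_obj R y \<in> Obj C" "On_obj L (On_obj R y) \<in> Obj D"
    "On_obj R (On_obj L (On_obj R y)) \<in> Obj C"
    by (simp_all add: T0_simps left.On_obj right.On_obj)
  note u = unit_arr[OF y(2)] and v = counit_arr[OF y(1)]
  show "T0_counit y \<in> hom (T0 D \<delta>') (On_obj (T0_ftor C D L) (On_obj (T0_ftor D C R) y)) y"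
    using y v left.target.keys_span_class[of "Ide D (On_obj L (On_obj R y))" "\<epsilon> y" "On_obj L (On_obj R y)" y]
    by (auto simp: hom_T0 simps)
  have "rel_map D C R (On_obj L (On_obj R y)) y (span_class D \<delta>' (Ide D (On_obj L (On_obj R y))) (\<epsilon> y)) =
      span_class C \<delta> (Ide C (On_obj R (On_obj L (On_obj R y)))) (On_arr R (\<epsilon> y))"
    using y v by (simp add: right.rel_map_span_class right.On_Ide)
  moreover have "lin_comp C \<delta> (On_obj R y) (On_obj R (On_obj L (On_obj R y))) (On_obj R y)
      (span_class C \<delta> (Ide C (On_obj R y)) (\<eta> (On_obj R y)))
      (span_class C \<delta> (Ide C (On_obj R (On_obj L (On_obj R y)))) (On_arr R (\<epsilon> y))) =
      span_class C \<delta> (Ide C (On_obj R y)) (Ide C (On_obj R y))"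
    using y u v triangle_right[OF y(1)] by (subst left.source.comp_graph) auto
  ultimately show "On_arr (T0_ftor D C R) (T0_counit y) \<cdot>\<^bsub>T0 C \<delta>\<^esub> T0_unit (On_obj (T0_ftor D C R) y) =
      Ide (T0 C \<delta>) (On_obj (T0_ftor D C R) y)"
    using y by (simp add: simps left.source.T0_Ide)
qed (auto simp: hom_T0 T0_ftor_simps T0_simps(8) T0_unit_def T0_counit_def T0_unit_natural T0_counit_natural)

end

section \<open>Adjunctions of additive completions\<close>

lemma Hsum_simps [simp]:
  "Hsum C x y [] = Hzero C x y" "Hsum C x y (f # fs) = Hadd C f (Hsum C x y fs)"
  by (simp_all add: Hsum_def)

section \<open>Finite sums in hom-sets\<close>

context preadditive
begin

lemma Hsum_hom:
  assumes "x \<in> Obj C" "y \<in> Obj C"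
  shows "(\<And>k. k \<in> set ks \<Longrightarrow> f k \<in> hom C x y) \<Longrightarrow> Hsum C x y (map f ks) \<in> hom C x y"
  by (induction ks) (auto intro: Hadd_hom Hzero_hom assms)

lemma comp_Hsum:
  assumes "x \<in> Obj C" "y \<in> Obj C" "h \<in> hom C y z"
  shows "(\<And>k. k \<in> set ks \<Longrightarrow> f k \<in> hom C x y) \<Longrightarrow>
    h \<cdot> Hsum C x y (map f ks) = Hsum C x z (map (\<lambda>k. h \<cdot> f k) ks)"
  using assms by (induction ks) (simp_all add: comp_Hzero comp_Hadd[OF _ Hsum_hom])

lemma Hsum_comp:
  assumes "y \<in> Obj C" "z \<in> Obj C" "h \<in> hom C x y"
  shows "(\<And>k. k \<in> set ks \<Longrightarrow> f k \<in> hom C y z) \<Longrightarrow>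
    Hsum C y z (map f ks) \<cdot> h = Hsum C x z (map (\<lambda>k. f k \<cdot> h) ks)"
  using assms by (induction ks) (simp_all add: Hzero_comp Hadd_comp[OF _ _ Hsum_hom])

lemma zero_Hadd: "f \<in> hom C x y \<Longrightarrow> x \<in> Obj C \<Longrightarrow> y \<in> Obj C \<Longrightarrow> Hadd C (Hzero C x y) f = f"
  using Hadd_commute[OF Hzero_hom] Hadd_zero by simp

lemma Hsum_zero:
  assumes "x \<in> Obj C" "y \<in> Obj C"
  shows "(\<And>k. k \<in> set ks \<Longrightarrow> f k = Hzero C x y) \<Longrightarrow> Hsum C x y (map f ks) = Hzero C x y"
  using assms by (induction ks) (simp_all add: Hadd_zero Hzero_hom)

lemma Hadd_left_commute:
  assumes "f \<in> hom C x y" "g \<in> hom C x y" "h \<in> hom C x y"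
  shows "Hadd C f (Hadd C g h) = Hadd C g (Hadd C f h)"
  using Hadd_assoc[OF assms] Hadd_assoc[OF assms(2,1,3)] Hadd_commute[OF assms(1,2)] by simp

lemma Hsum_Hadd:
  assumes "x \<in> Obj C" "y \<in> Obj C"
  shows "(\<And>k. k \<in> set ks \<Longrightarrow> f k \<in> hom C x y \<and> g k \<in> hom C x y) \<Longrightarrow>
    Hsum C x y (map (\<lambda>k. Hadd C (f k) (g k)) ks) = Hadd C (Hsum C x y (map f ks)) (Hsum C x y (map g ks))"
proof (induction ks)
  case Nil
  show ?case
    using assms by (simp add: Hadd_zero Hzero_hom)
next
  case (Cons k ks)
  let ?F = "Hsum C x y (map f ks)" and ?G = "Hsum C x y (map g ks)"
  have "?F \<in> hom C x y" "?G \<in> hom C x y"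
    using Cons.prems assms by (auto intro: Hsum_hom)
  with Cons show ?case
    by (simp add: Hadd_assoc[of _ x y] Hadd_left_commute[of "g k" x y ?F] Hadd_hom)
qed

text \<open>The interchange of sums behind associativity of matrix multiplication.\<close>

lemma Hsum_swap:
  assumes "x \<in> Obj C" "y \<in> Obj C"
  shows "(\<And>k l. k \<in> set ks \<Longrightarrow> l \<in> set ls \<Longrightarrow> f k l \<in> hom C x y) \<Longrightarrow>
    Hsum C x y (map (\<lambda>k. Hsum C x y (map (f k) ls)) ks) =
    Hsum C x y (map (\<lambda>l. Hsum C x y (map (\<lambda>k. f k l) ks)) ls)"
proof (induction ks)
  case Nil
  show ?case
    using Hsum_zero[OF assms, of ls "\<lambda>l. Hzero C x y"] by simp
next
  case (Cons k ks)
  then show ?case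
    using assms by (simp add: Hsum_Hadd Hsum_hom)
qed

text \<open>Collapses the sums that arise from multiplying by a diagonal matrix.\<close>

lemma Hsum_single:
  assumes "x \<in> Obj C" "y \<in> Obj C" "f i \<in> hom C x y"
  shows "distinct ks \<Longrightarrow> i \<in> set ks \<Longrightarrow> (\<And>k. k \<in> set ks \<Longrightarrow> k \<noteq> i \<Longrightarrow> f k = Hzero C x y) \<Longrightarrow>
    Hsum C x y (map f ks) = f i"
proof (induction ks)
  case (Cons k ks)
  show ?case
  proof (cases "k = i")
    case True
    then have "Hsum C x y (map f ks) = Hzero C x y"
      using Cons.prems by (intro Hsum_zero assms) auto
    then show ?thesis
      using True assms by (simp add: Hadd_zero)
  next
    case False
    then show ?thesis
      using Cons assms by (simp add: zero_Hadd)
  qed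
qed simp

end

lemma (in additive_functor) On_Hsum:
  assumes "x \<in> Obj C" "y \<in> Obj C"
  shows "(\<And>k. k \<in> set ks \<Longrightarrow> f k \<in> hom C x y) \<Longrightarrow>
    On_arr F (Hsum C x y (map f ks)) = Hsum D (On_obj F x) (On_obj F y) (map (\<lambda>k. On_arr F (f k)) ks)"
  using assms by (induction ks) (simp_all add: On_Hzero On_Hadd[OF _ source.Hsum_hom])

text \<open>\<open>mk_mat\<close> overwrites all entries outside the index range, so comparison
  inside it suffices.\<close>

lemma mk_mat_cong:
  "(\<And>i j. i < length Y \<Longrightarrow> j < length X \<Longrightarrow> M i j = N i j) \<Longrightarrow> mk_mat X Y M = mk_mat X Y N"
  by (auto simp: mk_mat_def fun_eq_iff)

text \<open>Entries of a product read their factors inside the index range only, so the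
  normalisation by \<open>mk_mat\<close> disappears from both factors.\<close>

lemma additive_completion_simps:
  "Obj (additive_completion C) = lists (Obj C)"
  "Dom (additive_completion C) (mk_mat X Y M) = X" "Cod (additive_completion C) (mk_mat X Y M) = Y"
  "Ide (additive_completion C) X = mk_mat X X (\<lambda>i j. if i = j then Ide C (X ! i) else Hzero C (X ! j) (X ! i))"
  "Comp (additive_completion C) (mk_mat Y Z N) (mk_mat X Y M) =
    mk_mat X Z (\<lambda>i j. Hsum C (X ! j) (Z ! i) (map (\<lambda>k. N i k \<cdot>\<^bsub>C\<^esub> M k j) [0..<length Y]))"
  by (auto simp: additive_completion_def mk_mat_def fun_eq_iff
      intro!: arg_cong[where f = "Hsum C u v" for u v])

text \<open>Only entries in range are constrained: \<open>M\<close> may be any function that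
  represents the normalised arrow \<open>mk_mat X Y M\<close>.\<close>

definition matrix :: "('o, 'm, 'z) cat_scheme \<Rightarrow> 'o list \<Rightarrow> 'o list \<Rightarrow> (nat \<Rightarrow> nat \<Rightarrow> 'm) \<Rightarrow> bool" where
  "matrix C X Y M \<longleftrightarrow> X \<in> lists (Obj C) \<and> Y \<in> lists (Obj C) \<and>
     (\<forall>i < length Y. \<forall>j < length X. M i j \<in> hom C (X ! j) (Y ! i))"

lemma matrixD:
  assumes "matrix C X Y M"
  shows "j < length X \<Longrightarrow> X ! j \<in> Obj C" "i < length Y \<Longrightarrow> Y ! i \<in> Obj C"
    "i < length Y \<Longrightarrow> j < length X \<Longrightarrow> M i j \<in> hom C (X ! j) (Y ! i)"
    "X \<in> lists (Obj C)" "Y \<in> lists (Obj C)"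
  using assms by (auto simp: matrix_def)

lemma hom_additive_completion:
  "f \<in> hom (additive_completion C) X Y \<longleftrightarrow> (\<exists>M. f = mk_mat X Y M \<and> matrix C X Y M)"
  by (auto simp: additive_completion_def hom_def mk_mat_def matrix_def fun_eq_iff)

lemma mk_mat_hom [simp]: "mk_mat X Y M \<in> hom (additive_completion C) X Y \<longleftrightarrow> matrix C X Y M"
  unfolding hom_additive_completion by (auto simp: mk_mat_def matrix_def fun_eq_iff)

text \<open>The common form of identities, units and counits; \<open>X\<close> and \<open>Y\<close>
  have equal length in all uses.\<close>

definition diag :: "('o, 'm, 'z) preadd_cat_scheme \<Rightarrow> 'o list \<Rightarrow> 'o list \<Rightarrow> (nat \<Rightarrow> 'm) \<Rightarrow> ('o, 'm) mat_arr" where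
  "diag C X Y \<tau> = mk_mat X Y (\<lambda>i j. if i = j then \<tau> i else Hzero C (X ! j) (Y ! i))"

lemma additive_ftor_simps:
  "On_obj (additive_ftor F) = map (On_obj F)"
  "On_arr (additive_ftor F) (mk_mat X Y M) = mk_mat (map (On_obj F) X) (map (On_obj F) Y) (\<lambda>i j. On_arr F (M i j))"
  by (auto simp: additive_ftor_def mk_mat_def fun_eq_iff)

context preadditive
begin

lemma matrix_entry_comp:
  assumes "matrix C X Y M" "matrix C Y Z N" and "i < length Z" "k < length Y" "j < length X"
  shows "N i k \<cdot> M k j \<in> hom C (X ! j) (Z ! i)"
  using matrixD(3)[OF assms(1,4,5)] matrixD(3)[OF assms(2,3,4)] by (rule Comp_in_hom)

lemma matrix_comp:
  assumes "matrix C X Y M" "matrix C Y Z N"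
  shows "matrix C X Z (\<lambda>i j. Hsum C (X ! j) (Z ! i) (map (\<lambda>k. N i k \<cdot> M k j) [0..<length Y]))"
  unfolding matrix_def using matrixD[OF assms(1)] matrixD[OF assms(2)]
  by (auto intro!: Hsum_hom matrix_entry_comp[OF assms])

lemma diag_hom:
  assumes "X \<in> lists (Obj C)" "Y \<in> lists (Obj C)" "length X = length Y"
    "\<And>i. i < length X \<Longrightarrow> \<tau> i \<in> hom C (X ! i) (Y ! i)"
  shows "diag C X Y \<tau> \<in> hom (additive_completion C) X Y"
  using assms by (auto simp: diag_def matrix_def intro!: Hzero_hom)

text \<open>In each entry only the summand with matching index survives. Naturality for matrices
  thereby becomes naturality entry by entry.\<close>

lemma diag_comp:
  assumes M: "matrix C X Y M" and "Z \<in> lists (Obj C)" "length Y = length Z"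
    and \<tau>: "\<And>i. i < length Y \<Longrightarrow> \<tau> i \<in> hom C (Y ! i) (Z ! i)"
  shows "diag C Y Z \<tau> \<cdot>\<^bsub>additive_completion C\<^esub> mk_mat X Y M = mk_mat X Z (\<lambda>i j. \<tau> i \<cdot> M i j)"
  unfolding diag_def additive_completion_simps
proof (rule mk_mat_cong)
  fix i j assume ij: "i < length Z" "j < length X"
  note m = matrixD[OF M]
  have Z: "Z ! i \<in> Obj C"
    using assms(2) ij by auto
  let ?f = "\<lambda>k. (if i = k then \<tau> i else Hzero C (Y ! k) (Z ! i)) \<cdot> M k j"
  have "?f k = Hzero C (X ! j) (Z ! i)" if "k < length Y" "k \<noteq> i" for k
    using that ij m Z by (simp add: Hzero_comp)
  moreover have "?f i \<in> hom C (X ! j) (Z ! i)"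
    using ij assms(3) Comp_in_hom[OF m(3) \<tau>] by simp
  ultimately have "Hsum C (X ! j) (Z ! i) (map ?f [0..<length Y]) = ?f i"
    using ij m Z assms(3) by (intro Hsum_single) auto
  then show "Hsum C (X ! j) (Z ! i) (map ?f [0..<length Y]) = \<tau> i \<cdot> M i j"
    by simp
qed

lemma comp_diag:
  assumes N: "matrix C Y Z N" and "X \<in> lists (Obj C)" "length X = length Y"
    and \<tau>: "\<And>i. i < length X \<Longrightarrow> \<tau> i \<in> hom C (X ! i) (Y ! i)"
  shows "mk_mat Y Z N \<cdot>\<^bsub>additive_completion C\<^esub> diag C X Y \<tau> = mk_mat X Z (\<lambda>i j. N i j \<cdot> \<tau> j)"
  unfolding diag_def additive_completion_simps
proof (rule mk_mat_cong)
  fix i j assume ij: "i < length Z" "j < length X"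
  note m = matrixD[OF N]
  have X: "X ! j \<in> Obj C"
    using assms(2) ij by auto
  let ?f = "\<lambda>k. N i k \<cdot> (if k = j then \<tau> k else Hzero C (X ! j) (Y ! k))"
  have "?f k = Hzero C (X ! j) (Z ! i)" if "k < length Y" "k \<noteq> j" for k
    using that ij m X by (simp add: comp_Hzero)
  moreover have "?f j \<in> hom C (X ! j) (Z ! i)"
    using ij assms(3) Comp_in_hom[OF \<tau> m(3)] by simp
  ultimately have "Hsum C (X ! j) (Z ! i) (map ?f [0..<length Y]) = ?f j"
    using ij m X assms(3) by (intro Hsum_single) auto
  then show "Hsum C (X ! j) (Z ! i) (map ?f [0..<length Y]) = N i j \<cdot> \<tau> j"
    by simp
qed

lemma Ide_additive_completion: "Ide (additive_completion C) X = diag C X X (\<lambda>i. Ide C (X ! i))"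
  by (simp add: diag_def additive_completion_simps)

lemma additive_completion_comp_assoc:
  assumes "matrix C W X M" "matrix C X Y N" "matrix C Y Z P"
  shows "(mk_mat Y Z P \<cdot>\<^bsub>additive_completion C\<^esub> mk_mat X Y N) \<cdot>\<^bsub>additive_completion C\<^esub> mk_mat W X M =
    mk_mat Y Z P \<cdot>\<^bsub>additive_completion C\<^esub> (mk_mat X Y N \<cdot>\<^bsub>additive_completion C\<^esub> mk_mat W X M)"
  unfolding additive_completion_simps
proof (rule mk_mat_cong)
  fix i j assume ij: "i < length Z" "j < length W"
  note m = matrixD[OF assms(1)] and n = matrixD[OF assms(2)] and p = matrixD[OF assms(3)]
  let ?S = "Hsum C (W ! j) (Z ! i)"
  have "?S (map (\<lambda>k. Hsum C (X ! k) (Z ! i) (map (\<lambda>l. P i l \<cdot> N l k) [0..<length Y]) \<cdot> M k j) [0..<length X]) =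
      ?S (map (\<lambda>k. ?S (map (\<lambda>l. (P i l \<cdot> N l k) \<cdot> M k j) [0..<length Y])) [0..<length X])"
    using ij m n p by (intro arg_cong[where f = ?S] map_cong refl Hsum_comp)
      (auto intro: matrix_entry_comp[OF assms(2,3)])
  also have "\<dots> = ?S (map (\<lambda>l. ?S (map (\<lambda>k. (P i l \<cdot> N l k) \<cdot> M k j) [0..<length X])) [0..<length Y])"
    using ij m n p by (intro Hsum_swap) (auto intro!: Comp_in_hom[OF m(3) matrix_entry_comp[OF assms(2,3)]])
  also have "\<dots> = ?S (map (\<lambda>l. ?S (map (\<lambda>k. P i l \<cdot> (N l k \<cdot> M k j)) [0..<length X])) [0..<length Y])"
    using ij m n p by (intro arg_cong[where f = ?S] map_cong refl Comp_assoc) auto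
  also have "\<dots> = ?S (map (\<lambda>l. P i l \<cdot> Hsum C (W ! j) (Y ! l) (map (\<lambda>k. N l k \<cdot> M k j) [0..<length X])) [0..<length Y])"
    using ij m n p by (intro arg_cong[where f = ?S] map_cong refl comp_Hsum[symmetric])
      (auto intro: matrix_entry_comp[OF assms(1,2)])
  finally show "?S (map (\<lambda>k. Hsum C (X ! k) (Z ! i) (map (\<lambda>l. P i l \<cdot> N l k) [0..<length Y]) \<cdot> M k j) [0..<length X]) =
    ?S (map (\<lambda>l. P i l \<cdot> Hsum C (W ! j) (Y ! l) (map (\<lambda>k. N l k \<cdot> M k j) [0..<length X])) [0..<length Y])" .
qed

lemma additive_completion_category: "category (additive_completion C)"
proof
  fix X assume "X \<in> Obj (additive_completion C)"
  then show "Ide (additive_completion C) X \<in> hom (additive_completion C) X X"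
    unfolding Ide_additive_completion additive_completion_simps(1)
    by (intro diag_hom) (auto intro: Ide_in_hom)
next
  fix f g X Y Z
  assume "f \<in> hom (additive_completion C) X Y" "g \<in> hom (additive_completion C) Y Z"
  then obtain M N where "f = mk_mat X Y M" "matrix C X Y M" "g = mk_mat Y Z N" "matrix C Y Z N"
    unfolding hom_additive_completion by auto
  then show "g \<cdot>\<^bsub>additive_completion C\<^esub> f \<in> hom (additive_completion C) X Z"
    using matrix_comp by (simp add: additive_completion_simps)
next
  fix f X Y
  assume "f \<in> hom (additive_completion C) X Y"
  then obtain M where f: "f = mk_mat X Y M" and M: "matrix C X Y M"
    unfolding hom_additive_completion by auto
  note m = matrixD[OF M]
  show "f \<cdot>\<^bsub>additive_completion C\<^esub> Ide (additive_completion C) X = f"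
    unfolding f Ide_additive_completion using m
    by (subst comp_diag[OF M]) (auto intro!: mk_mat_cong Ide_in_hom Comp_Ide)
  show "Ide (additive_completion C) Y \<cdot>\<^bsub>additive_completion C\<^esub> f = f"
    unfolding f Ide_additive_completion using m
    by (subst diag_comp[OF M]) (auto intro!: mk_mat_cong Ide_in_hom Ide_Comp)
next
  fix f g h W X Y Z
  assume "f \<in> hom (additive_completion C) W X" "g \<in> hom (additive_completion C) X Y"
    "h \<in> hom (additive_completion C) Y Z"
  then show "(h \<cdot>\<^bsub>additive_completion C\<^esub> g) \<cdot>\<^bsub>additive_completion C\<^esub> f =
      h \<cdot>\<^bsub>additive_completion C\<^esub> (g \<cdot>\<^bsub>additive_completion C\<^esub> f)"
    unfolding hom_additive_completion using additive_completion_comp_assoc by blast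
qed (auto simp: additive_completion_def)

end

section \<open>Induced functors on matrices\<close>

context additive_functor
begin

lemma matrix_map:
  assumes "matrix C X Y M"
  shows "matrix D (map (On_obj F) X) (map (On_obj F) Y) (\<lambda>i j. On_arr F (M i j))"
  using matrixD[OF assms] by (auto simp: matrix_def On_obj intro!: On_arr)

lemma additive_ftor_diag:
  assumes "X \<in> lists (Obj C)" "Y \<in> lists (Obj C)"
  shows "On_arr (additive_ftor F) (diag C X Y \<tau>) = diag D (map (On_obj F) X) (map (On_obj F) Y) (\<lambda>i. On_arr F (\<tau> i))"
  unfolding diag_def additive_ftor_simps
  by (rule mk_mat_cong) (use assms in \<open>auto simp: On_Hzero\<close>)

lemma additive_ftor_functor: "cat_functor (additive_completion C) (additive_completion D) (additive_ftor F)"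
proof -
  interpret S: category "additive_completion C"
    by (rule source.additive_completion_category)
  interpret T: category "additive_completion D"
    by (rule target.additive_completion_category)
  show ?thesis
  proof
    fix X assume "X \<in> Obj (additive_completion C)"
    then show "On_obj (additive_ftor F) X \<in> Obj (additive_completion D)"
      by (auto simp: additive_completion_simps additive_ftor_simps On_obj)
  next
    fix f X Y assume "f \<in> hom (additive_completion C) X Y"
    then show "On_arr (additive_ftor F) f \<in>
        hom (additive_completion D) (On_obj (additive_ftor F) X) (On_obj (additive_ftor F) Y)"
      unfolding hom_additive_completion[of f] by (auto simp: additive_ftor_simps matrix_map)
  next
    fix X assume "X \<in> Obj (additive_completion C)"
    then show "On_arr (additive_ftor F) (Ide (additive_completion C) X) =
        Ide (additive_completion D) (On_obj (additive_ftor F) X)"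
      unfolding additive_completion_simps additive_ftor_simps
      by (intro mk_mat_cong) (auto simp: On_Ide On_Hzero)
  next
    fix f g X Y Z assume "f \<in> hom (additive_completion C) X Y" "g \<in> hom (additive_completion C) Y Z"
    then obtain M N where f: "f = mk_mat X Y M" "matrix C X Y M" and g: "g = mk_mat Y Z N" "matrix C Y Z N"
      unfolding hom_additive_completion by auto
    note m = matrixD[OF f(2)] and n = matrixD[OF g(2)]
    show "On_arr (additive_ftor F) (g \<cdot>\<^bsub>additive_completion C\<^esub> f) =
        On_arr (additive_ftor F) g \<cdot>\<^bsub>additive_completion D\<^esub> On_arr (additive_ftor F) f"
      unfolding f(1) g(1) additive_completion_simps additive_ftor_simps
    proof (rule mk_mat_cong)
      fix i j assume ij: "i < length (map (On_obj F) Z)" "j < length (map (On_obj F) X)"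
      have "On_arr F (Hsum C (X ! j) (Z ! i) (map (\<lambda>k. N i k \<cdot>\<^bsub>C\<^esub> M k j) [0..<length Y])) =
          Hsum D (On_obj F (X ! j)) (On_obj F (Z ! i)) (map (\<lambda>k. On_arr F (N i k \<cdot>\<^bsub>C\<^esub> M k j)) [0..<length Y])"
        using ij m n by (intro On_Hsum) (auto intro: source.matrix_entry_comp[OF f(2) g(2)])
      also have "map (\<lambda>k. On_arr F (N i k \<cdot>\<^bsub>C\<^esub> M k j)) [0..<length Y] =
          map (\<lambda>k. On_arr F (N i k) \<cdot>\<^bsub>D\<^esub> On_arr F (M k j)) [0..<length Y]"
        using ij m n by (intro map_cong refl On_Comp) auto
      finally show "On_arr F (Hsum C (X ! j) (Z ! i) (map (\<lambda>k. N i k \<cdot>\<^bsub>C\<^esub> M k j) [0..<length Y])) =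
          Hsum D (map (On_obj F) X ! j) (map (On_obj F) Z ! i)
            (map (\<lambda>k. On_arr F (N i k) \<cdot>\<^bsub>D\<^esub> On_arr F (M k j)) [0..<length (map (On_obj F) Y)])"
        using ij by simp
    qed
  qed
qed

end

text \<open>Since unit and counit are diagonal, every law reduces to the same law for single
  entries; off the diagonal the triangle identities hold because composition preserves zero.\<close>

lemma additive_adjunction:
  assumes "adjunction C D L R \<eta> \<epsilon>" and "additive_functor C D L" and "additive_functor D C R"
  shows "adjunction (additive_completion C) (additive_completion D) (additive_ftor L) (additive_ftor R)
    (\<lambda>X. diag C X (map (On_obj R) (map (On_obj L) X)) (\<lambda>i. \<eta> (X ! i)))
    (\<lambda>Y. diag D (map (On_obj L) (map (On_obj R) Y)) Y (\<lambda>i. \<epsilon> (Y ! i)))"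
proof -
  interpret adjunction C D L R \<eta> \<epsilon> by fact
  interpret L: additive_functor C D L by fact
  interpret R: additive_functor D C R by fact
  note unit = unit.component[simplified] and counit = counit.component[simplified]
  show ?thesis
  proof (rule adjunctionI[OF L.additive_ftor_functor R.additive_ftor_functor])
    fix X assume "X \<in> Obj (additive_completion C)"
    then have X: "X \<in> lists (Obj C)" "map (On_obj L) X \<in> lists (Obj D)"
      "map (On_obj R) (map (On_obj L) X) \<in> lists (Obj C)"
      "map (On_obj L) (map (On_obj R) (map (On_obj L) X)) \<in> lists (Obj D)"
      by (auto simp: additive_completion_simps left.On_obj right.On_obj)
    show "diag C X (map (On_obj R) (map (On_obj L) X)) (\<lambda>i. \<eta> (X ! i)) \<in>
        hom (additive_completion C) X (On_obj (additive_ftor R) (On_obj (additive_ftor L) X))"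
      unfolding additive_ftor_simps by (rule L.source.diag_hom) (use X in \<open>auto intro: unit\<close>)
    let ?Y = "map (On_obj L) X"
    \<comment> \<open>The image of the unit is diagonal as well, but is presented as a general
      matrix so that \<open>diag_comp\<close> applies to the product.\<close>
    have M: "matrix D ?Y (map (On_obj L) (map (On_obj R) ?Y))
        (\<lambda>i j. if i = j then On_arr L (\<eta> (X ! i)) else Hzero D (?Y ! j) (map (On_obj L) (map (On_obj R) ?Y) ! i))"
      unfolding matrix_def using X by (auto intro!: left.On_arr unit L.target.Hzero_hom)
    have "diag D (map (On_obj L) (map (On_obj R) ?Y)) ?Y (\<lambda>i. \<epsilon> (?Y ! i)) \<cdot>\<^bsub>additive_completion D\<^esub>
        diag D ?Y (map (On_obj L) (map (On_obj R) ?Y)) (\<lambda>i. On_arr L (\<eta> (X ! i))) =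
        mk_mat ?Y ?Y (\<lambda>i j. \<epsilon> (?Y ! i) \<cdot>\<^bsub>D\<^esub> (if i = j then On_arr L (\<eta> (X ! i)) else
          Hzero D (?Y ! j) (map (On_obj L) (map (On_obj R) ?Y) ! i)))"
      unfolding diag_def[of D ?Y] by (rule L.target.diag_comp[OF M]) (use X in \<open>auto intro!: counit\<close>)
    also have "\<dots> = Ide (additive_completion D) ?Y"
      unfolding additive_completion_simps using X
      by (intro mk_mat_cong) (auto simp: triangle_left L.target.comp_Hzero[OF _ counit])
    finally show "diag D (map (On_obj L) (map (On_obj R) (On_obj (additive_ftor L) X))) (On_obj (additive_ftor L) X)
          (\<lambda>i. \<epsilon> (On_obj (additive_ftor L) X ! i)) \<cdot>\<^bsub>additive_completion D\<^esub>
        On_arr (additive_ftor L) (diag C X (map (On_obj R) (map (On_obj L) X)) (\<lambda>i. \<eta> (X ! i))) =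
        Ide (additive_completion D) (On_obj (additive_ftor L) X)"
      unfolding additive_ftor_simps L.additive_ftor_diag[OF X(1,3)] .
  next
    fix Y assume "Y \<in> Obj (additive_completion D)"
    then have Y: "Y \<in> lists (Obj D)" "map (On_obj R) Y \<in> lists (Obj C)"
      "map (On_obj L) (map (On_obj R) Y) \<in> lists (Obj D)"
      "map (On_obj R) (map (On_obj L) (map (On_obj R) Y)) \<in> lists (Obj C)"
      by (auto simp: additive_completion_simps left.On_obj right.On_obj)
    show "diag D (map (On_obj L) (map (On_obj R) Y)) Y (\<lambda>i. \<epsilon> (Y ! i)) \<in>
        hom (additive_completion D) (On_obj (additive_ftor L) (On_obj (additive_ftor R) Y)) Y"
      unfolding additive_ftor_simps by (rule L.target.diag_hom) (use Y in \<open>auto intro: counit\<close>)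
    let ?X = "map (On_obj R) Y"
    have M: "matrix C ?X (map (On_obj R) (map (On_obj L) ?X))
        (\<lambda>i j. if i = j then \<eta> (?X ! i) else Hzero C (?X ! j) (map (On_obj R) (map (On_obj L) ?X) ! i))"
      unfolding matrix_def using Y by (auto intro!: unit L.source.Hzero_hom)
    have "diag C (map (On_obj R) (map (On_obj L) ?X)) ?X (\<lambda>i. On_arr R (\<epsilon> (Y ! i))) \<cdot>\<^bsub>additive_completion C\<^esub>
        diag C ?X (map (On_obj R) (map (On_obj L) ?X)) (\<lambda>i. \<eta> (?X ! i)) =
        mk_mat ?X ?X (\<lambda>i j. On_arr R (\<epsilon> (Y ! i)) \<cdot>\<^bsub>C\<^esub> (if i = j then \<eta> (?X ! i) else
          Hzero C (?X ! j) (map (On_obj R) (map (On_obj L) ?X) ! i)))"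
      unfolding diag_def[of C ?X] by (rule L.source.diag_comp[OF M]) (use Y in \<open>auto intro!: right.On_arr counit\<close>)
    also have "\<dots> = Ide (additive_completion C) ?X"
      unfolding additive_completion_simps using Y
      by (intro mk_mat_cong) (auto simp: triangle_right L.source.comp_Hzero[OF _ right.On_arr[OF counit]])
    finally show "On_arr (additive_ftor R) (diag D (map (On_obj L) (map (On_obj R) Y)) Y (\<lambda>i. \<epsilon> (Y ! i)))
          \<cdot>\<^bsub>additive_completion C\<^esub>
        diag C (On_obj (additive_ftor R) Y) (map (On_obj R) (map (On_obj L) (On_obj (additive_ftor R) Y)))
          (\<lambda>i. \<eta> (On_obj (additive_ftor R) Y ! i)) =
        Ide (additive_completion C) (On_obj (additive_ftor R) Y)"
      unfolding additive_ftor_simps R.additive_ftor_diag[OF Y(3,1)] .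
  next
    fix X Y f assume "f \<in> hom (additive_completion C) X Y"
    then obtain M where f: "f = mk_mat X Y M" and M: "matrix C X Y M"
      unfolding hom_additive_completion by auto
    note m = matrixD[OF M] and RL = R.matrix_map[OF L.matrix_map[OF M]]
    have "diag C Y (map (On_obj R) (map (On_obj L) Y)) (\<lambda>i. \<eta> (Y ! i)) \<cdot>\<^bsub>additive_completion C\<^esub> f =
        mk_mat X (map (On_obj R) (map (On_obj L) Y)) (\<lambda>i j. \<eta> (Y ! i) \<cdot>\<^bsub>C\<^esub> M i j)"
      unfolding f using matrixD[OF RL] m by (intro L.source.diag_comp[OF M]) (auto intro: unit)
    also have "\<dots> = mk_mat X (map (On_obj R) (map (On_obj L) Y)) (\<lambda>i j. On_arr R (On_arr L (M i j)) \<cdot>\<^bsub>C\<^esub> \<eta> (X ! j))"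
      using m unit.natural by (intro mk_mat_cong) auto
    also have "\<dots> = On_arr (additive_ftor R) (On_arr (additive_ftor L) f) \<cdot>\<^bsub>additive_completion C\<^esub>
        diag C X (map (On_obj R) (map (On_obj L) X)) (\<lambda>i. \<eta> (X ! i))"
      unfolding f additive_ftor_simps using m
      by (intro L.source.comp_diag[OF RL, symmetric]) (auto intro: unit)
    finally show "diag C Y (map (On_obj R) (map (On_obj L) Y)) (\<lambda>i. \<eta> (Y ! i)) \<cdot>\<^bsub>additive_completion C\<^esub> f =
        On_arr (additive_ftor R) (On_arr (additive_ftor L) f) \<cdot>\<^bsub>additive_completion C\<^esub>
        diag C X (map (On_obj R) (map (On_obj L) X)) (\<lambda>i. \<eta> (X ! i))" .
  next
    fix X Y f assume "f \<in> hom (additive_completion D) X Y"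
    then obtain M where f: "f = mk_mat X Y M" and M: "matrix D X Y M"
      unfolding hom_additive_completion by auto
    note m = matrixD[OF M] and LR = L.matrix_map[OF R.matrix_map[OF M]]
    have "diag D (map (On_obj L) (map (On_obj R) Y)) Y (\<lambda>i. \<epsilon> (Y ! i)) \<cdot>\<^bsub>additive_completion D\<^esub>
        On_arr (additive_ftor L) (On_arr (additive_ftor R) f) =
        mk_mat (map (On_obj L) (map (On_obj R) X)) Y (\<lambda>i j. \<epsilon> (Y ! i) \<cdot>\<^bsub>D\<^esub> On_arr L (On_arr R (M i j)))"
      unfolding f additive_ftor_simps using m by (intro L.target.diag_comp[OF LR]) (auto intro: counit)
    also have "\<dots> = mk_mat (map (On_obj L) (map (On_obj R) X)) Y (\<lambda>i j. M i j \<cdot>\<^bsub>D\<^esub> \<epsilon> (X ! j))"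
      using m counit.natural by (intro mk_mat_cong) auto
    also have "\<dots> = f \<cdot>\<^bsub>additive_completion D\<^esub> diag D (map (On_obj L) (map (On_obj R) X)) X (\<lambda>i. \<epsilon> (X ! i))"
      unfolding f using m matrixD[OF LR] by (intro L.target.comp_diag[OF M, symmetric]) (auto intro: counit)
    finally show "diag D (map (On_obj L) (map (On_obj R) Y)) Y (\<lambda>i. \<epsilon> (Y ! i)) \<cdot>\<^bsub>additive_completion D\<^esub>
        On_arr (additive_ftor L) (On_arr (additive_ftor R) f) =
        f \<cdot>\<^bsub>additive_completion D\<^esub> diag D (map (On_obj L) (map (On_obj R) X)) X (\<lambda>i. \<epsilon> (X ! i))" .
  qed
qed

section \<open>Adjunctions of Karoubi completions\<close>

lemma karoubi_simps:
  "e \<in> Obj (karoubi C) \<longleftrightarrow> e \<in> Arr C \<and> Dom C e = Cod C e \<and> e \<cdot>\<^bsub>C\<^esub> e = e"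
  "Dom (karoubi C) (e, f, e') = e" "Cod (karoubi C) (e, f, e') = e'"
  "Ide (karoubi C) e = (e, e, e)"
  "Comp (karoubi C) (d', g, d) (e, f, e') = (e, g \<cdot>\<^bsub>C\<^esub> f, d)"
  by (auto simp: karoubi_def Let_def)

lemma Arr_karoubi: "(e, f, e') \<in> Arr (karoubi C) \<longleftrightarrow> e \<in> Obj (karoubi C) \<and> e' \<in> Obj (karoubi C) \<and>
    f \<in> Arr C \<and> Dom C f = Dom C e \<and> Cod C f = Dom C e' \<and> f \<cdot>\<^bsub>C\<^esub> e = f \<and> e' \<cdot>\<^bsub>C\<^esub> f = f"
  by (auto simp: karoubi_def Let_def hom_def)

lemma hom_karoubi: "x \<in> hom (karoubi C) e e' \<longleftrightarrow> (\<exists>f. x = (e, f, e') \<and> (e, f, e') \<in> Arr (karoubi C))"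
  by (cases x) (auto simp: hom_def karoubi_simps)

lemma karoubi_ftor_simps:
  "On_obj (karoubi_ftor F) = On_arr F"
  "On_arr (karoubi_ftor F) (e, f, e') = (On_arr F e, On_arr F f, On_arr F e')"
  by (simp_all add: karoubi_ftor_def)

lemma (in category) karoubi_category: "category (karoubi C)"
proof
  fix f g x y z
  assume "f \<in> hom (karoubi C) x y" "g \<in> hom (karoubi C) y z"
  then show "g \<cdot>\<^bsub>karoubi C\<^esub> f \<in> hom (karoubi C) x z"
    by (auto simp: hom_karoubi Arr_karoubi karoubi_simps comp_assoc comp_cong)
next
  fix f g h w x y z
  assume "f \<in> hom (karoubi C) w x" "g \<in> hom (karoubi C) x y" "h \<in> hom (karoubi C) y z"
  then show "(h \<cdot>\<^bsub>karoubi C\<^esub> g) \<cdot>\<^bsub>karoubi C\<^esub> f = h \<cdot>\<^bsub>karoubi C\<^esub> (g \<cdot>\<^bsub>karoubi C\<^esub> f)"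
    by (auto simp: hom_karoubi Arr_karoubi karoubi_simps comp_assoc)
qed (auto simp: hom_karoubi Arr_karoubi karoubi_simps)

lemma (in cat_functor) karoubi_functor: "cat_functor (karoubi C) (karoubi D) (karoubi_ftor F)"
proof -
  interpret S: category "karoubi C"
    by (rule dom_cat.karoubi_category)
  interpret T: category "karoubi D"
    by (rule cod_cat.karoubi_category)
  show ?thesis
    by unfold_locales
      (auto simp: hom_karoubi Arr_karoubi karoubi_simps karoubi_ftor_simps simp flip: on_comp)
qed

context adjunction
begin

text \<open>Arrows of the completion must absorb the idempotents at both ends. The bare unit need
  not do so, but its composite with \<open>e\<close> does: at the source by idempotence, at the
  target by naturality together with idempotence.\<close>

definition karoubi_unit :: "'m \<Rightarrow> 'm kar_arr" where
  "karoubi_unit e = (e, \<eta> (Dom C e) \<cdot>\<^bsub>C\<^esub> e, On_arr R (On_arr L e))"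

text \<open>The dual choice: \<open>e\<close> is absorbed at the target by idempotence, and its
  image under \<open>LR\<close> at the source by naturality of the counit.\<close>

definition karoubi_counit :: "'n \<Rightarrow> 'n kar_arr" where
  "karoubi_counit e = (On_arr L (On_arr R e), e \<cdot>\<^bsub>D\<^esub> \<epsilon> (Dom D e), e)"

theorem karoubi_adjunction:
  "adjunction (karoubi C) (karoubi D) (karoubi_ftor L) (karoubi_ftor R) karoubi_unit karoubi_counit"
proof (rule adjunctionI[OF left.karoubi_functor right.karoubi_functor])
  interpret KL: cat_functor "karoubi C" "karoubi D" "karoubi_ftor L"
    by (rule left.karoubi_functor)
  interpret KR: cat_functor "karoubi D" "karoubi C" "karoubi_ftor R"
    by (rule right.karoubi_functor)
  fix e assume E: "e \<in> Obj (karoubi C)"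
  then have e: "e \<in> Arr C" "Cod C e = Dom C e" "e \<cdot>\<^bsub>C\<^esub> e = e"
    by (auto simp: karoubi_simps)
  let ?x = "Dom C e"
  have x: "?x \<in> Obj C" "On_obj L ?x \<in> Obj D"
    using e left.On_obj by auto
  note u = unit_arr[OF x(1)] and v = counit_arr[OF x(2)]
  have ue: "On_arr R (On_arr L e) \<cdot>\<^bsub>C\<^esub> (\<eta> ?x \<cdot>\<^bsub>C\<^esub> e) = \<eta> ?x \<cdot>\<^bsub>C\<^esub> e"
    using unit_natural[OF e(1)] e u
    by (metis left.dom_cat.comp_assoc left.on_arr right.on_arr)
  show "karoubi_unit e \<in> hom (karoubi C) e (On_obj (karoubi_ftor R) (On_obj (karoubi_ftor L) e))"
  proof -
    have "On_arr R (On_arr L e) \<in> Obj (karoubi C)"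
      using KR.On_obj[OF KL.On_obj[OF E]] by (simp add: karoubi_ftor_simps)
    moreover have "(\<eta> ?x \<cdot>\<^bsub>C\<^esub> e) \<cdot>\<^bsub>C\<^esub> e = \<eta> ?x \<cdot>\<^bsub>C\<^esub> e"
      using e u by (simp add: left.dom_cat.comp_assoc)
    moreover have "\<eta> ?x \<cdot>\<^bsub>C\<^esub> e \<in> Arr C" "Dom C (\<eta> ?x \<cdot>\<^bsub>C\<^esub> e) = ?x"
      "Cod C (\<eta> ?x \<cdot>\<^bsub>C\<^esub> e) = Dom C (On_arr R (On_arr L e))"
      using e(1,2) u by simp_all
    ultimately show ?thesis
      using E ue unfolding karoubi_unit_def hom_karoubi Arr_karoubi karoubi_ftor_simps by blast
  qed
  \<comment> \<open>Regrouping exposes the triangle identity in the middle, which leaves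
    \<open>L e\<close> composed with itself.\<close>
  have "(On_arr L e \<cdot>\<^bsub>D\<^esub> \<epsilon> (On_obj L ?x)) \<cdot>\<^bsub>D\<^esub> (On_arr L (\<eta> ?x) \<cdot>\<^bsub>D\<^esub> On_arr L e) =
      On_arr L e \<cdot>\<^bsub>D\<^esub> ((\<epsilon> (On_obj L ?x) \<cdot>\<^bsub>D\<^esub> On_arr L (\<eta> ?x)) \<cdot>\<^bsub>D\<^esub> On_arr L e)"
    using e(1,2) u v by (simp add: left.cod_cat.comp_assoc)
  also have "\<dots> = On_arr L e"
    using e x left.on_comp[of e e] by (simp add: triangle_left)
  finally show "karoubi_counit (On_obj (karoubi_ftor L) e) \<cdot>\<^bsub>karoubi D\<^esub> On_arr (karoubi_ftor L) (karoubi_unit e) =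
      Ide (karoubi D) (On_obj (karoubi_ftor L) e)"
    using e u by (simp add: karoubi_unit_def karoubi_counit_def karoubi_ftor_simps karoubi_simps left.on_comp)
next
  interpret KL: cat_functor "karoubi C" "karoubi D" "karoubi_ftor L"
    by (rule left.karoubi_functor)
  interpret KR: cat_functor "karoubi D" "karoubi C" "karoubi_ftor R"
    by (rule right.karoubi_functor)
  fix e assume E: "e \<in> Obj (karoubi D)"
  then have e: "e \<in> Arr D" "Cod D e = Dom D e" "e \<cdot>\<^bsub>D\<^esub> e = e"
    by (auto simp: karoubi_simps)
  let ?y = "Dom D e"
  have y: "?y \<in> Obj D" "On_obj R ?y \<in> Obj C"
    using e right.On_obj by auto
  note u = unit_arr[OF y(2)] and v = counit_arr[OF y(1)]
  have ve: "(e \<cdot>\<^bsub>D\<^esub> \<epsilon> ?y) \<cdot>\<^bsub>D\<^esub> On_arr L (On_arr R e) = e \<cdot>\<^bsub>D\<^esub> \<epsilon> ?y"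
    using counit_natural[OF e(1)] e v
    by (metis left.cod_cat.comp_assoc left.on_arr right.on_arr)
  show "karoubi_counit e \<in> hom (karoubi D) (On_obj (karoubi_ftor L) (On_obj (karoubi_ftor R) e)) e"
  proof -
    have "On_arr L (On_arr R e) \<in> Obj (karoubi D)"
      using KL.On_obj[OF KR.On_obj[OF E]] by (simp add: karoubi_ftor_simps)
    moreover have "e \<cdot>\<^bsub>D\<^esub> (e \<cdot>\<^bsub>D\<^esub> \<epsilon> ?y) = e \<cdot>\<^bsub>D\<^esub> \<epsilon> ?y"
      using left.cod_cat.comp_cong[OF e(3)] e(1,2) v by simp
    moreover have "e \<cdot>\<^bsub>D\<^esub> \<epsilon> ?y \<in> Arr D" "Dom D (e \<cdot>\<^bsub>D\<^esub> \<epsilon> ?y) = Dom D (On_arr L (On_arr R e))"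
      "Cod D (e \<cdot>\<^bsub>D\<^esub> \<epsilon> ?y) = ?y"
      using e(1,2) v by simp_all
    ultimately show ?thesis
      using E ve unfolding karoubi_counit_def hom_karoubi Arr_karoubi karoubi_ftor_simps by blast
  qed
  have "(On_arr R e \<cdot>\<^bsub>C\<^esub> On_arr R (\<epsilon> ?y)) \<cdot>\<^bsub>C\<^esub> (\<eta> (On_obj R ?y) \<cdot>\<^bsub>C\<^esub> On_arr R e) =
      On_arr R e \<cdot>\<^bsub>C\<^esub> ((On_arr R (\<epsilon> ?y) \<cdot>\<^bsub>C\<^esub> \<eta> (On_obj R ?y)) \<cdot>\<^bsub>C\<^esub> On_arr R e)"
    using e(1,2) u v by (simp add: left.dom_cat.comp_assoc)
  also have "\<dots> = On_arr R e"
    using e y right.on_comp[of e e] by (simp add: triangle_right)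
  finally show "On_arr (karoubi_ftor R) (karoubi_counit e) \<cdot>\<^bsub>karoubi C\<^esub> karoubi_unit (On_obj (karoubi_ftor R) e) =
      Ide (karoubi C) (On_obj (karoubi_ftor R) e)"
    using e v by (simp add: karoubi_unit_def karoubi_counit_def karoubi_ftor_simps karoubi_simps right.on_comp)
next
  fix d e x assume "x \<in> hom (karoubi C) d e"
  then obtain f where x: "x = (d, f, e)" and f: "f \<in> Arr C" "d \<in> Arr C" "e \<in> Arr C" "Dom C f = Dom C d"
    "Cod C f = Dom C e" "Cod C d = Dom C d" "Cod C e = Dom C e" "f \<cdot>\<^bsub>C\<^esub> d = f" "e \<cdot>\<^bsub>C\<^esub> f = f"
    unfolding hom_karoubi Arr_karoubi karoubi_simps by metis
  note u = unit_arr[of "Dom C d"] unit_arr[of "Dom C e"]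
  have "(\<eta> (Dom C e) \<cdot>\<^bsub>C\<^esub> e) \<cdot>\<^bsub>C\<^esub> f = \<eta> (Dom C e) \<cdot>\<^bsub>C\<^esub> f"
    using f u by (simp add: left.dom_cat.comp_assoc)
  \<comment> \<open>Naturality moves \<open>\<eta>\<close> past \<open>f\<close>, and
    \<open>d\<close> is inserted by writing \<open>f\<close> as \<open>f \<cdot> d\<close>.\<close>
  also have "\<dots> = On_arr R (On_arr L f) \<cdot>\<^bsub>C\<^esub> (\<eta> (Dom C d) \<cdot>\<^bsub>C\<^esub> d)"
  proof -
    have "On_arr R (On_arr L f) \<cdot>\<^bsub>C\<^esub> (\<eta> (Dom C d) \<cdot>\<^bsub>C\<^esub> d) = \<eta> (Dom C e) \<cdot>\<^bsub>C\<^esub> (f \<cdot>\<^bsub>C\<^esub> d)"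
      using unit_natural[of f] f(1-7) u by (intro left.dom_cat.comp_square) auto
    then show ?thesis
      unfolding f(8) ..
  qed
  finally show "karoubi_unit e \<cdot>\<^bsub>karoubi C\<^esub> x =
      On_arr (karoubi_ftor R) (On_arr (karoubi_ftor L) x) \<cdot>\<^bsub>karoubi C\<^esub> karoubi_unit d"
    by (simp add: x karoubi_unit_def karoubi_ftor_simps karoubi_simps)
next
  fix d e x assume "x \<in> hom (karoubi D) d e"
  then obtain f where x: "x = (d, f, e)" and f: "f \<in> Arr D" "d \<in> Arr D" "e \<in> Arr D" "Dom D f = Dom D d"
    "Cod D f = Dom D e" "Cod D d = Dom D d" "Cod D e = Dom D e" "f \<cdot>\<^bsub>D\<^esub> d = f" "e \<cdot>\<^bsub>D\<^esub> f = f"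
    unfolding hom_karoubi Arr_karoubi karoubi_simps by metis
  note u = counit_arr[of "Dom D d"] counit_arr[of "Dom D e"]
  have "(e \<cdot>\<^bsub>D\<^esub> \<epsilon> (Dom D e)) \<cdot>\<^bsub>D\<^esub> On_arr L (On_arr R f) = e \<cdot>\<^bsub>D\<^esub> (f \<cdot>\<^bsub>D\<^esub> \<epsilon> (Dom D d))"
    using counit_natural[of f] f u by (simp add: left.cod_cat.comp_assoc)
  also have "\<dots> = f \<cdot>\<^bsub>D\<^esub> \<epsilon> (Dom D d)"
    using left.cod_cat.comp_cong[OF f(9)] f u by simp
  also have "\<dots> = f \<cdot>\<^bsub>D\<^esub> (d \<cdot>\<^bsub>D\<^esub> \<epsilon> (Dom D d))"
    using left.cod_cat.comp_cong[OF f(8)] f u by simp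
  finally show "karoubi_counit e \<cdot>\<^bsub>karoubi D\<^esub> On_arr (karoubi_ftor L) (On_arr (karoubi_ftor R) x) =
      x \<cdot>\<^bsub>karoubi D\<^esub> karoubi_counit d"
    by (simp add: x karoubi_counit_def karoubi_ftor_simps karoubi_simps)
qed

end

theorem proposition5p0p1:
  fixes A :: "('o, 'm) cat" and A' :: "('p, 'n) cat"
    and \<delta> :: "'m \<Rightarrow> 'k::field" and \<delta>' :: "'n \<Rightarrow> 'k"
    and F :: "('o, 'm, 'p, 'n) ftor" and G :: "('p, 'n, 'o, 'm) ftor"
    and \<eta> :: "'p \<Rightarrow> 'n" and \<epsilon> :: "'o \<Rightarrow> 'm"
  assumes "regular_category A" and "regular_category A'"
    and "degree_function A \<delta>" and "degree_function A' \<delta>'"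
    and "adjunction A' A G F \<eta> \<epsilon>"
    and "preserves_degree A \<delta> A' \<delta>' F" and "preserves_degree A' \<delta>' A \<delta> G"
    and "preserves_pullbacks A' A G"
    and "\<And>x' y' f'. f' \<in> hom A' x' y' \<Longrightarrow>
           is_pullback A' (\<eta> y') (On_arr F (On_arr G f')) f' (\<eta> x')"
    and "\<And>x y f. f \<in> hom A x y \<Longrightarrow>
           is_pullback A (\<epsilon> y) f (On_arr G (On_arr F f)) (\<epsilon> x)"
  shows "left_adjoint (T0 A' \<delta>') (T0 A \<delta>) (T0_ftor A' A G) (T0_ftor A A' F) \<and>
         left_adjoint (T A' \<delta>') (T A \<delta>) (T_ftor A' A G) (T_ftor A A' F)"
proof -
  interpret adjunction A' A G F \<eta> \<epsilon> by fact
  interpret A: degree_category A \<delta>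
    using assms by (intro degree_category.intro degree_category_axioms.intro)
  interpret A': degree_category A' \<delta>'
    using assms by (intro degree_category.intro degree_category_axioms.intro)
  \<comment> \<open>The left adjoint starts at \<open>A'\<close>, so \<open>A'\<close> and
    \<open>G\<close> take the parts of \<open>C\<close> and \<open>L\<close>. Preservation of
    pullbacks is a hypothesis for \<open>G\<close> and comes from
    \<open>right_adjoint_preserves_pullbacks\<close> for \<open>F\<close>.\<close>
  interpret cartesian_adjunction A' A G F \<eta> \<epsilon> \<delta>' \<delta>
    by unfold_locales (fact assms right_adjoint_preserves_pullbacks[OF assms(1)])+
  have 0: "adjunction (T0 A' \<delta>') (T0 A \<delta>) (T0_ftor A' A G) (T0_ftor A A' F) T0_unit T0_counit"
    by (rule T0_adjunction)
  have "left_adjoint (T A' \<delta>') (T A \<delta>) (T_ftor A' A G) (T_ftor A A' F)"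
    unfolding left_adjoint_def T_def T_ftor_def
    using adjunction.karoubi_adjunction[OF
        additive_adjunction[OF 0 left.T0_additive_functor right.T0_additive_functor]]
    by blast
  with 0 show ?thesis
    unfolding left_adjoint_def by blast
qed

end
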